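(* Let $s=\sigma+it\in\mathbb{C}$ with $0\le\sigma\le1$ and $t\in\mathbb{R}$, let $c$ be a real number with $c>-3/2$, and put $K=\dfrac{\pi^{1/4}}{2\,\Gamma(3/4)}$. Then: (II) if $c<-\sigma/2-1$ and $c<\sigma/2-3/2$, then $\xi(s)=K-1-J(s,c)$; (III) if $-\sigma/2-1<c<\sigma/2-3/2$, then $0=K-1-J(s,c)$; (V) if $\sigma/2-3/2<c<-\sigma/2-1$, then $0=K-1-J(s,c)$; (IV) if $c>-\sigma/2-1$ and $c>\sigma/2-3/2$, then $-\xi(s)=K-1-J(s,c)$.
   Context: $\zeta$ is the Riemann zeta function, $\Gamma$ the Gamma function, and $\xi$ is Riemann's function $\xi(s)=(s-1)\,\pi^{-s/2}\,\zeta(s)\,\Gamma(1+s/2)$ (an entire function, with removable singularities filled in), which satisfies $\xi(s)=\xi(1-s)$. For complex $s$ and real $c$, $$J(s,c)=\int_{-\infty}^{\infty}\pi^{c-iv}\,\zeta(-2c+2iv-2)\,\Gamma(-c+iv)\,M(c,s,v)\,dv,$$ $$M(c,s,v)=\frac{-(2s-1)^2/2+2iv-2(c+5/4)}{-(2s-1)^2/4+2i\bigl(2iv-4(c+5/4)\bigr)v+4(c+5/4)^2}.$$ Removable singularities of the product $\zeta(-2c+2iv-2)\,\Gamma(-c+iv)$ (poles of $\Gamma$ cancelled by trivial zeros of $\zeta$) are filled in by continuity. *)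

theory Defs
  imports "HOL-Complex_Analysis.Complex_Analysis"
begin

text \<open>
  The Riemann zeta function, as the analytic continuation of the Dirichlet series to the
  complex plane without the point 1. The value at the pole is fixed (arbitrarily) to be 0,
  so that exactly one function of type \<^typ>\<open>complex \<Rightarrow> complex\<close> has the stated properties.
\<close>

definition zeta :: "complex \<Rightarrow> complex" where
  "zeta = (THE f. f holomorphic_on (- {1}) \<and>
                  (\<forall>s. Re s > 1 \<longrightarrow> (\<lambda>n. of_nat (Suc n) powr (- s)) sums f s) \<and>
                  f 1 = 0)"

text \<open>
  In the following two definitions, \<^const>\<open>remove_sings\<close> replaces the value at each removable
  singularity by the limit there. It is needed because \<^const>\<open>Gamma\<close> is 0 at its poles and
  \<^const>\<open>zeta\<close> is 0 at 1.
\<close>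

definition riemann_xi :: "complex \<Rightarrow> complex" where
  "riemann_xi =
     remove_sings (\<lambda>s. (s - 1) * of_real pi powr (- s / 2) * zeta s * Gamma (1 + s / 2))"

text \<open>
  At \<open>z = -c + i v\<close> this is the product of the zeta and Gamma factors of the integrand of \<open>J\<close>.
\<close>

definition zeta_Gamma :: "complex \<Rightarrow> complex" where
  "zeta_Gamma = remove_sings (\<lambda>z. zeta (2 * z - 2) * Gamma z)"

definition M :: "real \<Rightarrow> complex \<Rightarrow> real \<Rightarrow> complex" where
  "M c s v =
     (- (2 * s - 1)\<^sup>2 / 2 + 2 * \<i> * of_real v - 2 * (of_real c + 5 / 4)) /
     (- (2 * s - 1)\<^sup>2 / 4
        + 2 * \<i> * (2 * \<i> * of_real v - 4 * (of_real c + 5 / 4)) * of_real v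
        + 4 * (of_real c + 5 / 4)\<^sup>2)"

definition J :: "complex \<Rightarrow> real \<Rightarrow> complex" where
  "J s c = (LINT v|lborel. of_real pi powr (of_real c - \<i> * of_real v)
                             * zeta_Gamma (- of_real c + \<i> * of_real v) * M c s v)"

end

theory Submission
  imports Defs "HOL-Probability.Probability" "HOL-Real_Asymp.Real_Asymp"
begin

text \<open>
  Put \<open>u = 2 z - 2\<close> with \<open>z = - c + i v\<close>. Then \<open>\<xi>(u) = (u - 1) \<pi>\<^sup>1\<^sup>-\<^sup>z \<zeta>(2 z - 2) \<Gamma>(z)\<close>, and
  the denominator of \<open>M\<close> factors as \<open>(u - s) (u - (1 - s))\<close>. By partial fractions the
  integrand of \<open>J\<close> becomes
  \<open>\<xi>(u) (2 / (u - 1) - 1 / (u - s) - 1 / (u - (1 - s))) / \<pi>\<close>,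
  so \<open>J s c\<close> is a combination of the line integrals
  \<open>L(b, a) = \<integral> \<xi>(b + i w) / (b + i w - a) dw\<close> over the line \<open>Re u = b\<close>, \<open>b = - 2 c - 2 < 1\<close>
  (lemma \<open>J_eq_xi_lines\<close>).

  Two properties of \<open>L\<close> give the four cases. By Cauchy's theorem \<open>L(b, a)\<close> depends on \<open>b\<close> only
  through the side of \<open>a\<close> on which the line lies, and crossing \<open>a\<close> from left to right adds
  \<open>2 \<pi> \<xi>(a)\<close> (\<open>xi_line_shift\<close>). The symmetry \<open>\<xi>(u) = \<xi>(1 - u)\<close> gives
  \<open>L(b, 1 - s) = - L(1 - b, s)\<close> (\<open>xi_line_reflect\<close>). Hence \<open>L(b, s) + L(b, 1 - s)\<close> is
  \<open>2 \<pi> \<xi>(s)\<close>, \<open>0\<close> or \<open>- 2 \<pi> \<xi>(s)\<close> according to which of the lines \<open>b\<close> and \<open>1 - b\<close> lie to the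
  right of \<open>s\<close>.

  The remaining constant is \<open>L(b, 1) = \<pi> (\<theta>(1) / 2 - 1)\<close> (\<open>xi_line_1\<close>), where
  \<open>\<theta>(x) = \<Sum>\<^sub>n exp (- \<pi> n\<^sup>2 x)\<close> over all integers \<open>n\<close>. It comes from Fourier inversion of Riemann's
  formula, in which \<open>2 \<xi>(u) / (u (u - 1))\<close> is the Mellin transform of \<open>(\<theta>(x) - 1) / 2\<close>
  at \<open>u / 2\<close>. The value \<open>\<theta>(1) = \<pi>\<^sup>1\<^sup>/\<^sup>4 / \<Gamma>(3/4)\<close> (\<open>theta_1\<close>) turns it into the constant \<open>K\<close>: the
  duplication formulas for theta functions are an arithmetic-geometric mean iteration,
  under which complete elliptic integrals are invariant, and the one belonging to \<open>\<theta>(1)\<close> is a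
  Beta integral.

  The analytic continuation of \<open>\<zeta>\<close> is obtained from Riemann's formula too: the functional
  equation of \<open>\<theta>\<close> (\<open>theta_inverse\<close>) makes \<open>\<xi>\<close> entire and symmetric, and \<open>\<zeta>\<close> is then read off from
  \<open>\<xi>\<close> (\<open>zeta_eq\<close>). Shifting the lines needs decay of \<open>\<xi>\<close> in vertical strips (\<open>entire_xi_decay\<close>):
  to the right of the critical strip it comes from the Gamma factor, and the
  Phragmen-Lindelof principle carries it across the strip.
\<close>

section \<open>Integrals over the real line\<close>

lemma has_bochner_integral_lborel_iff:
  fixes F :: "real \<Rightarrow> 'a :: euclidean_space"
  assumes A: "A \<in> sets borel" and F: "(\<lambda>x. indicator A x *\<^sub>R F x) \<in> borel_measurable borel"
  shows "has_bochner_integral lborel (\<lambda>x. indicator A x *\<^sub>R F x) I \<longleftrightarrow>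
         F absolutely_integrable_on A \<and> integral A F = I"
proof -
  have "F absolutely_integrable_on A \<longleftrightarrow> integrable lborel (\<lambda>x. indicator A x *\<^sub>R F x)"
    using integrable_completion[of "\<lambda>x. indicator A x *\<^sub>R F x" lborel] A F
    by (simp add: set_integrable_def)
  moreover have "integral A F = integral\<^sup>L lborel (\<lambda>x. indicator A x *\<^sub>R F x)"
    if "F absolutely_integrable_on A"
  proof -
    have "integral A F = set_lebesgue_integral lebesgue A F"
      using set_lebesgue_integral_eq_integral(2)[OF that] by simp
    also have "\<dots> = integral\<^sup>L lborel (\<lambda>x. indicator A x *\<^sub>R F x)"
      unfolding set_lebesgue_integral_def
      by (rule integral_completion) (use F in simp)
    finally show ?thesis .
  qed
  ultimately show ?thesis by (auto simp: has_bochner_integral_iff)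
qed

lemma has_bochner_integral_lborel_nonneg:
  fixes F :: "real \<Rightarrow> real"
  assumes A: "A \<in> sets borel" and F: "(\<lambda>x. indicator A x *\<^sub>R F x) \<in> borel_measurable borel"
    and "\<And>x. x \<in> A \<Longrightarrow> F x \<ge> 0" and "(F has_integral I) A"
  shows "has_bochner_integral lborel (\<lambda>x. indicator A x *\<^sub>R F x) I"
  using assms absolutely_integrable_on_iff_nonneg[of A F]
  by (subst has_bochner_integral_lborel_iff) (auto simp: has_integral_iff)

text \<open>
  Transferred from absolutely convergent gauge integrals: both integrands are Borel measurable, so
  the completion of the Lebesgue measure adds nothing.
\<close>

lemma has_bochner_integral_substitution:
  fixes f :: "real \<Rightarrow> 'a :: euclidean_space" and g h :: "real \<Rightarrow> real"
  assumes S: "S \<in> sets borel" "g ` S \<in> sets borel"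
    and der: "\<And>t. t \<in> S \<Longrightarrow> (g has_real_derivative h t) (at t)"
    and pos: "\<And>t. t \<in> S \<Longrightarrow> h t \<ge> 0"
    and inj: "inj_on g S"
    and meas: "(\<lambda>x. indicator (g ` S) x *\<^sub>R f x) \<in> borel_measurable borel"
              "(\<lambda>t. indicator S t *\<^sub>R (h t *\<^sub>R f (g t))) \<in> borel_measurable borel"
  shows "has_bochner_integral lborel (\<lambda>t. indicator S t *\<^sub>R (h t *\<^sub>R f (g t))) I \<longleftrightarrow>
         has_bochner_integral lborel (\<lambda>x. indicator (g ` S) x *\<^sub>R f x) I"
proof -
  have 1: "has_bochner_integral lborel (\<lambda>t. indicator S t *\<^sub>R (h t *\<^sub>R f (g t))) I \<longleftrightarrow>
        (\<lambda>t. h t *\<^sub>R f (g t)) absolutely_integrable_on S \<and> integral S (\<lambda>t. h t *\<^sub>R f (g t)) = I"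
    by (rule has_bochner_integral_lborel_iff) (use S meas in auto)
  have 2: "has_bochner_integral lborel (\<lambda>x. indicator (g ` S) x *\<^sub>R f x) I \<longleftrightarrow>
        f absolutely_integrable_on (g ` S) \<and> integral (g ` S) f = I"
    by (rule has_bochner_integral_lborel_iff) (use S meas in auto)
  have c1: "(\<lambda>t. h t *\<^sub>R f (g t)) absolutely_integrable_on S \<longleftrightarrow> (\<lambda>t. \<bar>h t\<bar> *\<^sub>R f (g t)) absolutely_integrable_on S"
    using pos by (intro set_integrable_cong) auto
  have c2: "integral S (\<lambda>t. h t *\<^sub>R f (g t)) = integral S (\<lambda>t. \<bar>h t\<bar> *\<^sub>R f (g t))"
    using pos by (intro integral_cong) auto
  show ?thesis unfolding 1 2 c1 c2
    by (rule has_absolute_integral_change_of_variables_real)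
       (use S der inj in \<open>auto intro: has_field_derivative_at_within\<close>)
qed

lemma integrable_inverse_square: "integrable lborel (\<lambda>t::real. 1 / (1 + t\<^sup>2))"
  and integral_inverse_square: "(LINT t|lborel. 1 / (1 + t\<^sup>2)) = pi"
  using integrable_inverse_1_plus_square LBINT_inverse_1_plus_square
  by (simp_all add: set_integrable_def interval_lebesgue_integral_def set_lebesgue_integral_def
        inverse_eq_divide)

lemma integrable_quadratic_decay:
  fixes f :: "real \<Rightarrow> 'a :: {banach, second_countable_topology}"
  assumes "f \<in> borel_measurable borel" "\<And>t. norm (f t) * (1 + t\<^sup>2) \<le> C"
  shows "integrable lborel f"
proof (rule Bochner_Integration.integrable_bound)
  show "integrable lborel (\<lambda>t. C * (1 / (1 + t\<^sup>2)))"
    by (intro integrable_mult_right integrable_inverse_square) 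
  show "AE t in lborel. norm (f t) \<le> norm (C * (1 / (1 + t\<^sup>2)))"
  proof (rule AE_I2)
    fix t :: real
    have p: "1 + t\<^sup>2 > 0" by (smt (verit) zero_le_power2)
    hence "norm (f t) \<le> C * (1 / (1 + t\<^sup>2))" using assms(2)[of t] by (simp add: field_simps)
    thus "norm (f t) \<le> norm (C * (1 / (1 + t\<^sup>2)))" unfolding real_norm_def by linarith
  qed
qed (use assms in auto)

lemma integral_Icc_tendsto:
  fixes f :: "real \<Rightarrow> 'a :: euclidean_space" and a b :: "nat \<Rightarrow> real"
  assumes f: "integrable lborel f" and a: "filterlim a at_bot sequentially" and b: "filterlim b at_top sequentially"
  shows "(\<lambda>n. integral {a n..b n} f) \<longlonglongrightarrow> integral\<^sup>L lborel f"
proof -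
  have [measurable]: "f \<in> borel_measurable borel" using f by auto
  have eq: "integral {a n..b n} f = (LINT t|lborel. indicator {a n..b n} t *\<^sub>R f t)" for n
  proof -
    have "set_integrable lborel {a n..b n} f"
      unfolding set_integrable_def by (intro integrable_mult_indicator f) auto
    from set_borel_integral_eq_integral(2)[OF this] show ?thesis
      by (simp add: set_lebesgue_integral_def)
  qed
  have "(\<lambda>n. LINT t|lborel. indicator {a n..b n} t *\<^sub>R f t) \<longlonglongrightarrow> integral\<^sup>L lborel f"
  proof (rule integral_dominated_convergence)
    show "integrable lborel (\<lambda>t. norm (f t))" using f by auto
    show "AE t in lborel. (\<lambda>n. indicator {a n..b n} t *\<^sub>R f t) \<longlonglongrightarrow> f t"
    proof (rule AE_I2)
      fix t :: real
      have "eventually (\<lambda>n. a n \<le> t) sequentially" "eventually (\<lambda>n. t \<le> b n) sequentially"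
        using a b by (auto simp: filterlim_at_top filterlim_at_bot)
      hence "eventually (\<lambda>n. indicator {a n..b n} t *\<^sub>R f t = f t) sequentially"
        by eventually_elim (auto simp: indicator_def)
      thus "(\<lambda>n. indicator {a n..b n} t *\<^sub>R f t) \<longlonglongrightarrow> f t"
        by (rule tendsto_eventually)
    qed
    show "AE t in lborel. norm (indicator {a n..b n} t *\<^sub>R f t) \<le> norm (f t)" for n
      by (rule AE_I2) (simp add: indicator_def)
  qed measurable
  thus ?thesis by (simp only: eq)
qed

text \<open>
  This is the characteristic function of the standard normal distribution, freed from its
  normalisation.
\<close>

lemma gaussian_iexp:
  fixes v :: real
  shows "has_bochner_integral lborel (\<lambda>x. of_real (exp (-x\<^sup>2/2)) * exp (\<i> * of_real (v * x)))
           (of_real (sqrt (2*pi) * exp (-v\<^sup>2/2)) :: complex)"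
proof -
  have int: "integrable lborel (\<lambda>x. of_real (exp (-x\<^sup>2/2)) * exp (\<i> * of_real (v * x)) :: complex)"
  proof (rule Bochner_Integration.integrable_bound)
    show "integrable lborel (\<lambda>x. sqrt (2*pi) * std_normal_density x)"
      by (intro integrable_mult_right integrable_normal_density) auto
  qed (auto simp: std_normal_density_def norm_mult)
  have "char std_normal_distribution v = (LINT x|lborel. std_normal_density x *\<^sub>R exp (\<i> * of_real (v * x)))"
    unfolding char_def by (subst integral_density) auto
  also have "\<dots> = (LINT x|lborel. (1 / sqrt (2*pi)) *\<^sub>R (of_real (exp (-x\<^sup>2/2)) * exp (\<i> * of_real (v * x))))"
    by (intro Bochner_Integration.integral_cong) (auto simp: std_normal_density_def scaleR_conv_of_real)
  also have "\<dots> = (1 / sqrt (2*pi)) *\<^sub>R (LINT x|lborel. of_real (exp (-x\<^sup>2/2)) * exp (\<i> * of_real (v * x)))"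
    by (rule Bochner_Integration.integral_scaleR_right) 
  finally have "(LINT x|lborel. of_real (exp (-x\<^sup>2/2)) * exp (\<i> * of_real (v * x))) =
     sqrt (2*pi) * complex_of_real (exp (-v\<^sup>2/2))"
    by (simp add: char_std_normal_distribution scaleR_conv_of_real field_simps)
  with int show ?thesis by (simp add: has_bochner_integral_iff)
qed

lemma gaussian_cos:
  fixes x w :: real assumes x: "x > 0"
  shows "has_bochner_integral lborel (\<lambda>t. exp (-pi*x*t\<^sup>2) * cos (2*pi*w*t))
           (exp (-pi*w\<^sup>2/x) / sqrt x)"
proof -
  define c where "c = sqrt (2*pi*x)"
  have c: "c > 0" "c\<^sup>2 = 2*pi*x" 
    unfolding c_def by (rule real_sqrt_gt_zero real_sqrt_pow2; use x in simp)+
  define v where "v = 2*pi*w/c"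
  have "has_bochner_integral lborel (\<lambda>t. Re (of_real (exp (-t\<^sup>2/2)) * exp (\<i> * of_real (v * t))))
          (Re (of_real (sqrt (2*pi) * exp (-v\<^sup>2/2))))"
    by (intro has_bochner_integral_Re gaussian_iexp)
  hence "has_bochner_integral lborel (\<lambda>t. exp (-t\<^sup>2/2) * cos (v * t)) (sqrt (2*pi) * exp (-v\<^sup>2/2))"
    by (simp add: Re_exp)
  hence "has_bochner_integral lborel (\<lambda>t. exp (-(0+c*t)\<^sup>2/2) * cos (v * (0+c*t))) ((sqrt (2*pi) * exp (-v\<^sup>2/2)) /\<^sub>R \<bar>c\<bar>)"
    by (rule iffD1[OF lborel_has_bochner_integral_real_affine_iff, rotated]) (use c in simp)
  moreover have "exp (-(0+c*t)\<^sup>2/2) * cos (v * (0+c*t)) = exp (-pi*x*t\<^sup>2) * cos (2*pi*w*t)" for t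
  proof -
    have "-(0+c*t)\<^sup>2/2 = -pi*x*t\<^sup>2" 
      unfolding add_0_left power_mult_distrib c(2) by algebra
    moreover have "v * (0+c*t) = 2*pi*w*t" using c(1) by (simp add: v_def)
    ultimately show ?thesis by (simp only:)
  qed
  moreover have "(sqrt (2*pi) * exp (-v\<^sup>2/2)) /\<^sub>R \<bar>c\<bar> = exp (-pi*w\<^sup>2/x) / sqrt x"
  proof -
    have "-v\<^sup>2/2 = -pi*w\<^sup>2/x" 
      unfolding v_def power_divide power_mult_distrib c(2) using x by (simp add: power2_eq_square)
    moreover have "sqrt (2*pi) / c = 1 / sqrt x" by (simp add: c_def real_sqrt_mult)
    moreover have "(sqrt (2*pi) * exp (-v\<^sup>2/2)) /\<^sub>R \<bar>c\<bar> = (sqrt (2*pi) / c) * exp (-v\<^sup>2/2)"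
      using c(1) by (simp add: field_simps)
    ultimately show ?thesis by (simp only: times_divide_eq_left mult_1)
  qed
  ultimately show ?thesis by (simp only:)
qed

text \<open>
  Inserting the factor \<open>exp (- (v / m)\<^sup>2 / 2)\<close> makes the double integral absolutely convergent.
  Fubini and the self-duality of the Gaussian then turn it into an average of \<open>h\<close> over a
  Gaussian of width \<open>1 / m\<close>, and letting \<open>m\<close> tend to infinity concentrates this average at \<open>0\<close>.
\<close>

lemma fourier_inversion_at_0:
  fixes h :: "real \<Rightarrow> complex"
  defines "H \<equiv> (\<lambda>v. LINT y|lborel. exp (\<i> * of_real (v * y)) * h y)"
  assumes int: "integrable lborel h" and bdd: "\<And>y. norm (h y) \<le> C" and cont: "isCont h 0"
    and H: "integrable lborel H"
  shows "(LINT v|lborel. H v) = 2 * pi * h 0"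
proof -
  have [measurable]: "h \<in> borel_measurable borel" "H \<in> borel_measurable borel" using int H by auto
  define g where "g = (\<lambda>w::real. exp (- w\<^sup>2 / 2))"
  have g_int: "has_bochner_integral lborel (\<lambda>w. complex_of_real (g w) * exp (\<i> * of_real (v * w))) (of_real (sqrt (2*pi) * g v))" for v
    unfolding g_def by (rule gaussian_iexp)
  have g_int0: "integrable lborel g" "(LINT w|lborel. complex_of_real (g w)) = sqrt (2 * pi)"
  proof -
    have *: "has_bochner_integral lborel (\<lambda>w. complex_of_real (g w)) (of_real (sqrt (2*pi)))"
      using g_int[of 0] by (simp add: g_def)
    thus "(LINT w|lborel. complex_of_real (g w)) = sqrt (2 * pi)" by (rule has_bochner_integral_integral_eq)
    from * show "integrable lborel g" by (simp add: has_bochner_integral_iff complex_of_real_integrable_eq)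
  qed
  have [measurable]: "g \<in> borel_measurable borel" unfolding g_def by measurable
  have key: "(LINT v|lborel. of_real (g (v / m)) * H v) = sqrt (2 * pi) * (LINT z|lborel. of_real (g z) * h (z / m))"
    if m: "m > 0" for m :: real
  proof -
    have gm: "integrable lborel (\<lambda>v. g (v / m))"
      using lborel_integrable_real_affine[OF g_int0(1), of "1/m" 0] m by simp
    have "integrable (lborel \<Otimes>\<^sub>M lborel) (\<lambda>(v, y). of_real (g (v / m)) * (exp (\<i> * of_real (v * y)) * h y))"
    proof (rule lborel_pair.Fubini_integrable)
      have "norm (of_real (g (v / m)) * (exp (\<i> * of_real (v * y)) * h y)) = g (v / m) * norm (h y)" for v y
        by (simp add: norm_mult g_def)
      hence "(\<lambda>v. LINT y|lborel. norm (case (v, y) of (v, y) \<Rightarrow> of_real (g (v / m)) * (exp (\<i> * of_real (v * y)) * h y))) =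
            (\<lambda>v. g (v / m) * (LINT y|lborel. norm (h y)))"
        by simp
      thus "integrable lborel (\<lambda>v. LINT y|lborel. norm (case (v, y) of (v, y) \<Rightarrow> of_real (g (v / m)) * (exp (\<i> * of_real (v * y)) * h y)))"
        using gm by simp
      show "AE v in lborel. integrable lborel (\<lambda>y. case (v, y) of (v, y) \<Rightarrow> of_real (g (v / m)) * (exp (\<i> * of_real (v * y)) * h y))"
      proof (rule AE_I2)
        fix v :: real
        have "integrable lborel (\<lambda>y. exp (\<i> * of_real (v * y)) * h y)"
          by (rule Bochner_Integration.integrable_bound[OF int]) (auto simp: norm_mult)
        thus "integrable lborel (\<lambda>y. case (v, y) of (v, y) \<Rightarrow> of_real (g (v / m)) * (exp (\<i> * of_real (v * y)) * h y))"
          by simp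
      qed
    qed measurable
    from lborel_pair.Fubini_integral[OF this]
    have "(LINT v|lborel. LINT y|lborel. of_real (g (v / m)) * (exp (\<i> * of_real (v * y)) * h y)) =
          (LINT y|lborel. LINT v|lborel. of_real (g (v / m)) * (exp (\<i> * of_real (v * y)) * h y))" by simp
    moreover have "(LINT y|lborel. of_real (g (v / m)) * (exp (\<i> * of_real (v * y)) * h y)) = of_real (g (v / m)) * H v" for v
      unfolding H_def by simp
    moreover have "(LINT v|lborel. of_real (g (v / m)) * (exp (\<i> * of_real (v * y)) * h y)) = (m * sqrt (2 * pi)) * (of_real (g (m * y)) * h y)" for y
    proof -
      have "(LINT v|lborel. of_real (g (v / m)) * (exp (\<i> * of_real (v * y)) * h y)) =
            \<bar>m\<bar> *\<^sub>R (LINT w|lborel. of_real (g ((0 + m * w) / m)) * (exp (\<i> * of_real ((0 + m * w) * y)) * h y))"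
        by (rule lborel_integral_real_affine) (use m in auto)
      also have "(\<lambda>w. of_real (g ((0 + m * w) / m)) * (exp (\<i> * of_real ((0 + m * w) * y)) * h y)) =
          (\<lambda>w. (of_real (g w) * exp (\<i> * of_real ((m * y) * w))) * h y)"
        using m by (simp add: mult_ac)
      also have "(LINT w|lborel. (of_real (g w) * exp (\<i> * of_real ((m * y) * w))) * h y) = of_real (sqrt (2*pi) * g (m * y)) * h y"
        using g_int[of "m * y"] unfolding has_bochner_integral_iff by simp
      finally show ?thesis using m by (simp add: scaleR_conv_of_real mult_ac)
    qed
    ultimately have "(LINT v|lborel. of_real (g (v / m)) * H v) = (LINT y|lborel. (m * sqrt (2 * pi)) * (of_real (g (m * y)) * h y))"
      by (simp only:)
    also have "\<dots> = \<bar>1/m\<bar> *\<^sub>R (LINT z|lborel. (m * sqrt (2 * pi)) * (of_real (g (m * (0 + (1/m) * z))) * h (0 + (1/m) * z)))"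
      by (rule lborel_integral_real_affine) (use m in auto)
    also have "\<dots> = \<bar>1/m\<bar> *\<^sub>R ((m * sqrt (2 * pi)) * (LINT z|lborel. of_real (g z) * h (z / m)))"
      using m by simp
    also have "\<dots> = sqrt (2 * pi) * (LINT z|lborel. of_real (g z) * h (z / m))"
      using m by (simp add: scaleR_conv_of_real)
    finally show ?thesis .
  qed
  have lim1: "(\<lambda>n. LINT v|lborel. of_real (g (v / real (Suc n))) * H v) \<longlonglongrightarrow> (LINT v|lborel. H v)"
  proof (rule integral_dominated_convergence)
    show "integrable lborel (\<lambda>v. norm (H v))" using H by auto
    show "AE v in lborel. (\<lambda>n. of_real (g (v / real (Suc n))) * H v) \<longlonglongrightarrow> H v"
    proof (rule AE_I2)
      fix v :: real
      have "(\<lambda>n. v / real (Suc n)) \<longlonglongrightarrow> 0" by real_asymp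
      hence "(\<lambda>n. g (v / real (Suc n))) \<longlonglongrightarrow> exp (- 0\<^sup>2 / 2)" unfolding g_def by (intro tendsto_intros) auto
      hence "(\<lambda>n. g (v / real (Suc n))) \<longlonglongrightarrow> 1" by simp
      hence "(\<lambda>n. complex_of_real (g (v / real (Suc n))) * H v) \<longlonglongrightarrow> of_real 1 * H v"
        by (intro tendsto_intros)
      thus "(\<lambda>n. of_real (g (v / real (Suc n))) * H v) \<longlonglongrightarrow> H v" by simp
    qed
    show "AE v in lborel. norm (of_real (g (v / real (Suc n))) * H v) \<le> norm (H v)" for n
      by (rule AE_I2) (simp add: norm_mult g_def mult_left_le_one_le)
  qed measurable
  have lim2: "(\<lambda>n. LINT z|lborel. of_real (g z) * h (z / real (Suc n))) \<longlonglongrightarrow> (LINT z|lborel. of_real (g z) * h 0)"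
  proof (rule integral_dominated_convergence)
    show "integrable lborel (\<lambda>z. g z * C)" using g_int0 by auto
    show "AE z in lborel. (\<lambda>n. of_real (g z) * h (z / real (Suc n))) \<longlonglongrightarrow> of_real (g z) * h 0"
    proof (rule AE_I2)
      fix z :: real
      have "(\<lambda>n. z / real (Suc n)) \<longlonglongrightarrow> 0" by real_asymp
      from isCont_tendsto_compose[OF cont this]
      show "(\<lambda>n. of_real (g z) * h (z / real (Suc n))) \<longlonglongrightarrow> of_real (g z) * h 0" by (intro tendsto_intros)
    qed
    show "AE z in lborel. norm (of_real (g z) * h (z / real (Suc n))) \<le> g z * C" for n
      by (rule AE_I2) (simp add: norm_mult g_def bdd)
  qed measurable
  have "(\<lambda>n. LINT v|lborel. of_real (g (v / real (Suc n))) * H v) \<longlonglongrightarrow> sqrt (2 * pi) * (LINT z|lborel. of_real (g z) * h 0)"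
    unfolding key[OF of_nat_0_less_iff[THEN iffD2, OF zero_less_Suc]] by (intro tendsto_intros lim2)
  from LIMSEQ_unique[OF lim1 this] have "(LINT v|lborel. H v) = sqrt (2 * pi) * (LINT z|lborel. of_real (g z) * h 0)" .
  also have "\<dots> = (of_real (sqrt (2 * pi)) * of_real (sqrt (2 * pi))) * h 0"
    using g_int0(2) by simp
  also have "complex_of_real (sqrt (2 * pi)) * of_real (sqrt (2 * pi)) = 2 * pi"
    by (simp flip: of_real_mult)
  finally show ?thesis .
qed

section \<open>The functional equation of the theta function\<close>

lemma cosh_minus_one_le: "cosh y - 1 \<le> y\<^sup>2 * exp \<bar>y\<bar>" for y :: real
proof -
  have *: "sinh z \<le> z * exp z" if "z \<ge> 0" for z :: real
  proof -
    have "1 - exp (-2*z) \<le> 2 * z" using exp_ge_add_one_self[of "-2*z"] by simp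
    hence "exp z * (1 - exp (-2*z)) \<le> exp z * (2 * z)" by (intro mult_left_mono) auto
    moreover have "exp z * (1 - exp (-2*z)) = 2 * sinh z"
      by (simp add: sinh_def algebra_simps flip: exp_add)
    ultimately show ?thesis by (simp add: algebra_simps)
  qed
  have "cosh y = cosh (2 * (\<bar>y\<bar>/2))" by (cases "y \<ge> 0") auto
  also have "\<dots> = 1 + 2 * (sinh (\<bar>y\<bar>/2))\<^sup>2"
    by (simp only: cosh_double cosh_square_eq)
  finally have "cosh y - 1 = 2 * (sinh (\<bar>y\<bar>/2))\<^sup>2" by simp
  also have "\<dots> \<le> 2 * (\<bar>y\<bar>/2 * exp (\<bar>y\<bar>/2))\<^sup>2"
    by (intro mult_left_mono power_mono *) auto
  also have "\<dots> = y\<^sup>2 / 2 * exp \<bar>y\<bar>"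
    by (simp add: power2_eq_square field_simps flip: exp_add)
  also have "\<dots> \<le> y\<^sup>2 * exp \<bar>y\<bar>" by (intro mult_right_mono) auto
  finally show ?thesis .
qed

text \<open>
  Adding the terms for \<open>n\<close> and \<open>- n\<close> removes the linear term in \<open>t\<close>. The quadratic bound that
  remains is what the Fejer kernel needs, since it compensates the factor
  \<open>1 / (1 - cos (2 \<pi> t))\<close>.
\<close>

lemma gaussian_second_difference:
  fixes a t :: real and n :: nat
  assumes a: "a > 0" and t: "\<bar>t\<bar> \<le> 1/2"
  shows "\<bar>exp (-a*(n+t)\<^sup>2) + exp (-a*(n-t)\<^sup>2) - 2 * exp (-a*n\<^sup>2)\<bar>
           \<le> t\<^sup>2 * (2 * exp (-a*n\<^sup>2) * (a + 4*a\<^sup>2*n\<^sup>2*exp(a*n)))"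
proof -
  define y where "y = 2*a*n*t"
  have eq: "exp (-a*(n+t)\<^sup>2) + exp (-a*(n-t)\<^sup>2) - 2 * exp (-a*n\<^sup>2) =
      2 * exp (-a*n\<^sup>2) * (exp (-a*t\<^sup>2) * cosh y - 1)"
    unfolding cosh_def y_def
    by (simp add: algebra_simps power2_eq_square flip: exp_add)
  have y: "\<bar>y\<bar> \<le> a * n"
  proof -
    have "\<bar>y\<bar> = 2*a*n*\<bar>t\<bar>" using a by (simp add: y_def abs_mult)
    also have "\<dots> \<le> 2*a*n*(1/2)" by (intro mult_left_mono t) (use a in auto)
    finally show ?thesis by simp
  qed
  have "exp (-a*t\<^sup>2) * cosh y - 1 \<le> cosh y - 1"
    using a cosh_real_ge_1[of y] by (simp add: mult_le_cancel_right2)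
  also have "\<dots> \<le> y\<^sup>2 * exp \<bar>y\<bar>" by (rule cosh_minus_one_le)
  also have "\<dots> \<le> y\<^sup>2 * exp (a*n)" using y by (intro mult_left_mono) auto
  also have "\<dots> = t\<^sup>2 * (4*a\<^sup>2*n\<^sup>2*exp(a*n))" by (simp add: y_def power2_eq_square)
  finally have 1: "exp (-a*t\<^sup>2) * cosh y - 1 \<le> t\<^sup>2 * (4*a\<^sup>2*n\<^sup>2*exp(a*n))" .
  have "-(a*t\<^sup>2) \<le> exp (-a*t\<^sup>2) - 1" using exp_ge_add_one_self[of "-a*t\<^sup>2"] by simp
  also have "exp (-a*t\<^sup>2) \<le> exp (-a*t\<^sup>2) * cosh y"
    using cosh_real_ge_1[of y] mult_left_mono[of 1 "cosh y" "exp (-a*t\<^sup>2)"] by simp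
  finally have 2: "-(t\<^sup>2*a) \<le> exp (-a*t\<^sup>2) * cosh y - 1" by (simp add: mult.commute)
  have nn: "0 \<le> t\<^sup>2 * a" "0 \<le> t\<^sup>2 * (4*a\<^sup>2*n\<^sup>2*exp(a*n))" using a by auto
  have "\<bar>exp (-a*t\<^sup>2) * cosh y - 1\<bar> \<le> t\<^sup>2 * a + t\<^sup>2 * (4*a\<^sup>2*n\<^sup>2*exp(a*n))"
    using 1 2 nn by linarith
  hence "2 * exp (-a*n\<^sup>2) * \<bar>exp (-a*t\<^sup>2) * cosh y - 1\<bar> \<le>
         2 * exp (-a*n\<^sup>2) * (t\<^sup>2 * a + t\<^sup>2 * (4*a\<^sup>2*n\<^sup>2*exp(a*n)))"
    by (intro mult_left_mono) auto
  also have "2 * exp (-a*n\<^sup>2) * \<bar>exp (-a*t\<^sup>2) * cosh y - 1\<bar> =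
      \<bar>exp (-a*(n+t)\<^sup>2) + exp (-a*(n-t)\<^sup>2) - 2 * exp (-a*n\<^sup>2)\<bar>"
    unfolding eq by (simp add: abs_mult)
  finally show ?thesis by (simp add: algebra_simps)
qed

lemma summable_gaussian_majorant:
  fixes a :: real assumes "a > 0"
  shows "summable (\<lambda>n::nat. 2 * exp (-a*n\<^sup>2) * (a + 4*a\<^sup>2*n\<^sup>2*exp(a*n)))"
proof (rule summable_comparison_test_bigo)
  show "summable (\<lambda>n::nat. norm (1 / real n ^ 2))"
    using inverse_power_summable[of 2, where 'a=real] by (simp add: inverse_eq_divide)
  show "(\<lambda>n::nat. 2 * exp (-a*n\<^sup>2) * (a + 4*a\<^sup>2*n\<^sup>2*exp(a*n))) \<in> O(\<lambda>n. 1 / real n ^ 2)"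
    using assms by real_asymp
qed

lemma summable_gaussian:
  fixes a :: real assumes "a > 0"
  shows "summable (\<lambda>n::nat. exp (-a*n\<^sup>2))"
proof (rule summable_comparison_test_bigo)
  show "summable (\<lambda>n::nat. norm (1 / real n ^ 2))"
    using inverse_power_summable[of 2, where 'a=real] by (simp add: inverse_eq_divide)
  show "(\<lambda>n::nat. exp (-a*n\<^sup>2)) \<in> O(\<lambda>n. 1 / real n ^ 2)"
    using assms by real_asymp
qed

lemma one_minus_cos_ge:
  fixes t :: real assumes "\<bar>t\<bar> \<le> 1/2"
  shows "t\<^sup>2 \<le> 1 - cos (2 * pi * t)"
proof -
  define z where "z = pi * \<bar>t\<bar>"
  have z: "0 \<le> z" "z \<le> pi/2" using assms by (auto simp: z_def)
  have conc: "concave_on {0..pi/2} sin"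
  proof (rule f''_le0_imp_concave)
    show "(sin has_real_derivative cos x) (at x)" for x :: real by (rule DERIV_sin)
    show "(cos has_real_derivative - sin x) (at x)" for x :: real by (rule DERIV_cos)
  qed (auto intro: sin_ge_zero)
  have "\<bar>t\<bar> \<le> 2 * \<bar>t\<bar>" by simp
  also have "\<dots> \<le> sin z"
    using concave_onD[OF conc, of "2*\<bar>t\<bar>" 0 "pi/2"] assms
    by (simp add: z_def mult.commute)
  finally have "\<bar>t\<bar> \<le> sin z" .
  hence "\<bar>t\<bar>\<^sup>2 \<le> (sin z)\<^sup>2" by (intro power_mono) auto
  also have "(sin z)\<^sup>2 = (sin (pi*t))\<^sup>2" by (cases "t \<ge> 0") (auto simp: z_def)
  finally have "t\<^sup>2 \<le> (sin (pi*t))\<^sup>2" by simp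
  moreover have "1 - cos (2 * pi * t) = 2 * (sin (pi * t))\<^sup>2"
    using cos_double_sin[of "pi*t"] by (simp add: mult.assoc)
  ultimately show ?thesis using zero_le_power2[of "sin (pi*t)"] by linarith
qed

definition dirichlet_kernel :: "nat \<Rightarrow> real \<Rightarrow> real" where
  "dirichlet_kernel j t = 1 + 2 * (\<Sum>k\<in>{1..j}. cos (2 * pi * real k * t))"

lemma dirichlet_kernel_times:
  "dirichlet_kernel j t * (1 - cos (2*pi*t)) = cos (2*pi*j*t) - cos (2*pi*Suc j*t)"
proof (induction j)
  case 0 thus ?case by (simp add: dirichlet_kernel_def)
next
  case (Suc j)
  define A B where "A = 2*pi*Suc j*t" and "B = 2*pi*t"
  have "dirichlet_kernel (Suc j) t = dirichlet_kernel j t + 2 * cos A"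
    by (simp add: dirichlet_kernel_def A_def algebra_simps)
  hence "dirichlet_kernel (Suc j) t * (1 - cos B) =
     cos (2*pi*j*t) - cos (2*pi*Suc j*t) + 2 * cos A * (1 - cos B)"
    using Suc unfolding B_def by (simp add: algebra_simps)
  also have "2*pi*j*t = A - B" by (simp add: A_def B_def algebra_simps)
  also have "2*pi*Suc j*t = A" by (simp add: A_def)
  also have "cos (A - B) - cos A + 2 * cos A * (1 - cos B) = cos A - cos (A + B)"
    by (simp add: cos_add cos_diff algebra_simps)
  also have "A + B = 2*pi*Suc (Suc j)*t" by (simp add: A_def B_def algebra_simps)
  finally show ?case by (simp add: A_def B_def)
qed

text \<open>
  The sum of Dirichlet kernels is the (unnormalised) Fejer kernel
  \<open>(1 - cos (2 \<pi> K t)) / (1 - cos (2 \<pi> t))\<close>; the identity is stated without the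
  division so that no case distinction at \<open>t = 0\<close> is needed.
\<close>

lemma fejer_kernel_times:
  "(\<Sum>j<K. dirichlet_kernel j t) * (1 - cos (2*pi*t)) = 1 - cos (2*pi*K*t)"
proof -
  have "(\<Sum>j<K. dirichlet_kernel j t) * (1 - cos (2*pi*t)) =
        (\<Sum>j<K. cos (2*pi*j*t) - cos (2*pi*Suc j*t))"
    by (simp only: sum_distrib_right dirichlet_kernel_times)
  also have "\<dots> = 1 - cos (2*pi*K*t)"
    by (subst sum_lessThan_telescope') simp
  finally show ?thesis .
qed

text \<open>
  A finite section of the periodic function whose Fourier series is the content of Poisson
  summation. Working with finite sections keeps every integrand continuous and avoids
  exchanging an infinite sum with an integral.
\<close>

definition theta_translate :: "real \<Rightarrow> nat \<Rightarrow> real \<Rightarrow> real" where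
  "theta_translate x N t = exp (-pi*x*t\<^sup>2) + (\<Sum>n\<in>{1..N}. exp (-(pi*x)*(real n+t)\<^sup>2) + exp (-(pi*x)*(real n-t)\<^sup>2))"

text \<open>
  Unfolding: the translates of the unit interval by \<open>- N, \<dots>, N\<close> fit together to one
  long interval, and the cosine has period \<open>1\<close>.
\<close>

lemma integral_theta_translate:
  fixes k :: nat and x :: real
  defines "H \<equiv> (\<lambda>t::real. exp (-pi*x*t\<^sup>2) * cos (2*pi*k*t))"
  shows "integral {-1/2..1/2} (\<lambda>t. theta_translate x N t * cos (2*pi*k*t)) =
         integral {-1/2-real N..1/2+real N} H"
proof (induction N)
  case 0
  thus ?case by (simp add: theta_translate_def H_def)
next
  case (Suc N)
  have H: "H integrable_on {a..b}" for a b
    unfolding H_def by (intro integrable_continuous_interval continuous_intros)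
  define n where "n = Suc N"
  have per: "cos (2 * pi * real m) = 1" "sin (2 * pi * real m) = 0" for m
    using cos_2npi[of m] sin_2npi[of m] by (simp_all add: mult_ac)
  have H1: "exp (-(pi*x)*(real n+t)\<^sup>2) * cos (2*pi*k*t) = H (t + real n)" for t
  proof -
    have "cos (2*pi*k*(t+real n)) = cos (2*pi*k*t + 2 * pi * real (k*n))"
      by (simp add: algebra_simps)
    also have "\<dots> = cos (2*pi*k*t)" by (simp only: cos_add per mult_1_right mult_zero_right diff_0_right)
    finally show ?thesis by (simp add: H_def add.commute)
  qed
  have H2: "exp (-(pi*x)*(real n-t)\<^sup>2) * cos (2*pi*k*t) = H (t + - real n)" for t
  proof -
    have "cos (2*pi*k*(t + - real n)) = cos (2*pi*k*t - 2 * pi * real (k*n))"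
      by (simp add: algebra_simps)
    also have "\<dots> = cos (2*pi*k*t)" by (simp only: cos_diff per mult_1_right mult_zero_right add_0_right)
    finally show ?thesis by (simp add: H_def power2_commute)
  qed
  have shift: "integral {-1/2..1/2} (\<lambda>t. H (t + c)) = integral {-1/2+c..1/2+c} H" for c
    using integral_shift_real_ivl[of "-1/2+c" c "1/2+c" H] by simp
  have intS: "(\<lambda>t. H (t + c)) integrable_on {-1/2..1/2}" for c
    unfolding H_def by (intro integrable_continuous_interval continuous_intros)
  have intT: "(\<lambda>t. theta_translate x N t * cos (2*pi*k*t)) integrable_on {-1/2..1/2}"
    unfolding theta_translate_def by (intro integrable_continuous_interval continuous_intros)
  have "theta_translate x (Suc N) t * cos (2*pi*k*t) =
      theta_translate x N t * cos (2*pi*k*t) + (H (t + real n) + H (t + -real n))" for t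
    unfolding H1[symmetric] H2[symmetric] by (simp add: theta_translate_def n_def algebra_simps)
  hence "integral {-1/2..1/2} (\<lambda>t. theta_translate x (Suc N) t * cos (2*pi*k*t)) =
      integral {-1/2..1/2} (\<lambda>t. theta_translate x N t * cos (2*pi*k*t)) +
       (integral {-1/2+real n..1/2+real n} H + integral {-1/2+-real n..1/2+-real n} H)"
    by (simp only: Henstock_Kurzweil_Integration.integral_add[OF intT integrable_add[OF intS intS]]
          Henstock_Kurzweil_Integration.integral_add[OF intS intS] shift)
  also have "integral {-1/2..1/2} (\<lambda>t. theta_translate x N t * cos (2*pi*k*t)) =
       integral {-1/2-real N..1/2+real N} H" by (rule Suc.IH)
  also have "integral {-1/2-real N..1/2+real N} H = integral {1/2 - real n..-1/2+real n} H"
    by (simp add: n_def)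
  also have "integral {1/2 - real n..-1/2+real n} H + (integral {-1/2+real n..1/2+real n} H + integral {-1/2+-real n..1/2+-real n} H) =
     integral {-1/2-real n..1/2+real n} H"
    using Henstock_Kurzweil_Integration.integral_combine[of "-1/2-real n" "1/2-real n" "-1/2+real n" H]
          Henstock_Kurzweil_Integration.integral_combine[of "-1/2-real n" "-1/2+real n" "1/2+real n" H] H
    by (simp add: n_def)
  finally show ?case by (simp add: n_def)
qed

lemma integral_theta_translate_tendsto:
  fixes k :: nat
  assumes x: "x > 0"
  shows "(\<lambda>N. integral {-1/2..1/2} (\<lambda>t. theta_translate x N t * cos (2*pi*k*t)))
           \<longlonglongrightarrow> exp (-pi*(real k)\<^sup>2/x) / sqrt x"
proof -
  define H where "H = (\<lambda>t::real. exp (-pi*x*t\<^sup>2) * cos (2*pi*k*t))"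
  have H: "integrable lborel H" "integral\<^sup>L lborel H = exp (-pi*(real k)\<^sup>2/x) / sqrt x"
    using gaussian_cos[OF x, of "real k"] by (auto simp: H_def has_bochner_integral_iff)
  have "(\<lambda>N. integral {-1/2-real N..1/2+real N} H) \<longlonglongrightarrow> exp (-pi*(real k)\<^sup>2/x) / sqrt x"
    unfolding H(2)[symmetric] by (rule integral_Icc_tendsto[OF H(1)]; real_asymp)
  thus ?thesis
    unfolding integral_theta_translate H_def .
qed

text \<open>
  Riemann's \<open>\<psi>\<close>: the part of the theta series with positive index.
\<close>

definition half_theta :: "real \<Rightarrow> real" where
  "half_theta x = (\<Sum>n. exp (-pi * (real (Suc n))\<^sup>2 * x))"

definition theta :: "real \<Rightarrow> real" where
  "theta x = 1 + 2 * half_theta x"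

lemma summable_half_theta:
  assumes "x > 0"
  shows "summable (\<lambda>n. exp (-pi * (real (Suc n))\<^sup>2 * x))"
proof -
  have "summable (\<lambda>n. exp (-(pi*x) * (real (Suc n))\<^sup>2))"
    using summable_gaussian[of "pi * x"] assms by (subst summable_Suc_iff) simp
  thus ?thesis by (simp add: mult_ac)
qed

lemma sum_tendsto_theta:
  assumes "x > 0"
  shows "(\<lambda>N. 1 + 2 * (\<Sum>n\<in>{1..N}. exp (-pi * (real n)\<^sup>2 * x))) \<longlonglongrightarrow> theta x"
proof -
  have "(\<lambda>N. \<Sum>n<N. exp (-pi * (real (Suc n))\<^sup>2 * x)) \<longlonglongrightarrow> half_theta x"
    using summable_LIMSEQ[OF summable_half_theta[OF assms]] by (simp add: half_theta_def)
  moreover have "(\<Sum>n<N. exp (-pi * (real (Suc n))\<^sup>2 * x)) = (\<Sum>n\<in>{1..N}. exp (-pi * (real n)\<^sup>2 * x))" for N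
    by (rule sum.reindex_bij_witness[of _ "\<lambda>n. n - 1" Suc]) auto
  ultimately show ?thesis unfolding theta_def by (intro tendsto_intros) simp
qed

lemma bounded_partial_sums_imp_limit_zero:
  fixes a :: "nat \<Rightarrow> real"
  assumes lim: "a \<longlonglongrightarrow> L" and bd: "\<And>K. \<bar>\<Sum>j<K. a j\<bar> \<le> B"
  shows "L = 0"
proof (rule ccontr)
  assume L: "L \<noteq> 0"
  then obtain m where m: "\<And>j. j \<ge> m \<Longrightarrow> \<bar>a j - L\<bar> < \<bar>L\<bar>/2"
    using LIMSEQ_D[OF lim, of "\<bar>L\<bar>/2"] by auto
  have *: "real K * (\<bar>L\<bar>/2) \<le> 2 * B" for K
  proof -
    have "\<bar>\<Sum>j<K. a (m + j) - L\<bar> \<le> (\<Sum>j<K. \<bar>L\<bar>/2)"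
      by (rule order_trans[OF sum_abs sum_mono]) (use m in \<open>auto intro: less_imp_le\<close>)
    moreover have "(\<Sum>j<K. a (m + j) - L) = (\<Sum>j<m+K. a j) - (\<Sum>j<m. a j) - K * L"
    proof -
      have "(\<Sum>j<m+K. a j) = (\<Sum>j<m. a j) + (\<Sum>j<K. a (m + j))"
        by (induction K) auto
      thus ?thesis by (simp add: sum_subtractf)
    qed
    ultimately have "\<bar>(\<Sum>j<m+K. a j) - (\<Sum>j<m. a j) - K * L\<bar> \<le> real K * (\<bar>L\<bar>/2)"
      by simp
    hence "\<bar>real K * L\<bar> \<le> 2 * B + real K * (\<bar>L\<bar>/2)"
      using bd[of "m+K"] bd[of m] by linarith
    thus ?thesis by (simp add: abs_mult)
  qed
  obtain K where "2 * B < real K * (\<bar>L\<bar>/2)"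
    using reals_Archimedean3[of "\<bar>L\<bar>/2"] L by (meson half_gt_zero zero_less_abs_iff)
  with *[of K] show False by linarith
qed

lemma theta_translate_bound:
  assumes x: "x > 0"
  obtains C where "\<And>N t. \<bar>t\<bar> \<le> 1/2 \<Longrightarrow>
    \<bar>theta_translate x N t - theta_translate x N 0\<bar> \<le> C * (1 - cos (2*pi*t))"
proof -
  define a where "a = pi * x"
  have a: "a > 0" using x by (simp add: a_def)
  define m where "m = (\<lambda>n::nat. 2 * exp (-a*n\<^sup>2) * (a + 4*a\<^sup>2*n\<^sup>2*exp(a*n)))"
  have m: "summable m" unfolding m_def by (rule summable_gaussian_majorant[OF a])
  have m0: "m n \<ge> 0" for n using a by (auto simp: m_def intro!: add_nonneg_nonneg)
  define G where "G = (\<lambda>n t. exp (-a*(real n+t)\<^sup>2) + exp (-a*(real n-t)\<^sup>2) - 2 * exp (-a*(real n)\<^sup>2))"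
  have G: "\<bar>G n t\<bar> \<le> t\<^sup>2 * m n" if "\<bar>t\<bar> \<le> 1/2" for n t
    using gaussian_second_difference[OF a that, of n] by (simp add: G_def m_def)
  show ?thesis
  proof (rule that[of "suminf m"])
    fix N t assume t: "\<bar>t :: real\<bar> \<le> 1/2"
    have "theta_translate x N t - theta_translate x N 0 = G 0 t / 2 + (\<Sum>n\<in>{1..N}. G n t)"
      by (simp add: theta_translate_def G_def a_def sum_subtractf)
    also have "\<bar>\<dots>\<bar> \<le> \<bar>G 0 t\<bar> + (\<Sum>n\<in>{1..N}. \<bar>G n t\<bar>)"
      using sum_abs[of "\<lambda>n. G n t" "{1..N}"] by linarith
    also have "\<dots> = (\<Sum>n\<in>insert 0 {1..N}. \<bar>G n t\<bar>)" by simp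
    also have "\<dots> \<le> (\<Sum>n\<in>insert 0 {1..N}. t\<^sup>2 * m n)" by (intro sum_mono G t)
    also have "\<dots> = t\<^sup>2 * (\<Sum>n\<in>insert 0 {1..N}. m n)" by (rule sum_distrib_left [symmetric])
    also have "\<dots> \<le> t\<^sup>2 * suminf m"
      by (intro mult_left_mono sum_le_suminf m) (use m0 in auto)
    also have "\<dots> \<le> (1 - cos (2*pi*t)) * suminf m"
      by (intro mult_right_mono one_minus_cos_ge t suminf_nonneg m m0)
    finally show "\<bar>theta_translate x N t - theta_translate x N 0\<bar> \<le> suminf m * (1 - cos (2*pi*t))"
      by (simp add: mult.commute)
  qed
qed

lemma integral_cos_period:
  fixes k :: nat
  assumes "k > 0"
  shows "((\<lambda>t. cos (2*pi*k*t)) has_integral 0) {-1/2..1/2}"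
proof -
  have "((\<lambda>t. cos (2*pi*k*t)) has_integral 
       sin (2*pi*k*(1/2)) / (2*pi*k) - sin (2*pi*k*(-1/2)) / (2*pi*k)) {-1/2..1/2}"
    by (rule fundamental_theorem_of_calculus)
       (use assms in \<open>auto intro!: derivative_eq_intros simp flip: has_real_derivative_iff_has_vector_derivative\<close>)
  moreover have "sin (2*pi*k*(1/2)) = 0" "sin (2*pi*k*(-1/2)) = 0"
    using sin_npi[of k] by (simp_all add: mult.commute)
  ultimately show ?thesis by simp
qed

lemma fejer_kernel_integral:
  "((\<lambda>t. \<Sum>j<K. dirichlet_kernel j t) has_integral real K) {-1/2..1/2}"
proof -
  have "((\<lambda>t. dirichlet_kernel j t) has_integral 1) {-1/2..1/2}" for j
  proof -
    have "((\<lambda>t. 1 + 2 * (\<Sum>k\<in>{1..j}. cos (2*pi*real k*t))) has_integral 1 + 2 * (\<Sum>k\<in>{1..j}. 0)) {-1/2..1/2}"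
      by (intro has_integral_add has_integral_mult_right has_integral_sum integral_cos_period)
         (use has_integral_const_real[of "1::real" "-1/2" "1/2"] in auto)
    thus ?thesis by (simp add: dirichlet_kernel_def)
  qed
  hence "((\<lambda>t. \<Sum>j<K. dirichlet_kernel j t) has_integral (\<Sum>j<K. 1)) {-1/2..1/2}"
    by (intro has_integral_sum) auto
  thus ?thesis by simp
qed

text \<open>
  Poisson summation for the Gaussian. Testing the sections \<open>f N - f N 0\<close> against the
  Fejer kernel of order \<open>K\<close> gives, on the one hand, a quantity bounded independently of \<open>K\<close> and
  \<open>N\<close>, because of the quadratic vanishing at \<open>0\<close>; on the other hand, as \<open>N\<close> grows, the sum over
  \<open>j < K\<close> of the differences between the partial sums of the dual series and \<open>\<theta>(x)\<close>. Bounded sums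
  force these differences to tend to \<open>0\<close>.
\<close>

theorem theta_inverse:
  assumes x: "x > 0"
  shows "theta (1 / x) = sqrt x * theta x"
proof -
  obtain C where C: "\<And>N t. \<bar>t\<bar> \<le> 1/2 \<Longrightarrow>
    \<bar>theta_translate x N t - theta_translate x N 0\<bar> \<le> C * (1 - cos (2*pi*t))"
    using theta_translate_bound[OF x] by blast
  define f where "f = theta_translate x"
  define c where "c = (\<lambda>N k. integral {-1/2..1/2} (\<lambda>t. f N t * cos (2*pi*real k*t)))"
  define g where "g = (\<lambda>k::nat. exp (-pi*(real k)\<^sup>2/x) / sqrt x)"
  have c_lim: "(\<lambda>N. c N k) \<longlonglongrightarrow> g k" for k
    unfolding c_def g_def f_def by (rule integral_theta_translate_tendsto[OF x])
  have cont: "continuous_on A (f N)" "continuous_on A (dirichlet_kernel j)" for N j and A :: "real set"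
    unfolding f_def theta_translate_def dirichlet_kernel_def by (intro continuous_intros)+
  have C0: "0 \<le> C" using C[of "1/2" 0] by simp
  have fejer: "\<bar>(\<Sum>j<K. (c N 0 + 2 * (\<Sum>k\<in>{1..j}. c N k)) - f N 0)\<bar> \<le> 2 * C" for K N
  proof -
    have "((\<lambda>t. f N t * dirichlet_kernel j t) has_integral c N 0 + 2 * (\<Sum>k\<in>{1..j}. c N k)) {-1/2..1/2}" for j
    proof -
      have *: "((\<lambda>t. f N t * cos (2*pi*real k*t)) has_integral c N k) {-1/2..1/2}" for k
        unfolding c_def by (intro integrable_integral integrable_continuous_interval continuous_intros cont)
      have "((\<lambda>t. f N t * cos (2*pi*real 0*t) + 2 * (\<Sum>k\<in>{1..j}. f N t * cos (2*pi*real k*t))) 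
          has_integral c N 0 + 2 * (\<Sum>k\<in>{1..j}. c N k)) {-1/2..1/2}"
        by (intro has_integral_add has_integral_mult_right has_integral_sum *) auto
      thus ?thesis by (simp add: dirichlet_kernel_def algebra_simps sum_distrib_left)
    qed
    hence "((\<lambda>t. \<Sum>j<K. f N t * dirichlet_kernel j t) has_integral (\<Sum>j<K. c N 0 + 2 * (\<Sum>k\<in>{1..j}. c N k))) {-1/2..1/2}"
      by (intro has_integral_sum) auto
    from has_integral_diff[OF this has_integral_mult_right[OF fejer_kernel_integral, of "f N 0"]]
    have I: "((\<lambda>t. (f N t - f N 0) * (\<Sum>j<K. dirichlet_kernel j t)) has_integral
        (\<Sum>j<K. (c N 0 + 2 * (\<Sum>k\<in>{1..j}. c N k)) - f N 0)) {-1/2..1/2}"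
      by (simp add: sum_distrib_left sum_subtractf algebra_simps)
    have "norm (\<Sum>j<K. (c N 0 + 2 * (\<Sum>k\<in>{1..j}. c N k)) - f N 0) \<le> (2 * C) * measure lborel {-1/2..1/2::real}"
    proof (rule has_integral_bound_real[OF _ _ I, of _ "{}"])
      fix t :: real assume "t \<in> {-1/2..1/2} - {}"
      hence t: "\<bar>t\<bar> \<le> 1/2" by auto
      have "norm ((f N t - f N 0) * (\<Sum>j<K. dirichlet_kernel j t)) =
            \<bar>f N t - f N 0\<bar> * \<bar>\<Sum>j<K. dirichlet_kernel j t\<bar>" by (simp add: abs_mult)
      also have "\<dots> \<le> (C * (1 - cos (2*pi*t))) * \<bar>\<Sum>j<K. dirichlet_kernel j t\<bar>"
        unfolding f_def by (intro mult_right_mono C t) auto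
      also have "\<dots> = C * \<bar>(\<Sum>j<K. dirichlet_kernel j t) * (1 - cos (2*pi*t))\<bar>"
        by (simp add: abs_mult)
      also have "\<dots> = C * \<bar>1 - cos (2*pi*K*t)\<bar>" by (simp only: fejer_kernel_times)
      also have "\<dots> \<le> C * 2"
        by (intro mult_left_mono C0) (smt (verit) cos_le_one cos_ge_minus_one)
      finally show "norm ((f N t - f N 0) * (\<Sum>j<K. dirichlet_kernel j t)) \<le> 2 * C" by simp
    qed (use C0 in auto)
    thus ?thesis by simp
  qed
  have f0: "(\<lambda>N. f N 0) \<longlonglongrightarrow> theta x"
  proof -
    have "f N 0 = 1 + 2 * (\<Sum>n\<in>{1..N}. exp (-pi * (real n)\<^sup>2 * x))" for N
      by (simp add: f_def theta_translate_def sum.distrib mult_ac sum_distrib_left)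
    with sum_tendsto_theta[OF x] show ?thesis by simp
  qed
  define S where "S = (\<lambda>j. g 0 + 2 * (\<Sum>k\<in>{1..j}. g k))"
  \<comment> \<open>The bound \<open>fejer\<close> is uniform in \<open>N\<close>, so it survives the passage to the limit.\<close>
  have bd: "\<bar>\<Sum>j<K. S j - theta x\<bar> \<le> 2 * C" for K
  proof (rule tendsto_upperbound)
    show "(\<lambda>N. \<bar>\<Sum>j<K. (c N 0 + 2 * (\<Sum>k\<in>{1..j}. c N k)) - f N 0\<bar>) \<longlonglongrightarrow> \<bar>\<Sum>j<K. S j - theta x\<bar>"
      unfolding S_def by (intro tendsto_intros c_lim f0)
  qed (use fejer in \<open>auto intro: always_eventually\<close>)
  have "S \<longlonglongrightarrow> theta (1/x) / sqrt x"
  proof -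
    have "S = (\<lambda>j. (1 + 2 * (\<Sum>n\<in>{1..j}. exp (-pi * (real n)\<^sup>2 * (1/x)))) / sqrt x)"
      by (simp add: fun_eq_iff S_def g_def add_divide_distrib sum_divide_distrib sum_distrib_left)
    thus ?thesis using tendsto_divide[OF sum_tendsto_theta[of "1/x"] tendsto_const[of "sqrt x"]] x
      by simp
  qed
  hence "(\<lambda>j. S j - theta x) \<longlonglongrightarrow> theta (1/x) / sqrt x - theta x" by (intro tendsto_intros)
  from bounded_partial_sums_imp_limit_zero[OF this bd] show ?thesis
    using x by (simp add: field_simps)
qed

lemma theta_pos:
  assumes "x > 0" shows "theta x > 0"
proof -
  have "half_theta x \<ge> 0" unfolding half_theta_def by (intro suminf_nonneg summable_half_theta assms) auto
  thus ?thesis by (simp add: theta_def)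
qed

text \<open>
  From \<open>exp (- y) \<le> 1 / y\<close>, applied termwise.
\<close>

lemma half_theta_le:
  assumes x: "x > 0"
  shows "half_theta x \<le> (\<Sum>n. 1 / (pi * (real (Suc n))\<^sup>2)) / x"
proof -
  have s: "summable (\<lambda>n. 1 / (pi * (real (Suc n))\<^sup>2))"
    using summable_mult[OF inverse_power_summable[of 2, where 'a=real], THEN summable_Suc_iff[THEN iffD2], of "1/pi"]
    by (simp add: divide_simps)
  have "exp (-pi * (real (Suc n))\<^sup>2 * x) \<le> 1 / (pi * (real (Suc n))\<^sup>2) / x" for n
  proof -
    define y where "y = pi * (real (Suc n))\<^sup>2 * x"
    have y: "y > 0" using x by (simp add: y_def)
    have "y \<le> exp y" using exp_ge_add_one_self[of y] by linarith
    hence "exp (-y) \<le> 1 / y" using y by (simp add: exp_minus field_simps)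
    thus ?thesis by (simp add: y_def)
  qed
  hence "half_theta x \<le> (\<Sum>n. 1 / (pi * (real (Suc n))\<^sup>2) / x)"
    unfolding half_theta_def using s by (intro suminf_le summable_half_theta x summable_divide) auto
  also have "\<dots> = (\<Sum>n. 1 / (pi * (real (Suc n))\<^sup>2)) / x" by (rule suminf_divide[OF s])
  finally show ?thesis .
qed

lemma half_theta_nonneg: "x > 0 \<Longrightarrow> half_theta x \<ge> 0"
  unfolding half_theta_def by (intro suminf_nonneg summable_half_theta) auto

section \<open>The value of the theta function at 1\<close>

lemma has_sum_product:
  fixes f :: "'a \<Rightarrow> real" and g :: "'b \<Rightarrow> real"
  assumes f: "(f has_sum a) A" and g: "(g has_sum b) B"
  shows "((\<lambda>(x,y). f x * g y) has_sum (a * b)) (A \<times> B)"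
proof (rule has_sum_SigmaI[where g = "\<lambda>x. f x * b"])
  have abs: "(\<lambda>x. norm (f x)) summable_on A" "(\<lambda>y. norm (g y)) summable_on B"
    using f[THEN has_sum_imp_summable] g[THEN has_sum_imp_summable]
    by (blast intro: summable_on_iff_abs_summable_on_real[THEN iffD1])+
  show "((\<lambda>y. case (x, y) of (x, y) \<Rightarrow> f x * g y) has_sum f x * b) B" for x
    using has_sum_cmult_right[OF g] by simp
  show "((\<lambda>x. f x * b) has_sum a * b) A" by (rule has_sum_cmult_left[OF f])
  show "(\<lambda>(x, y). f x * g y) summable_on A \<times> B"
  proof (rule Infinite_Sum.abs_summable_summable, subst Infinite_Sum.abs_summable_on_Sigma_iff, intro conjI ballI)
    show "(\<lambda>y. norm (case (x, y) of (x, y) \<Rightarrow> f x * g y)) summable_on B" for x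
      using summable_on_cmult_right[OF abs(2), of "norm (f x)"] by (simp add: abs_mult)
    have "(\<Sum>\<^sub>\<infinity>y\<in>B. norm (case (x, y) of (x, y) \<Rightarrow> f x * g y)) = norm (f x) * (\<Sum>\<^sub>\<infinity>y\<in>B. norm (g y))" for x
      by (simp add: abs_mult infsum_cmult_right')
    thus "(\<lambda>x. norm (\<Sum>\<^sub>\<infinity>y\<in>B. norm (case (x, y) of (x, y) \<Rightarrow> f x * g y))) summable_on A"
      using summable_on_cmult_left[OF abs(1), of "norm (\<Sum>\<^sub>\<infinity>y\<in>B. norm (g y))"] by (simp add: abs_mult)
  qed
qed

definition theta_term :: "real \<Rightarrow> int \<Rightarrow> real" where
  "theta_term x n = exp (-pi * (real_of_int n)\<^sup>2 * x)"

definition parity_sign :: "int \<Rightarrow> real" where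
  "parity_sign n = (if even n then 1 else -1)"

text \<open>
  In Jacobi's notation this is \<open>\<theta>\<^sub>4\<close>, while \<open>theta\<close> is \<open>\<theta>\<^sub>3\<close>, with nome \<open>exp (- \<pi> x)\<close>.
\<close>

definition theta_alt :: "real \<Rightarrow> real" where
  "theta_alt x = (\<Sum>\<^sub>\<infinity>n. parity_sign n * theta_term x n)"

lemma theta_term_has_sum:
  assumes "x > 0"
  shows "(theta_term x has_sum theta x) UNIV"
proof -
  have half_theta: "((\<lambda>n. exp (-pi * (real (Suc n))\<^sup>2 * x)) has_sum half_theta x) UNIV"
    unfolding half_theta_def by (intro sums_nonneg_imp_has_sum summable_sums summable_half_theta assms) simp
  have pos: "(theta_term x has_sum half_theta x) {0<..}"
  proof -
    have "range (\<lambda>n. int (Suc n)) = {0<..}"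
    proof (intro equalityI subsetI)
      fix k :: int assume "k \<in> {0<..}"
      then obtain n where "k = int n" "0 < n"
        using zero_less_imp_eq_int[of k] by auto
      then obtain m where "k = int (Suc m)"
        using gr0_implies_Suc by blast
      thus "k \<in> range (\<lambda>n. int (Suc n))" by (rule range_eqI)
    qed auto
    moreover have "inj (\<lambda>n. int (Suc n))" by (auto simp: inj_on_def)
    moreover have "theta_term x \<circ> (\<lambda>n. int (Suc n)) = (\<lambda>n. exp (-pi * (real (Suc n))\<^sup>2 * x))"
      by (simp only: theta_term_def o_def of_int_of_nat_eq)
    ultimately show ?thesis using half_theta has_sum_reindex[of "\<lambda>n. int (Suc n)" UNIV "theta_term x" "half_theta x"] by simp
  qed
  have neg: "(theta_term x has_sum half_theta x) {..<0}"
  proof -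
    have "theta_term x \<circ> uminus = theta_term x"
      by (rule ext) (simp only: theta_term_def o_def of_int_minus power2_minus)
    thus ?thesis using pos has_sum_reindex[of "uminus" "{0<..}" "theta_term x" "half_theta x"] by simp
  qed
  have zero: "(theta_term x has_sum 1) {0}" 
    using has_sum_finite[of "{0}" "theta_term x"] by (simp add: theta_term_def)
  have "(theta_term x has_sum (half_theta x + half_theta x)) ({0<..} \<union> {..<0})"
    by (rule has_sum_Un_disjoint[OF pos neg]) auto
  hence "(theta_term x has_sum (1 + (half_theta x + half_theta x))) ({0} \<union> ({0<..} \<union> {..<0}))"
    by (rule has_sum_Un_disjoint[OF zero]) auto
  moreover have "{0} \<union> ({0<..} \<union> {..<0}) = (UNIV :: int set)" by auto
  ultimately show ?thesis by (simp add: theta_def theta_term_def)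
qed

lemma theta_term_nonneg [simp]: "theta_term x n \<ge> 0" by (simp add: theta_term_def)

lemma theta_alt_has_sum:
  assumes "x > 0"
  shows "((\<lambda>n. parity_sign n * theta_term x n) has_sum theta_alt x) UNIV"
  unfolding theta_alt_def
proof (rule has_sum_infsum, rule Infinite_Sum.abs_summable_summable)
  have "norm (parity_sign n * theta_term x n) = theta_term x n" for n
    by (simp add: parity_sign_def)
  thus "(\<lambda>n. norm (parity_sign n * theta_term x n)) summable_on UNIV"
    using theta_term_has_sum[OF assms] by (auto simp: summable_on_def)
qed

text \<open>
  The pairs of integers of equal parity form the lattice spanned by \<open>(1, 1)\<close> and \<open>(1, -1)\<close>. Both
  duplication formulas result from summing over \<open>\<int>\<^sup>2\<close> a function that vanishes off this lattice.
\<close>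

lemma has_sum_same_parity_lattice:
  fixes F :: "int \<times> int \<Rightarrow> real"
  assumes "(F has_sum S) (UNIV \<times> UNIV)" and "\<And>m n. odd (m + n) \<Longrightarrow> F (m, n) = 0"
  shows "((\<lambda>(j, k). F (j + k, j - k)) has_sum S) (UNIV \<times> UNIV)"
proof -
  have "(F has_sum S) {(m, n). even (m + n)}"
    by (rule iffD1[OF has_sum_cong_neutral assms(1)]) (use assms(2) in auto)
  moreover have "range (\<lambda>(j, k). (j + k, j - k)) = {(m, n :: int). even (m + n)}"
  proof (intro equalityI subsetI)
    fix p assume "p \<in> {(m, n :: int). even (m + n)}"
    then obtain m n where p: "p = (m, n)" "even (m + n)" by (cases p) auto
    then obtain j where "m + n = 2 * j" by (elim evenE)
    hence "p = (\<lambda>(j, k). (j + k, j - k)) (j, m - j)" using p by simp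
    thus "p \<in> range (\<lambda>(j, k). (j + k, j - k))" by (rule range_eqI)
  qed auto
  moreover have "inj (\<lambda>(j, k). (j + k, j - k :: int))" by (auto simp: inj_on_def)
  ultimately show ?thesis
    using has_sum_reindex[of "\<lambda>(j, k). (j + k, j - k)" UNIV F S] by (simp add: case_prod_unfold o_def)
qed

lemma theta_term_rotate: "theta_term x (j + k) * theta_term x (j - k) = theta_term (2 * x) j * theta_term (2 * x) k"
  unfolding theta_term_def mult_exp_exp by (simp add: power2_eq_square algebra_simps)

text \<open>
  Together with \<open>theta_mult_theta_alt\<close>, this says that
  \<open>(\<theta>\<^sub>3\<^sup>2, \<theta>\<^sub>4\<^sup>2)\<close> at \<open>2 x\<close> is obtained from its value at \<open>x\<close> by one step of the
  arithmetic-geometric mean.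
\<close>

lemma theta_sum_squares:
  assumes x: "x > 0"
  shows "theta x ^ 2 + theta_alt x ^ 2 = 2 * theta (2 * x) ^ 2"
proof -
  have x2: "2 * x > 0" using x by simp
  have "((\<lambda>(m, n). theta_term x m * theta_term x n) has_sum (theta x * theta x)) (UNIV \<times> UNIV)"
    by (intro has_sum_product theta_term_has_sum x)
  moreover have "((\<lambda>(m, n). (parity_sign m * theta_term x m) * (parity_sign n * theta_term x n)) has_sum (theta_alt x * theta_alt x)) (UNIV \<times> UNIV)"
    by (intro has_sum_product theta_alt_has_sum x)
  ultimately have "((\<lambda>p. (\<lambda>(m, n). theta_term x m * theta_term x n) p + 
      (\<lambda>(m, n). (parity_sign m * theta_term x m) * (parity_sign n * theta_term x n)) p)
      has_sum (theta x * theta x + theta_alt x * theta_alt x)) (UNIV \<times> UNIV)"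
    by (rule has_sum_add)
  from has_sum_same_parity_lattice[OF this]
  have "((\<lambda>(j, k). 2 * (theta_term x (j + k) * theta_term x (j - k))) has_sum (theta x * theta x + theta_alt x * theta_alt x)) (UNIV \<times> UNIV)"
    by (rule iffD1[OF has_sum_cong, rotated]) (auto simp: parity_sign_def)
  hence "((\<lambda>(j, k). 2 * (theta_term (2 * x) j * theta_term (2 * x) k)) has_sum (theta x * theta x + theta_alt x * theta_alt x)) (UNIV \<times> UNIV)"
    by (simp only: theta_term_rotate)
  moreover have "((\<lambda>(j, k). 2 * (theta_term (2 * x) j * theta_term (2 * x) k)) has_sum 2 * (theta (2 * x) * theta (2 * x))) (UNIV \<times> UNIV)"
    using has_sum_cmult_right[OF has_sum_product[OF theta_term_has_sum[OF x2] theta_term_has_sum[OF x2]], of 2]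
    by (simp add: case_prod_unfold del: UNIV_Times_UNIV)
  ultimately show ?thesis
    using has_sum_unique by (fastforce simp: power2_eq_square)
qed

lemma theta_mult_theta_alt:
  assumes x: "x > 0"
  shows "theta x * theta_alt x = theta_alt (2 * x) ^ 2"
proof -
  have x2: "2 * x > 0" using x by simp
  have "((\<lambda>(m, n). theta_term x m * (parity_sign n * theta_term x n)) has_sum (theta x * theta_alt x)) (UNIV \<times> UNIV)"
    by (intro has_sum_product theta_term_has_sum theta_alt_has_sum x)
  moreover have "((\<lambda>(m, n). (parity_sign m * theta_term x m) * theta_term x n) has_sum (theta_alt x * theta x)) (UNIV \<times> UNIV)"
    by (intro has_sum_product theta_term_has_sum theta_alt_has_sum x)
  ultimately have "((\<lambda>p. (\<lambda>(m, n). theta_term x m * (parity_sign n * theta_term x n)) p + 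
      (\<lambda>(m, n). (parity_sign m * theta_term x m) * theta_term x n) p)
      has_sum (theta x * theta_alt x + theta_alt x * theta x)) (UNIV \<times> UNIV)"
    by (rule has_sum_add)
  from has_sum_same_parity_lattice[OF this]
  have "((\<lambda>(j, k). 2 * ((parity_sign j * parity_sign k) * (theta_term x (j + k) * theta_term x (j - k)))) has_sum (theta x * theta_alt x + theta_alt x * theta x)) (UNIV \<times> UNIV)"
    by (rule iffD1[OF has_sum_cong, rotated]) (auto simp: parity_sign_def)
  hence "((\<lambda>(j, k). 2 * ((parity_sign j * theta_term (2 * x) j) * (parity_sign k * theta_term (2 * x) k))) has_sum (theta x * theta_alt x + theta_alt x * theta x)) (UNIV \<times> UNIV)"
    by (simp only: theta_term_rotate) (simp add: mult_ac)
  moreover have "((\<lambda>(j, k). 2 * ((parity_sign j * theta_term (2 * x) j) * (parity_sign k * theta_term (2 * x) k))) has_sum 2 * (theta_alt (2 * x) * theta_alt (2 * x))) (UNIV \<times> UNIV)"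
    using has_sum_cmult_right[OF has_sum_product[OF theta_alt_has_sum[OF x2] theta_alt_has_sum[OF x2]], of 2]
    by (simp add: case_prod_unfold del: UNIV_Times_UNIV)
  ultimately show ?thesis
    using has_sum_unique by (fastforce simp: power2_eq_square)
qed

definition elliptic_integrand :: "real \<Rightarrow> real \<Rightarrow> real \<Rightarrow> real" where
  "elliptic_integrand a b t = 1 / sqrt ((t\<^sup>2 + a\<^sup>2) * (t\<^sup>2 + b\<^sup>2))"

text \<open>
  With the integral taken over the whole line, this is twice the classical complete integral
  \<open>I(a, b) = \<integral>\<^sub>0\<^sup>\<pi>\<^sup>/\<^sup>2 (a\<^sup>2 cos\<^sup>2 \<phi> + b\<^sup>2 sin\<^sup>2 \<phi>)\<^sup>-\<^sup>1\<^sup>/\<^sup>2 d\<phi>\<close>.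
\<close>

definition elliptic_integral :: "real \<Rightarrow> real \<Rightarrow> real" where
  "elliptic_integral a b = (LINT t|lborel. elliptic_integrand a b t)"

lemma elliptic_integrand_measurable [measurable]: "elliptic_integrand a b \<in> borel_measurable borel"
  unfolding elliptic_integrand_def by measurable

lemma has_bochner_integral_inverse_quadratic:
  fixes a :: real assumes "a > 0"
  shows "has_bochner_integral lborel (\<lambda>t. 1 / (t\<^sup>2 + a\<^sup>2)) (pi / a)"
proof -
  have "has_bochner_integral lborel (\<lambda>t. 1 / (1 + (0 + inverse a * t)\<^sup>2)) (pi /\<^sub>R \<bar>inverse a\<bar>)"
    using integrable_inverse_square integral_inverse_square assms
    by (subst lborel_has_bochner_integral_real_affine_iff[symmetric]) (auto simp: has_bochner_integral_iff)
  hence "has_bochner_integral lborel (\<lambda>t. (1 / a\<^sup>2) * (1 / (1 + (0 + inverse a * t)\<^sup>2))) ((1 / a\<^sup>2) * (pi /\<^sub>R \<bar>inverse a\<bar>))"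
    by (rule has_bochner_integral_mult_right)
  moreover have "(1 / a\<^sup>2) * (1 / (1 + (0 + inverse a * t)\<^sup>2)) = 1 / (t\<^sup>2 + a\<^sup>2)" for t
  proof -
    have "a\<^sup>2 * (1 + (0 + inverse a * t)\<^sup>2) = t\<^sup>2 + a\<^sup>2"
      using assms by (simp add: power2_eq_square field_simps)
    thus ?thesis by (simp add: field_simps)
  qed
  moreover have "(1 / a\<^sup>2) * (pi /\<^sub>R \<bar>inverse a\<bar>) = pi / a"
    using assms by (simp add: power2_eq_square field_simps)
  ultimately show ?thesis by (simp only:)
qed

lemma elliptic_integrand_bounds:
  assumes "0 < b" "b \<le> a"
  shows "1 / (t\<^sup>2 + a\<^sup>2) \<le> elliptic_integrand a b t" "elliptic_integrand a b t \<le> 1 / (t\<^sup>2 + b\<^sup>2)"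
proof -
  have p: "0 < t\<^sup>2 + b\<^sup>2" "t\<^sup>2 + b\<^sup>2 \<le> t\<^sup>2 + a\<^sup>2"
    using assms by (auto intro!: add_nonneg_pos power_mono)
  define A B where "A = t\<^sup>2 + a\<^sup>2" and "B = t\<^sup>2 + b\<^sup>2"
  have AB: "0 < B" "B \<le> A" using p by (auto simp: A_def B_def)
  have "sqrt (A * B) \<le> sqrt (A * A)" "sqrt (B * B) \<le> sqrt (A * B)"
    by (rule real_sqrt_le_mono, use AB in \<open>simp add: mult_left_mono mult_right_mono\<close>)+
  moreover have "sqrt (A * A) = A" "sqrt (B * B) = B" using AB by auto
  ultimately have "sqrt (A * B) \<le> A" "B \<le> sqrt (A * B)" by (simp_all only:)
  moreover have "0 < sqrt (A * B)" using AB by simp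
  ultimately show "1 / (t\<^sup>2 + a\<^sup>2) \<le> elliptic_integrand a b t" "elliptic_integrand a b t \<le> 1 / (t\<^sup>2 + b\<^sup>2)"
    using AB unfolding elliptic_integrand_def A_def[symmetric] B_def[symmetric] by (auto intro!: divide_left_mono)
qed

lemma elliptic_integrand_commute: "elliptic_integrand a b = elliptic_integrand b a"
  by (simp add: elliptic_integrand_def fun_eq_iff mult.commute)

lemma elliptic_integrand_integrable:
  assumes "0 < a" "0 < b"
  shows "integrable lborel (elliptic_integrand a b)"
proof -
  have *: "integrable lborel (elliptic_integrand a b)" if "0 < b" "b \<le> a" for a b
  proof (rule Bochner_Integration.integrable_bound)
    show "integrable lborel (\<lambda>t. 1 / (t\<^sup>2 + b\<^sup>2))"
      using has_bochner_integral_inverse_quadratic[OF that(1)] by (simp add: has_bochner_integral_iff)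
    show "AE t in lborel. norm (elliptic_integrand a b t) \<le> norm (1 / (t\<^sup>2 + b\<^sup>2))"
    proof (rule AE_I2)
      fix t
      have "0 \<le> elliptic_integrand a b t" by (simp add: elliptic_integrand_def)
      with elliptic_integrand_bounds(2)[OF that, of t] show "norm (elliptic_integrand a b t) \<le> norm (1 / (t\<^sup>2 + b\<^sup>2))"
        by (simp add: abs_of_nonneg)
    qed
  qed measurable
  show ?thesis using *[of a b] *[of b a] assms by (cases "a \<le> b") (auto simp: elliptic_integrand_commute[of a b])
qed

lemma elliptic_integral_bounds:
  assumes "0 < b" "b \<le> a"
  shows "pi / a \<le> elliptic_integral a b" "elliptic_integral a b \<le> pi / b"
proof -
  have q: "integrable lborel (\<lambda>t. 1 / (t\<^sup>2 + c\<^sup>2))" "(LINT t|lborel. 1 / (t\<^sup>2 + c\<^sup>2)) = pi / c" if "c > 0" for c :: real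
    using has_bochner_integral_inverse_quadratic[OF that] by (auto simp: has_bochner_integral_iff)
  have i: "integrable lborel (elliptic_integrand a b)" using assms by (intro elliptic_integrand_integrable) auto
  have "(LINT t|lborel. 1 / (t\<^sup>2 + a\<^sup>2)) \<le> elliptic_integral a b"
    unfolding elliptic_integral_def using assms by (intro integral_mono i q elliptic_integrand_bounds) auto
  moreover have "elliptic_integral a b \<le> (LINT t|lborel. 1 / (t\<^sup>2 + b\<^sup>2))"
    unfolding elliptic_integral_def using assms by (intro integral_mono i q elliptic_integrand_bounds) auto
  ultimately show "pi / a \<le> elliptic_integral a b" "elliptic_integral a b \<le> pi / b"
    using assms q(2) by auto
qed

lemma elliptic_integral_scale:
  assumes "c > 0"
  shows "elliptic_integral (c * a) (c * b) = elliptic_integral a b / c"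
proof -
  have "elliptic_integral (c * a) (c * b) = \<bar>c\<bar> *\<^sub>R (LINT t|lborel. elliptic_integrand (c * a) (c * b) (0 + c * t))"
    unfolding elliptic_integral_def using assms by (intro lborel_integral_real_affine) auto
  also have "(\<lambda>t. elliptic_integrand (c * a) (c * b) (0 + c * t)) = (\<lambda>t. (1 / c\<^sup>2) * elliptic_integrand a b t)"
  proof
    fix t
    have "((0 + c*t)\<^sup>2 + (c*a)\<^sup>2) * ((0 + c*t)\<^sup>2 + (c*b)\<^sup>2) = (c\<^sup>2)\<^sup>2 * ((t\<^sup>2 + a\<^sup>2) * (t\<^sup>2 + b\<^sup>2))"
      by (simp add: power_mult_distrib algebra_simps power2_eq_square)
    thus "elliptic_integrand (c * a) (c * b) (0 + c * t) = (1 / c\<^sup>2) * elliptic_integrand a b t"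
      unfolding elliptic_integrand_def by (simp only: real_sqrt_mult real_sqrt_abs) simp
  qed
  finally show ?thesis using assms by (simp add: elliptic_integral_def power2_eq_square)
qed

text \<open>
  The inverse of the Landen substitution \<open>t = (x - q / x) / 2\<close>, which maps the positive
  half-line onto the whole line.
\<close>

definition landen :: "real \<Rightarrow> real \<Rightarrow> real" where
  "landen q t = t + sqrt (t\<^sup>2 + q)"

lemma landen_properties:
  fixes q :: real assumes q: "q > 0"
  defines "g \<equiv> landen q"
  shows "inj g" "range g = {0<..}" "\<And>t. (g has_real_derivative g t / sqrt (t\<^sup>2 + q)) (at t)" "\<And>t. g t > 0"
    "\<And>t. g t - q / g t = 2 * t"
proof -
  have p: "t\<^sup>2 + q > 0" for t :: real using q by (intro add_nonneg_pos) auto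
  have big: "\<bar>t\<bar> < sqrt (t\<^sup>2 + q)" for t
    using q by (intro real_less_rsqrt) auto
  show g0: "g t > 0" for t using big[of t] by (simp add: g_def landen_def)
  show g2: "g t - q / g t = 2 * t" for t
  proof -
    have "g t * (g t - 2 * t) = q"
      using p[of t] by (simp add: g_def landen_def algebra_simps) (simp add: power2_eq_square)
    thus ?thesis using g0[of t] by (simp add: field_simps)
  qed
  show "inj g"
  proof (rule injI)
    fix s t assume "g s = g t"
    hence "2 * s = 2 * t" by (subst (1 2) g2 [symmetric]) (simp only:)
    thus "s = t" by simp
  qed
  show "range g = {0<..}"
  proof (intro equalityI subsetI)
    fix x :: real assume x: "x \<in> {0<..}"
    define t where "t = (x - q / x) / 2"
    have "t\<^sup>2 + q = ((x + q / x) / 2)\<^sup>2"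
    proof -
      define r where "r = q / x"
      have "q = r * x" using x by (simp add: r_def)
      moreover have "(x - r)\<^sup>2 + 4 * (r * x) = (x + r)\<^sup>2" by algebra
      ultimately show ?thesis unfolding t_def r_def[symmetric] by (simp add: power_divide)
    qed
    hence "sqrt (t\<^sup>2 + q) = (x + q / x) / 2" using x q by simp
    hence "g t = x" by (simp add: g_def landen_def t_def field_simps)
    thus "x \<in> range g" by blast
  qed (use g0 in auto)
  show "(g has_real_derivative g t / sqrt (t\<^sup>2 + q)) (at t)" for t
  proof -
    have "(g has_real_derivative 1 + (2 * t) * (inverse (sqrt (t\<^sup>2 + q)) / 2)) (at t)"
      unfolding g_def landen_def using p[of t] by (auto intro!: derivative_eq_intros)
    also have "1 + (2 * t) * (inverse (sqrt (t\<^sup>2 + q)) / 2) = g t / sqrt (t\<^sup>2 + q)"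
      using p[of t] by (simp add: g_def landen_def field_simps)
    finally show ?thesis .
  qed
qed

text \<open>
  With \<open>x = landen (q\<^sup>2) t\<close> one has \<open>x - q\<^sup>2 / x = 2 t\<close>, so \<open>x\<^sup>4 + p x\<^sup>2 + q\<^sup>4 = 4 x\<^sup>2 (t\<^sup>2 + m\<^sup>2)\<close>.
  The parameter \<open>p\<close> may be smaller than \<open>2 q\<^sup>2\<close>, so the same substitution covers an elliptic
  integral with complex conjugate parameters; \<open>p = 0\<close> is the lemniscatic case.
\<close>

lemma landen_transformation:
  fixes p q m :: real
  assumes q: "q > 0" and m: "p + 2 * q^2 = 4 * m^2" "m > 0"
  shows "has_bochner_integral lborel (\<lambda>x. indicator {0<..} x *\<^sub>R (1 / sqrt (x^4 + p * x\<^sup>2 + q^4)))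
           (elliptic_integral q m / 2)"
proof -
  define g where "g = landen (q\<^sup>2)"
  have q2: "q\<^sup>2 > 0" using q by simp
  note L = landen_properties[OF q2, folded g_def]
  define h where "h = (\<lambda>t. g t / sqrt (t\<^sup>2 + q\<^sup>2))"
  define f where "f = (\<lambda>x::real. 1 / sqrt (x^4 + p * x\<^sup>2 + q^4))"
  have eq: "h t * f (g t) = elliptic_integrand q m t / 2" for t
  proof -
    define x where "x = g t"
    have x: "x > 0" "x - q\<^sup>2 / x = 2 * t" using L by (auto simp: x_def)
    have "x\<^sup>2 - q\<^sup>2 = 2 * t * x" using x by (simp add: field_simps power2_eq_square)
    hence "x^4 + p * x\<^sup>2 + q^4 = (2 * t * x)^2 + (p + 2 * q^2) * x^2" by algebra
    also have "\<dots> = (2 * x)\<^sup>2 * (t\<^sup>2 + m\<^sup>2)" unfolding m by algebra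
    finally have "sqrt (x^4 + p * x\<^sup>2 + q^4) = (2 * x) * sqrt (t\<^sup>2 + m\<^sup>2)"
      using x by (simp add: real_sqrt_mult)
    thus ?thesis using x(1) by (simp add: h_def f_def x_def[symmetric] elliptic_integrand_def real_sqrt_mult)
  qed
  have "has_bochner_integral lborel (\<lambda>t. elliptic_integrand q m t / 2) (elliptic_integral q m / 2)"
    using elliptic_integrand_integrable[OF q m(2)] by (auto simp: has_bochner_integral_iff elliptic_integral_def)
  hence "has_bochner_integral lborel (\<lambda>t. indicator UNIV t *\<^sub>R (h t *\<^sub>R f (g t))) (elliptic_integral q m / 2)"
    by (simp add: eq)
  also have "?this \<longleftrightarrow> has_bochner_integral lborel (\<lambda>x. indicator (range g) x *\<^sub>R f x) (elliptic_integral q m / 2)"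
  proof (rule has_bochner_integral_substitution)
    show "(\<lambda>x. indicator (range g) x *\<^sub>R f x) \<in> borel_measurable borel"
      unfolding L(2) f_def by measurable
    show "(\<lambda>t. indicator UNIV t *\<^sub>R (h t *\<^sub>R f (g t))) \<in> borel_measurable borel"
      by (simp add: eq)
    show "0 \<le> h t" for t using L(4)[of t] by (simp add: h_def)
    show "range g \<in> sets borel" unfolding L(2) by simp
    show "(g has_real_derivative h t) (at t)" for t unfolding h_def by (rule L(3))
  qed (use L in auto)
  finally show ?thesis by (simp add: L(2) f_def)
qed

text \<open>
  Gauss's invariance, for \<open>p = a\<^sup>2 + b\<^sup>2\<close> and \<open>q\<^sup>2 = a b\<close> in \<open>landen_transformation\<close>.
\<close>

lemma elliptic_integral_agm_step:
  assumes "a > 0" "b > 0"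
  shows "elliptic_integral a b = elliptic_integral ((a + b) / 2) (sqrt (a * b))"
proof -
  define q where "q = sqrt (a * b)"
  have q: "q > 0" "q\<^sup>2 = a * b" using assms by (auto simp: q_def)
  have q4: "q^4 = (a * b)\<^sup>2" using q(2) by (metis power_mult numeral_Bit0 mult_2_right power2_eq_square power_add)
  have "has_bochner_integral lborel (\<lambda>x. indicator {0<..} x *\<^sub>R (1 / sqrt (x^4 + (a\<^sup>2 + b\<^sup>2) * x\<^sup>2 + q^4)))
           (elliptic_integral q ((a + b) / 2) / 2)"
    by (rule landen_transformation) (use assms q in \<open>auto simp: power2_eq_square field_simps\<close>)
  moreover have "x^4 + (a\<^sup>2 + b\<^sup>2) * x\<^sup>2 + q^4 = (x\<^sup>2 + a\<^sup>2) * (x\<^sup>2 + b\<^sup>2)" for x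
    unfolding q4 by algebra
  ultimately have "has_bochner_integral lborel (\<lambda>x. indicator {0<..} x *\<^sub>R elliptic_integrand a b x) (elliptic_integral q ((a + b) / 2) / 2)"
    by (simp add: elliptic_integrand_def)
  hence "has_bochner_integral lborel (\<lambda>x. indicator {0..} x *\<^sub>R elliptic_integrand a b x) (elliptic_integral q ((a + b) / 2) / 2)"
    by (rule has_bochner_integral_discrete_difference[where X="{0}", THEN iffD1, rotated 4])
       (auto simp: indicator_def)
  from has_bochner_integral_even_function[OF this]
  have "has_bochner_integral lborel (elliptic_integrand a b) (2 * (elliptic_integral q ((a + b) / 2) / 2))"
    by (simp add: elliptic_integrand_def[abs_def])
  thus ?thesis using elliptic_integrand_commute by (simp add: has_bochner_integral_iff elliptic_integral_def q_def)
qed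

text \<open>
  Taking \<open>p = 0\<close> and \<open>q = 1\<close> in \<open>landen_transformation\<close> leads to the integral of
  \<open>1 / sqrt (1 + x\<^sup>4)\<close>, which the substitution \<open>x\<^sup>4 = t / (1 - t)\<close> turns into \<open>Beta (1/4) (1/4) / 4\<close>.
\<close>

lemma elliptic_integral_lemniscate: "elliptic_integral 1 (1 / sqrt 2) = Gamma (1/4) ^ 2 / (2 * sqrt pi)"
proof -
  define g where "g = (\<lambda>t::real. (t / (1 - t)) powr (1/4))"
  define h where "h = (\<lambda>t::real. 1/4 * (t / (1 - t)) powr (-3/4) * (1 / (1 - t)\<^sup>2))"
  define f where "f = (\<lambda>x::real. 1 / sqrt (1 + x^4))"
  define B where "B = Beta (1/4) (1/4 :: real)"
  have im: "g ` {0<..<1} = {0<..}"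
  proof (intro equalityI subsetI)
    fix x :: real assume x: "x \<in> {0<..}"
    define t where "t = x^4 / (1 + x^4)"
    have x4: "x^4 > 0" using x by simp
    hence nz: "1 + x^4 \<noteq> 0" "1 + x^4 > 0" by linarith+
    have t1: "1 - t = 1 / (1 + x^4)" using nz by (simp add: t_def diff_divide_eq_iff)
    have "t / (1 - t) = x^4" unfolding t1 using nz by (simp add: t_def)
    hence "g t = (x^4) powr (1/4)" by (simp add: g_def)
    also have "\<dots> = x" using x powr_realpow[of x 4] by (simp add: powr_powr flip: powr_numeral)
    finally have "g t = x" .
    moreover have "t \<in> {0<..<1}" 
    proof -
      have "0 < t" "0 < 1 - t" using x4 nz unfolding t1 by (simp_all add: t_def)
      thus ?thesis by simp
    qed
    ultimately show "x \<in> g ` {0<..<1}" by blast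
  qed (auto simp: g_def)
  have inj: "inj_on g {0<..<1}"
  proof (rule inj_onI)
    fix s t :: real assume *: "s \<in> {0<..<1}" "t \<in> {0<..<1}" "g s = g t"
    have "(g s) powr 4 = (g t) powr 4" using * by simp
    hence "s / (1 - s) = t / (1 - t)" using * by (simp add: g_def powr_powr)
    thus "s = t" using * by (simp add: field_simps)
  qed
  have "has_bochner_integral lborel (\<lambda>t. indicator {0<..<1} t *\<^sub>R (h t *\<^sub>R f (g t))) (B / 4)"
  proof -
    have "((\<lambda>t. t powr (1/4 - 1) * (1 - t) powr (1/4 - 1)) has_integral B) {0..1}"
      unfolding B_def by (rule has_integral_Beta_real) auto
    hence "((\<lambda>t. t powr (1/4 - 1) * (1 - t) powr (1/4 - 1)) has_integral B) {0<..<1}"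
      by (simp add: has_integral_Icc_iff_Ioo)
    hence "has_bochner_integral lborel (\<lambda>t. indicator {0<..<1} t *\<^sub>R (t powr (1/4 - 1) * (1 - t) powr (1/4 - 1))) B"
      by (intro has_bochner_integral_lborel_nonneg) auto
    hence "has_bochner_integral lborel (\<lambda>t. (indicator {0<..<1} t *\<^sub>R (t powr (1/4 - 1) * (1 - t) powr (1/4 - 1))) / 4) (B / 4)"
      by (rule has_bochner_integral_divide)
    moreover have "(indicator {0<..<1} t *\<^sub>R (t powr (1/4 - 1) * (1 - t) powr (1/4 - 1))) / 4 =
        indicator {0<..<1} t *\<^sub>R (h t *\<^sub>R f (g t))" for t
    proof (cases "t \<in> {0<..<1}")
      case True
      hence t: "0 < t" "t < 1" by auto
      have "g t ^ 4 = t / (1 - t)"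
        using t by (simp add: g_def powr_powr flip: powr_numeral)
      hence "1 + g t ^ 4 = 1 / (1 - t)" using t by (simp add: field_simps)
      hence "f (g t) = (1 - t) powr (1/2)" using t by (simp add: f_def real_sqrt_divide powr_half_sqrt)
      moreover have "h t = 1/4 * t powr (-3/4) * ((1 - t) powr (3/4) * (1 - t) powr (-2))"
        using t by (simp add: h_def powr_divide powr_minus_divide powr_numeral)
      ultimately have "h t * f (g t) = 1/4 * t powr (-3/4) * ((1 - t) powr (3/4) * (1 - t) powr (-2) * (1-t) powr (1/2))"
        by simp
      also have "(1 - t) powr (3/4) * (1 - t) powr (-2) * (1-t) powr (1/2) = (1 - t) powr (-3/4)"
        by (simp flip: powr_add)
      finally show ?thesis using True by simp
    qed auto
    ultimately show ?thesis by (simp only:)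
  qed
  also have "?this \<longleftrightarrow> has_bochner_integral lborel (\<lambda>x. indicator (g ` {0<..<1}) x *\<^sub>R f x) (B / 4)"
  proof (rule has_bochner_integral_substitution)
    show "(g has_real_derivative h t) (at t)" if "t \<in> {0<..<1}" for t
    proof -
      have d: "((\<lambda>t. t / (1 - t)) has_real_derivative 1 / (1 - t)\<^sup>2) (at t)"
        using that by (auto intro!: derivative_eq_intros simp: power2_eq_square)
      show ?thesis unfolding g_def h_def
        using DERIV_chain2[where f = "\<lambda>z. z powr (1/4)" and g = "\<lambda>t. t / (1 - t)", OF _ d, 
            of "1/4 * (t / (1 - t)) powr (1/4 - 1)"] has_real_derivative_powr[of "t / (1 - t)" "1/4"] that by simp
    qed
  qed (use im inj in \<open>auto simp: h_def f_def g_def\<close>)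
  finally have "has_bochner_integral lborel (\<lambda>x. indicator {0<..} x *\<^sub>R (1 / sqrt (1 + x^4))) (B / 4)"
    by (simp add: im f_def)
  moreover have "has_bochner_integral lborel (\<lambda>x. indicator {0<..} x *\<^sub>R (1 / sqrt (x^4 + 0 * x\<^sup>2 + 1^4))) (elliptic_integral 1 (1 / sqrt 2) / 2)"
    by (rule landen_transformation) (auto simp: power_divide)
  ultimately have "elliptic_integral 1 (1 / sqrt 2) = B / 2"
    by (auto simp: has_bochner_integral_iff add.commute)
  also have "B = Gamma (1/4) ^ 2 / sqrt pi"
    by (simp add: B_def Beta_def power2_eq_square Gamma_one_half_real)
  finally show ?thesis by simp
qed

lemma theta_tendsto_1: "(theta \<longlongrightarrow> 1) at_top"
proof -
  define C where "C = (\<Sum>n. 1 / (pi * (real (Suc n))\<^sup>2))"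
  have "(half_theta \<longlongrightarrow> 0) at_top"
  proof (rule tendsto_sandwich)
    show "eventually (\<lambda>x. 0 \<le> half_theta x) at_top"
      using eventually_gt_at_top[of 0] by eventually_elim (rule half_theta_nonneg)
    show "eventually (\<lambda>x. half_theta x \<le> C / x) at_top"
      using eventually_gt_at_top[of 0] unfolding C_def by eventually_elim (rule half_theta_le)
    show "((\<lambda>x. C / x) \<longlongrightarrow> 0) at_top" by real_asymp
  qed auto
  hence "((\<lambda>x. 1 + 2 * half_theta x) \<longlongrightarrow> 1 + 2 * 0) at_top" by (intro tendsto_intros)
  thus ?thesis by (simp add: theta_def[abs_def])
qed

text \<open>
  The functional equation makes \<open>\<theta>(1/2)\<^sup>2 = 2 \<theta>(2)\<^sup>2\<close>, which closes the system of the duplication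
  formulas at \<open>1/2\<close> and at \<open>1\<close>.
\<close>

lemma theta_alt_1_squared: "theta 1 ^ 4 = 2 * theta_alt 1 ^ 4"
proof -
  define A B P Q where "A = theta 1 ^ 2" and "B = theta_alt 1 ^ 2" and "P = theta (1/2) ^ 2" and "Q = theta_alt (1/2) ^ 2"
  have "P + Q = 2 * A" using theta_sum_squares[of "1/2"] by (simp add: P_def Q_def A_def)
  moreover have "P * Q = B ^ 2"
    using theta_mult_theta_alt[of "1/2"] by (simp add: P_def Q_def B_def flip: power_mult_distrib)
  moreover have "A + B = 2 * theta 2 ^ 2" using theta_sum_squares[of 1] by (simp add: A_def B_def)
  moreover have "P = 2 * theta 2 ^ 2"
    using theta_inverse[of 2] by (simp add: P_def power_mult_distrib)
  ultimately have "A ^ 2 = 2 * B ^ 2" by algebra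
  thus ?thesis by (simp add: A_def B_def flip: power_mult)
qed

text \<open>
  Along \<open>x = 2\<^sup>k\<close> the pair \<open>(\<theta>\<^sub>3\<^sup>2, \<theta>\<^sub>4\<^sup>2)\<close> runs through an arithmetic-geometric mean iteration with
  limit \<open>(1, 1)\<close>, so the elliptic integral of its initial value is \<open>\<pi>\<close>. That value is
  \<open>\<theta>(1)\<^sup>2 (1, 1 / sqrt 2)\<close>, a multiple of the lemniscatic pair.
\<close>

theorem theta_1: "theta 1 = pi powr (1/4) / Gamma (3/4)"
proof -
  define A where "A = (\<lambda>k::nat. theta (2^k) ^ 2)"
  define B where "B = (\<lambda>k::nat. theta_alt (2^k) ^ 2)"
  have A0: "A k > 0" for k using theta_pos[of "2^k"] by (simp add: A_def)
  have B0: "theta_alt (2^k) \<noteq> 0" for k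
  proof (induction k)
    case 0 thus ?case using theta_alt_1_squared theta_pos[of 1] by auto
  next
    case (Suc k)
    thus ?case using theta_mult_theta_alt[of "2^k"] theta_pos[of "2^k"] by auto
  qed
  hence B0: "B k > 0" for k by (simp add: B_def)
  have step: "A (Suc k) = (A k + B k) / 2" "B (Suc k) = sqrt (A k * B k)" for k
  proof -
    show "A (Suc k) = (A k + B k) / 2" using theta_sum_squares[of "2^k"] by (simp add: A_def B_def)
    have "A k * B k = (theta_alt (2^Suc k) ^ 2) ^ 2"
      using theta_mult_theta_alt[of "2^k"] by (simp add: A_def B_def flip: power_mult_distrib)
    thus "B (Suc k) = sqrt (A k * B k)" by (simp only: B_def real_sqrt_abs) simp
  qed
  have const: "elliptic_integral (A k) (B k) = elliptic_integral (A 0) (B 0)" for k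
  proof (induction k)
    case (Suc k)
    thus ?case using elliptic_integral_agm_step[OF A0[of k] B0[of k]] by (simp only: step)
  qed auto
  have B_le: "B k \<le> A k" for k
  proof (cases k)
    case 0
    have "(B 0)\<^sup>2 \<le> (A 0)\<^sup>2" using theta_alt_1_squared by (simp add: A_def B_def flip: power_mult)
    thus ?thesis using A0[of 0] 0 by (metis power2_le_imp_le less_imp_le)
  next
    case (Suc j)
    thus ?thesis using arith_geo_mean_sqrt[of "A j" "B j"] A0[of j] B0[of j] by (simp add: step)
  qed
  have A_lim: "A \<longlonglongrightarrow> 1"
  proof -
    have "filterlim (\<lambda>k::nat. 2 ^ k :: real) at_top sequentially" by real_asymp
    from filterlim_compose[OF theta_tendsto_1 this] have "A \<longlonglongrightarrow> 1 ^ 2"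
      unfolding A_def by (intro tendsto_intros)
    thus ?thesis by simp
  qed
  have B_lim: "B \<longlonglongrightarrow> 1"
  proof -
    have "(\<lambda>k. 2 * A (Suc k) - A k) \<longlonglongrightarrow> 2 * 1 - 1" by (intro tendsto_intros A_lim LIMSEQ_Suc)
    moreover have "(\<lambda>k. 2 * A (Suc k) - A k) = B" by (simp add: step fun_eq_iff add_divide_distrib)
    ultimately show ?thesis by simp
  qed
  \<comment> \<open>The bounds \<open>\<pi> / A k\<close> and \<open>\<pi> / B k\<close> enclose the constant integral and both tend to \<open>\<pi>\<close>.\<close>
  have "elliptic_integral (A 0) (B 0) \<le> pi"
  proof (rule tendsto_lowerbound)
    show "(\<lambda>k. pi / B k) \<longlonglongrightarrow> pi" using tendsto_divide[OF tendsto_const[of pi] B_lim] by simp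
    show "eventually (\<lambda>k. elliptic_integral (A 0) (B 0) \<le> pi / B k) sequentially"
    proof (rule always_eventually, rule allI)
      fix k show "elliptic_integral (A 0) (B 0) \<le> pi / B k"
        using elliptic_integral_bounds(2)[OF B0[of k] B_le[of k]] const[of k] by (simp only:)
    qed
  qed simp
  moreover have "elliptic_integral (A 0) (B 0) \<ge> pi"
  proof (rule tendsto_upperbound)
    show "(\<lambda>k. pi / A k) \<longlonglongrightarrow> pi" using tendsto_divide[OF tendsto_const[of pi] A_lim] by simp
    show "eventually (\<lambda>k. pi / A k \<le> elliptic_integral (A 0) (B 0)) sequentially"
    proof (rule always_eventually, rule allI)
      fix k show "pi / A k \<le> elliptic_integral (A 0) (B 0)"
        using elliptic_integral_bounds(1)[OF B0[of k] B_le[of k]] const[of k] by (simp only:)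
    qed
  qed simp
  ultimately have "elliptic_integral (A 0) (B 0) = pi" by simp
  moreover have "B 0 = A 0 * (1 / sqrt 2)"
  proof -
    have "(B 0)\<^sup>2 = (A 0 * (1 / sqrt 2))\<^sup>2"
      using theta_alt_1_squared by (simp add: A_def B_def power_mult_distrib power_divide flip: power_mult)
    thus ?thesis using A0[of 0] B0[of 0] by (metis divide_pos_pos less_imp_le mult_pos_pos power2_eq_imp_eq real_sqrt_gt_0_iff zero_less_numeral zero_less_one)
  qed
  ultimately have "elliptic_integral 1 (1 / sqrt 2) / A 0 = pi"
    using elliptic_integral_scale[OF A0[of 0], of 1 "1 / sqrt 2"] by simp
  hence A_eq: "A 0 = Gamma (1/4) ^ 2 / (2 * sqrt pi * pi)"
    using A0[of 0] unfolding elliptic_integral_lemniscate by (simp add: field_simps)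
  have gamma_refl: "Gamma (1/4) * Gamma (3/4) = pi * sqrt (2 :: real)"
  proof -
    have "complex_of_real (Gamma (1/4) * Gamma (3/4)) = of_real (pi * sqrt 2)"
    proof -
      have "complex_of_real (Gamma (1/4) * Gamma (3/4)) = of_real (pi / sin (pi * (1/4)))"
      proof -
        have "complex_of_real (Gamma (1/4) * Gamma (3/4)) = Gamma (of_real (1/4)) * Gamma (of_real (3/4))"
          by (simp only: of_real_mult Gamma_complex_of_real)
        also have "\<dots> = Gamma (1/4) * Gamma (1 - 1/4)" by simp
        also have "\<dots> = of_real pi / sin (of_real pi * (1/4))" by (rule Gamma_reflection_complex)
        also have "sin (complex_of_real pi * (1/4)) = of_real (sin (pi * (1/4)))"
          using sin_of_real[of "pi * (1/4)", where 'a = complex] by simp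
        finally show ?thesis by (simp only: of_real_divide)
      qed
      also have "pi / sin (pi * (1/4)) = pi * sqrt 2"
        by (simp add: sin_45 field_simps)
      finally show ?thesis .
    qed
    thus ?thesis by (simp only: of_real_eq_iff)
  qed
  have G: "Gamma (3/4 :: real) > 0" by (rule Gamma_real_pos) simp
  have "(theta 1)\<^sup>2 = (pi powr (1/4) / Gamma (3/4))\<^sup>2"
  proof -
    have "Gamma (1/4) = pi * sqrt 2 / Gamma (3/4 :: real)" using gamma_refl G by (simp only: nonzero_eq_divide_eq[OF less_imp_neq[OF G, symmetric]])
    hence "A 0 = (pi * sqrt 2 / Gamma (3/4)) ^ 2 / (2 * sqrt pi * pi)" using A_eq by simp
    also have "\<dots> = (pi / sqrt pi) / Gamma (3/4) ^ 2"
      using G by (simp add: power_mult_distrib power_divide) (simp add: power2_eq_square)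
    also have "pi / sqrt pi = sqrt pi" by (simp add: real_div_sqrt)
    also have "sqrt pi = (pi powr (1/4))\<^sup>2" by (simp add: powr_half_sqrt[symmetric] powr_powr flip: powr_realpow powr_numeral)
    finally show ?thesis by (simp add: A_def power_divide)
  qed
  thus ?thesis using theta_pos[of 1] G by (metis divide_pos_pos less_imp_le pi_gt_zero power2_eq_imp_eq powr_gt_zero order_less_irrefl zero_less_one)
qed

section \<open>The entire function xi\<close>

text \<open>
  Euler's integral with \<open>t = exp y\<close>. In this logarithmic variable Mellin transforms become
  Fourier transforms and the inversion \<open>t \<mapsto> 1 / t\<close> becomes a reflection.
\<close>

lemma Gamma_exp_integral:
  assumes z: "Re z > 0"
  shows "has_bochner_integral lborel (\<lambda>y. exp (z * of_real y) * of_real (exp (- exp y))) (Gamma z)"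
proof -
  define f where "f = (\<lambda>t. complex_of_real t powr (z - 1) / of_real (exp t))"
  have meas: "(\<lambda>x. indicator {0<..} x *\<^sub>R f x) \<in> borel_measurable borel"
    unfolding f_def powr_def by measurable
  have eq: "exp y *\<^sub>R f (exp y) = exp (z * of_real y) * of_real (exp (- exp y))" for y
  proof -
    have "complex_of_real (exp y) powr (z - 1) = exp ((z - 1) * of_real y)"
      by (simp add: powr_def Ln_of_real)
    moreover have "exp (z * of_real y) = of_real (exp y) * exp ((z - 1) * of_real y)"
      by (simp only: exp_of_real[symmetric] mult_exp_exp) (simp add: algebra_simps)
    ultimately show ?thesis by (simp add: f_def scaleR_conv_of_real exp_minus field_simps exp_of_real)
  qed
  have "has_bochner_integral lborel (\<lambda>x. indicator {0<..} x *\<^sub>R f x) (Gamma z)"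
    using absolutely_integrable_Gamma_integral'[OF z] Gamma_integral_complex'[OF z] meas
    by (subst has_bochner_integral_lborel_iff) (auto simp: f_def has_integral_iff)
  moreover have "range (exp :: real \<Rightarrow> real) = {0<..}"
    by (auto simp: image_def intro: exp_ln[symmetric])
  ultimately have "has_bochner_integral lborel (\<lambda>x. indicator (range (exp :: real \<Rightarrow> real)) x *\<^sub>R f x) (Gamma z)" by simp
  also have "?this \<longleftrightarrow> has_bochner_integral lborel (\<lambda>y. indicator UNIV y *\<^sub>R (exp y *\<^sub>R f (exp y))) (Gamma z)"
  proof (rule has_bochner_integral_substitution [symmetric])
    show "(\<lambda>y. indicator UNIV y *\<^sub>R (exp y *\<^sub>R f (exp y))) \<in> borel_measurable borel"
      unfolding eq by measurable
    show "(\<lambda>x. indicator (range (exp :: real \<Rightarrow> real)) x *\<^sub>R f x) \<in> borel_measurable borel"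
      using meas \<open>range exp = {0<..}\<close> by simp
    show "inj (exp :: real \<Rightarrow> real)" by (auto simp: inj_on_def)
  qed (use \<open>range exp = {0<..}\<close> in auto)
  finally show ?thesis by (simp add: eq)
qed

lemma gaussian_mellin:
  fixes m :: real and u :: complex
  assumes m: "m > 0" and u: "Re u > 0"
  shows "has_bochner_integral lborel (\<lambda>y. of_real (2 * exp (- m * exp (2 * y))) * exp (u * of_real y))
           (Gamma (u / 2) * exp (- (u / 2) * of_real (ln m)))"
proof -
  define c where "c = exp (- (u / 2) * of_real (ln m))"
  have "has_bochner_integral lborel (\<lambda>y. exp ((u/2) * of_real (ln m + 2 * y)) * of_real (exp (- exp (ln m + 2 * y)))) (Gamma (u/2) /\<^sub>R \<bar>2\<bar>)"
    by (rule iffD1[OF lborel_has_bochner_integral_real_affine_iff[where c = 2 and t = "ln m" and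
          f = "\<lambda>y. exp ((u/2) * of_real y) * of_real (exp (- exp y))"] Gamma_exp_integral])
       (use u in simp_all)
  hence "has_bochner_integral lborel (\<lambda>y. (2 * c) * (exp ((u/2) * of_real (ln m + 2 * y)) * of_real (exp (- exp (ln m + 2 * y))))) ((2 * c) * (Gamma (u/2) /\<^sub>R \<bar>2\<bar>))"
    by (rule has_bochner_integral_mult_right)
  moreover have "(2 * c) * (exp ((u/2) * of_real (ln m + 2 * y)) * of_real (exp (- exp (ln m + 2 * y)))) =
     of_real (2 * exp (- m * exp (2 * y))) * exp (u * of_real y)" for y
  proof -
    have "exp (ln m + 2 * y) = m * exp (2 * y)" using m by (simp add: exp_add)
    moreover have "c * exp ((u/2) * of_real (ln m + 2 * y)) = exp (u * of_real y)"
      by (simp add: c_def algebra_simps flip: exp_add)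
    ultimately show ?thesis by simp
  qed
  moreover have "(2 * c) * (Gamma (u/2) /\<^sub>R \<bar>2\<bar>) = Gamma (u/2) * c" by (simp add: scaleR_conv_of_real)
  ultimately show ?thesis unfolding c_def[symmetric] by (simp only:)
qed

lemma half_theta_measurable [measurable]: "half_theta \<in> borel_measurable borel"
  unfolding half_theta_def by measurable

definition dirichlet_zeta :: "complex \<Rightarrow> complex" where
  "dirichlet_zeta u = (\<Sum>n. of_nat (Suc n) powr (- u))"

lemma summable_dirichlet_real:
  fixes x :: real assumes "x > 1"
  shows "summable (\<lambda>n. exp (- x * ln (real (Suc n))))"
proof -
  have "summable (\<lambda>n. real n powr (-x))" using assms by (subst summable_real_powr_iff) auto
  hence "summable (\<lambda>n. real (Suc n) powr (-x))" by (rule summable_Suc_iff[THEN iffD2])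
  thus ?thesis by (simp add: powr_def)
qed

lemma dirichlet_zeta_sums:
  assumes "Re u > 1"
  shows "(\<lambda>n. of_nat (Suc n) powr (- u)) sums dirichlet_zeta u"
  unfolding dirichlet_zeta_def
proof (rule summable_sums, rule summable_norm_cancel)
  have "norm (of_nat (Suc n) powr (- u)) = exp (- Re u * ln (real (Suc n)))" for n
    by (subst norm_powr_real_powr) (auto simp: powr_def)
  thus "summable (\<lambda>n. norm (of_nat (Suc n) powr (- u)))"
    using summable_dirichlet_real[OF assms] by simp
qed

text \<open>
  The integrand of Riemann's formula for \<open>\<pi>\<^sup>-\<^sup>u\<^sup>/\<^sup>2 \<Gamma>(u/2) \<zeta>(u)\<close>, after the substitution \<open>x = exp (2 y)\<close>.
\<close>

definition theta_mellin :: "complex \<Rightarrow> real \<Rightarrow> complex" where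
  "theta_mellin u y = of_real (2 * half_theta (exp (2 * y))) * exp (u * of_real y)"

lemma theta_mellin_measurable [measurable]: "theta_mellin u \<in> borel_measurable borel"
  unfolding theta_mellin_def by measurable

lemma theta_mellin_integral:
  assumes u: "Re u > 1"
  shows "has_bochner_integral lborel (theta_mellin u)
           (Gamma (u / 2) * exp (- (u / 2) * of_real (ln pi)) * dirichlet_zeta u)"
proof -
  define f where "f = (\<lambda>n y. of_real (2 * exp (- (pi * (real (Suc n))\<^sup>2) * exp (2 * y))) * exp (u * of_real y))"
  define x where "x = Re u"
  have ln_eq: "ln (pi * (real (Suc n))\<^sup>2) = ln pi + 2 * ln (real (Suc n))" for n
    by (simp add: ln_mult ln_realpow del: of_nat_Suc)
  have int: "has_bochner_integral lborel (f n) (Gamma (u / 2) * exp (- (u / 2) * of_real (ln pi)) * of_nat (Suc n) powr (-u))" for n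
  proof -
    have "has_bochner_integral lborel (f n) (Gamma (u / 2) * exp (- (u / 2) * of_real (ln (pi * (real (Suc n))\<^sup>2))))"
      unfolding f_def using u by (intro gaussian_mellin) auto
    also have "exp (- (u / 2) * of_real (ln (pi * (real (Suc n))\<^sup>2))) = exp (- (u / 2) * of_real (ln pi)) * of_nat (Suc n) powr (-u)"
    proof -
      have "complex_of_nat (Suc n) powr (-u) = exp (- u * of_real (ln (real (Suc n))))"
        using Ln_of_real[of "real (Suc n)"] by (simp add: powr_def del: of_nat_Suc)
      thus ?thesis unfolding ln_eq by (simp add: algebra_simps flip: exp_add)
    qed
    finally show ?thesis by (simp only: mult.assoc)
  qed
  have norm_f: "norm (f n y) = Re (of_real (2 * exp (- (pi * (real (Suc n))\<^sup>2) * exp (2 * y))) * exp (of_real x * of_real y))" for n y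
    by (simp add: f_def norm_mult x_def Re_exp)
  have int_norm: "(LINT y|lborel. norm (f n y)) = Re (Gamma (of_real x / 2)) * exp (- (x/2) * ln pi) * exp (- x * ln (real (Suc n)))" for n
  proof -
    have "has_bochner_integral lborel (\<lambda>y. Re (of_real (2 * exp (- (pi * (real (Suc n))\<^sup>2) * exp (2 * y))) * exp (of_real x * of_real y)))
       (Re (Gamma (of_real x / 2) * exp (- (of_real x / 2) * of_real (ln (pi * (real (Suc n))\<^sup>2)))))"
      using u by (intro has_bochner_integral_Re gaussian_mellin) (auto simp: x_def)
    hence "(LINT y|lborel. norm (f n y)) = Re (Gamma (of_real x / 2) * exp (- (of_real x / 2) * of_real (ln (pi * (real (Suc n))\<^sup>2))))"
      unfolding norm_f by (rule has_bochner_integral_integral_eq)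
    also have "exp (- (of_real x / 2) * of_real (ln (pi * (real (Suc n))\<^sup>2))) = complex_of_real (exp (- (x/2) * ln pi) * exp (- x * ln (real (Suc n))))"
      unfolding ln_eq by (simp add: algebra_simps exp_of_real [symmetric] flip: exp_add)
    finally show ?thesis by simp
  qed
  have summ: "summable (\<lambda>n. norm (f n y))" for y
  proof -
    have "norm (f n y) = 2 * exp (x * y) * exp (-pi * (real (Suc n))\<^sup>2 * exp (2 * y))" for n
      by (simp add: norm_f Re_exp)
    thus ?thesis using summable_half_theta[of "exp (2 * y)"] by (auto intro: summable_mult)
  qed
  have sum_eq: "(\<Sum>n. f n y) = theta_mellin u y" for y
  proof -
    have "(\<lambda>n. exp (-pi * (real (Suc n))\<^sup>2 * exp (2 * y))) sums half_theta (exp (2 * y))"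
      unfolding half_theta_def by (intro summable_sums summable_half_theta) auto
    hence "(\<lambda>n. complex_of_real (exp (-pi * (real (Suc n))\<^sup>2 * exp (2 * y)))) sums of_real (half_theta (exp (2 * y)))"
      by (rule sums_of_real)
    hence "(\<lambda>n. (2 * exp (u * of_real y)) * complex_of_real (exp (-pi * (real (Suc n))\<^sup>2 * exp (2 * y)))) sums ((2 * exp (u * of_real y)) * of_real (half_theta (exp (2 * y))))"
      by (rule sums_mult)
    thus ?thesis by (simp add: sums_iff f_def theta_mellin_def mult_ac)
  qed
  have summ_int: "summable (\<lambda>n. LINT y|lborel. norm (f n y))"
    unfolding int_norm using u by (intro summable_mult summable_dirichlet_real) (auto simp: x_def)
  have f_int: "integrable lborel (f n)" for n using int[of n] by (simp add: has_bochner_integral_iff)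
  have 1: "integrable lborel (theta_mellin u)"
    using integrable_suminf[OF f_int AE_I2[OF summ] summ_int] by (simp add: sum_eq)
  have "(\<lambda>n. integral\<^sup>L lborel (f n)) sums integral\<^sup>L lborel (theta_mellin u)"
    using sums_integral[OF f_int AE_I2[OF summ] summ_int] by (simp add: sum_eq)
  also have "(\<lambda>n. integral\<^sup>L lborel (f n)) = (\<lambda>n. Gamma (u / 2) * exp (- (u / 2) * of_real (ln pi)) * of_nat (Suc n) powr (-u))"
    using int by (simp only: has_bochner_integral_iff fun_eq_iff) blast
  finally have "integral\<^sup>L lborel (theta_mellin u) = Gamma (u / 2) * exp (- (u / 2) * of_real (ln pi)) * dirichlet_zeta u"
    by (rule sums_unique2[OF _ sums_mult[OF dirichlet_zeta_sums[OF u]]])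
  with 1 show ?thesis by (simp add: has_bochner_integral_iff)
qed

definition theta_tail :: "complex \<Rightarrow> complex" where
  "theta_tail u = (LINT y|lborel. indicator {0<..} y *\<^sub>R theta_mellin u y)"

lemma norm_theta_mellin: "norm (theta_mellin u y) = 2 * half_theta (exp (2 * y)) * exp (Re u * y)"
  using half_theta_nonneg[of "exp (2 * y)"] by (simp add: theta_mellin_def norm_mult)

lemma theta_tail_integrable: "integrable lborel (\<lambda>y. indicator {0<..} y *\<^sub>R theta_mellin u y)"
proof (rule Bochner_Integration.integrable_bound)
  define x where "x = max 2 (Re u)"
  \<comment> \<open>Any exponent greater than \<open>1\<close> that dominates \<open>Re u\<close> serves as a majorant.\<close>
  show "integrable lborel (theta_mellin (of_real x))"
    using theta_mellin_integral[of "of_real x"] by (auto simp: has_bochner_integral_iff x_def)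
  show "AE y in lborel. norm (indicator {0<..} y *\<^sub>R theta_mellin u y) \<le> norm (theta_mellin (of_real x) y)"
  proof (rule AE_I2)
    fix y :: real
    have "2 * half_theta (exp (2 * y)) * exp (Re u * y) \<le> 2 * half_theta (exp (2 * y)) * exp (x * y)" if "y > 0"
      using that half_theta_nonneg[of "exp (2 * y)"]
      by (intro mult_left_mono) (auto simp: x_def intro: mult_right_mono)
    thus "norm (indicator {0<..} y *\<^sub>R theta_mellin u y) \<le> norm (theta_mellin (of_real x) y)"
      using half_theta_nonneg[of "exp (2 * y)"] by (auto simp: norm_theta_mellin indicator_def)
  qed
qed measurable

lemma theta_tail_bound:
  assumes "Re u \<le> x"
  shows "norm (theta_tail u) \<le> Re (theta_tail (of_real x))"
proof -
  have "norm (theta_tail u) \<le> (LINT y|lborel. Re (indicator {0<..} y *\<^sub>R theta_mellin (of_real x) y))"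
    unfolding theta_tail_def
  proof (rule Bochner_Integration.integral_norm_bound_integral)
    show "integrable lborel (\<lambda>y. Re (indicator {0<..} y *\<^sub>R theta_mellin (of_real x) y))"
      by (intro integrable_Re theta_tail_integrable)
    fix y :: real
    have "exp (Re u * y) \<le> exp (x * y)" if "y > 0"
      using that assms by (auto intro: mult_right_mono)
    thus "norm (indicator {0<..} y *\<^sub>R theta_mellin u y) \<le> Re (indicator {0<..} y *\<^sub>R theta_mellin (of_real x) y)"
      using half_theta_nonneg[of "exp (2 * y)"]
      unfolding norm_scaleR norm_theta_mellin
      by (auto simp: indicator_def theta_mellin_def Re_exp intro!: mult_right_mono)
  qed (rule theta_tail_integrable)
  also have "\<dots> = Re (theta_tail (of_real x))"
    unfolding theta_tail_def by (intro integral_Re theta_tail_integrable)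
  finally show ?thesis .
qed

text \<open>
  Expanding \<open>exp (u y)\<close> under the integral gives an everywhere convergent power series; this is a
  short way to see that \<open>theta_tail\<close> is entire.
\<close>

lemma theta_tail_power_series:
  "(\<lambda>k. (LINT y|lborel. indicator {0<..} y *\<^sub>R (theta_mellin 0 y * of_real y ^ k / fact k)) * u ^ k) sums theta_tail u"
proof -
  define f where "f = (\<lambda>k y. u ^ k * (indicator {0<..} y *\<^sub>R (theta_mellin 0 y * of_real y ^ k / fact k)))"
  define g where "g = (\<lambda>y. indicator {0<..} y *\<^sub>R theta_mellin (of_real (norm u)) y)"
  have [measurable]: "f k \<in> borel_measurable borel" for k unfolding f_def by measurable
  have mell: "theta_mellin v y = theta_mellin 0 y * exp (v * of_real y)" for v y by (simp add: theta_mellin_def)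
  have sums: "(\<lambda>k. f k y) sums (indicator {0<..} y *\<^sub>R theta_mellin u y)" for y
  proof -
    have "(\<lambda>k. (u * of_real y) ^ k /\<^sub>R fact k) sums exp (u * of_real y)" by (rule exp_converges)
    hence "(\<lambda>k. indicator {0<..} y *\<^sub>R (theta_mellin 0 y * ((u * of_real y) ^ k /\<^sub>R fact k))) sums (indicator {0<..} y *\<^sub>R (theta_mellin 0 y * exp (u * of_real y)))"
      by (intro sums_scaleR_right sums_mult)
    moreover have "indicator {0<..} y *\<^sub>R (theta_mellin 0 y * ((u * of_real y) ^ k /\<^sub>R fact k)) = f k y" for k
      by (simp add: f_def power_mult_distrib scaleR_conv_of_real field_simps)
    ultimately show ?thesis by (simp add: mell[of u])
  qed
  have norm_sums: "(\<lambda>k. norm (f k y)) sums norm (g y)" for y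
  proof -
    have "(\<lambda>k. (norm u * y) ^ k /\<^sub>R fact k) sums exp (norm u * y)" by (rule exp_converges)
    hence "(\<lambda>k. indicator {0<..} y * norm (theta_mellin 0 y) * ((norm u * y) ^ k /\<^sub>R fact k)) sums (indicator {0<..} y * norm (theta_mellin 0 y) * exp (norm u * y))"
      by (rule sums_mult)
    moreover have "indicator {0<..} y * norm (theta_mellin 0 y) * ((norm u * y) ^ k /\<^sub>R fact k) = norm (f k y)" for k
      by (simp add: f_def norm_mult norm_divide norm_power power_mult_distrib indicator_def field_simps)
    moreover have "indicator {0<..} y * norm (theta_mellin 0 y) * exp (norm u * y) = norm (g y)"
      by (simp add: g_def norm_theta_mellin indicator_def)
    ultimately show ?thesis by simp
  qed
  have g: "integrable lborel g" unfolding g_def by (rule theta_tail_integrable)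
  have f: "integrable lborel (f k)" for k
  proof (rule Bochner_Integration.integrable_bound[OF g])
    show "AE y in lborel. norm (f k y) \<le> norm (g y)"
    proof (rule AE_I2)
      fix y show "norm (f k y) \<le> norm (g y)"
        using sum_le_suminf[of "\<lambda>k. norm (f k y)" "{k}"] norm_sums[of y] by (simp add: sums_iff)
    qed
  qed measurable
  have summ: "summable (\<lambda>k. LINT y|lborel. norm (f k y))"
  proof (rule bounded_imp_summable)
    fix n
    have "(\<Sum>k\<le>n. LINT y|lborel. norm (f k y)) = (LINT y|lborel. (\<Sum>k\<le>n. norm (f k y)))"
      by (intro Bochner_Integration.integral_sum[symmetric] integrable_norm f)
    also have "\<dots> \<le> (LINT y|lborel. norm (g y))"
    proof (intro integral_mono Bochner_Integration.integrable_sum integrable_norm f g)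
      fix y show "(\<Sum>k\<le>n. norm (f k y)) \<le> norm (g y)"
        using sum_le_suminf[of "\<lambda>k. norm (f k y)" "{..n}"] norm_sums[of y] by (simp add: sums_iff)
    qed
    finally show "(\<Sum>k\<le>n. LINT y|lborel. norm (f k y)) \<le> (LINT y|lborel. norm (g y))" .
  qed auto
  have "(\<lambda>k. integral\<^sup>L lborel (f k)) sums (LINT y|lborel. (\<Sum>k. f k y))"
    using norm_sums by (intro sums_integral f summ AE_I2) (auto simp: sums_iff)
  also have "(\<lambda>y. \<Sum>k. f k y) = (\<lambda>y. indicator {0<..} y *\<^sub>R theta_mellin u y)"
    using sums by (simp add: sums_iff fun_eq_iff)
  also have "(LINT y|lborel. \<dots> y) = theta_tail u" by (simp add: theta_tail_def)
  also have "(\<lambda>k. integral\<^sup>L lborel (f k)) = (\<lambda>k. (LINT y|lborel. indicator {0<..} y *\<^sub>R (theta_mellin 0 y * of_real y ^ k / fact k)) * u ^ k)"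
    unfolding f_def by (rule ext, subst Bochner_Integration.integral_mult_right_zero) (rule mult.commute)
  finally show ?thesis .
qed

lemma theta_tail_holomorphic [holomorphic_intros]:
  assumes "f holomorphic_on A"
  shows "(\<lambda>u. theta_tail (f u)) holomorphic_on A"
proof -
  have "theta_tail holomorphic_on ball 0 r" for r
    by (rule power_series_holomorphic) (use theta_tail_power_series in simp)
  hence "theta_tail holomorphic_on UNIV"
    by (metis UNIV_I centre_in_ball holomorphic_on_open open_ball open_UNIV mem_ball_0 linordered_field_no_ub)
  thus ?thesis using holomorphic_on_compose_gen[OF assms, of theta_tail UNIV] by (simp add: o_def)
qed

text \<open>
  Riemann's formula for \<open>\<xi>\<close>. It makes the symmetry under \<open>u \<mapsto> 1 - u\<close> and the absence of
  singularities evident; the agreement with the product of the zeta and Gamma factors is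
  proved for \<open>Re u > 1\<close> in \<open>entire_xi_eq_zeta\<close>.
\<close>

definition entire_xi :: "complex \<Rightarrow> complex" where
  "entire_xi u = 1/2 + u * (u - 1) / 2 * (theta_tail u + theta_tail (1 - u))"

lemma entire_xi_reflect: "entire_xi (1 - u) = entire_xi u"
  by (simp add: entire_xi_def algebra_simps)

lemma entire_xi_holomorphic [holomorphic_intros]: 
  "f holomorphic_on A \<Longrightarrow> (\<lambda>u. entire_xi (f u)) holomorphic_on A"
  unfolding entire_xi_def by (intro holomorphic_intros) auto

lemma entire_xi_1 [simp]: "entire_xi 1 = 1/2"
  by (simp add: entire_xi_def)

lemma exp_decay_integral:
  fixes c :: complex assumes c: "Re c > 0"
  shows "has_bochner_integral lborel (\<lambda>y. indicator {0<..} y *\<^sub>R exp (- c * of_real y)) (1 / c)"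
proof -
  define x where "x = Re c"
  have norm: "norm (exp (- c * of_real y)) = exp (- x * y)" for y by (simp add: x_def)
  have major: "integrable lborel (\<lambda>y. indicator {0..} y *\<^sub>R exp (- x * y))"
  proof -
    have "has_bochner_integral lborel (\<lambda>y. indicator {0..} y *\<^sub>R exp (- x * y)) (1 / x)"
      using has_integral_exp_minus_to_infinity[of x 0] c
      by (intro has_bochner_integral_lborel_nonneg) (auto simp: x_def)
    thus ?thesis by (simp add: has_bochner_integral_iff)
  qed
  have int: "integrable lborel (\<lambda>y. indicator {0<..} y *\<^sub>R exp (- c * of_real y))"
  proof (rule Bochner_Integration.integrable_bound)
    show "integrable lborel (\<lambda>y. indicator {0..} y *\<^sub>R exp (- x * y))" by (rule major)
  qed (auto simp: x_def indicator_def intro!: AE_I2)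
  have "(\<lambda>n. LINT y|lborel. indicator {0..real n} y *\<^sub>R exp (- c * of_real y)) \<longlonglongrightarrow> (LINT y|lborel. indicator {0..} y *\<^sub>R exp (- c * of_real y))"
  proof (rule integral_dominated_convergence)
    show "integrable lborel (\<lambda>y. indicator {0..} y *\<^sub>R exp (- x * y))" by (rule major)
    show "AE y in lborel. (\<lambda>n. indicator {0..real n} y *\<^sub>R exp (- c * of_real y)) \<longlonglongrightarrow> indicator {0..} y *\<^sub>R exp (- c * of_real y)"
    proof (rule AE_I2)
      fix y :: real
      have "eventually (\<lambda>n. real n \<ge> y) sequentially"
        using filterlim_real_sequentially by (auto simp: filterlim_at_top)
      hence "eventually (\<lambda>n. indicator {0..real n} y *\<^sub>R exp (- c * of_real y) = indicator {0..} y *\<^sub>R exp (- c * of_real y)) sequentially"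
        by eventually_elim (auto simp: indicator_def)
      thus "(\<lambda>n. indicator {0..real n} y *\<^sub>R exp (- c * of_real y)) \<longlonglongrightarrow> indicator {0..} y *\<^sub>R exp (- c * of_real y)"
        by (rule tendsto_eventually)
    qed
    show "AE y in lborel. norm (indicator {0..real n} y *\<^sub>R exp (- c * of_real y)) \<le> indicator {0..} y *\<^sub>R exp (- x * y)" for n
      by (rule AE_I2) (simp add: x_def indicator_def)
  qed measurable
  moreover have "(LINT y|lborel. indicator {0..real n} y *\<^sub>R exp (- c * of_real y)) = 1 / c - exp (- c * of_real (real n)) / c" for n
  proof -
    have c0: "c \<noteq> 0" using c by auto
    have "has_bochner_integral lborel (\<lambda>y. indicator {0..real n} y *\<^sub>R exp (- c * of_real y)) 
        ((- exp (- c * of_real (real n)) / c) - (- exp (- c * of_real 0) / c))"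
    proof (rule has_bochner_integral_FTC_Icc)
      show "((\<lambda>y. - exp (- c * of_real y) / c) has_vector_derivative exp (- c * of_real y)) (at y within {0..real n})" for y
      proof -
        have "((\<lambda>z. - exp (- c * z) / c) has_field_derivative exp (- c * of_real y)) (at (of_real y))"
          using c0 by (auto intro!: derivative_eq_intros)
        from has_vector_derivative_real_field[OF this] show ?thesis by (rule has_vector_derivative_at_within)
      qed
    qed (auto intro!: continuous_intros)
    thus ?thesis by (simp add: has_bochner_integral_iff)
  qed
  moreover have "(\<lambda>n. 1 / c - exp (- c * of_real (real n)) / c) \<longlonglongrightarrow> 1 / c - 0 / c"
  proof (intro tendsto_intros)
    show "(\<lambda>n. exp (- c * of_real (real n))) \<longlonglongrightarrow> 0"
    proof (rule tendsto_norm_zero_cancel)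
      show "(\<lambda>n. norm (exp (- c * of_real (real n)))) \<longlonglongrightarrow> 0"
        unfolding norm using c unfolding x_def[symmetric] by real_asymp
    qed
  qed (use c in auto)
  ultimately have "(LINT y|lborel. indicator {0..} y *\<^sub>R exp (- c * of_real y)) = 1 / c - 0 / c"
    by (simp add: LIMSEQ_unique)
  also have "(LINT y|lborel. indicator {0..} y *\<^sub>R exp (- c * of_real y)) = (LINT y|lborel. indicator {0<..} y *\<^sub>R exp (- c * of_real y))"
    by (rule integral_discrete_difference[where X = "{0}"]) (auto simp: indicator_def)
  finally show ?thesis using int by (simp add: has_bochner_integral_iff)
qed

text \<open>
  The part of the integral over negative \<open>y\<close> is reflected to positive \<open>y\<close> by \<open>theta_inverse\<close>. The
  two elementary exponentials that this produces integrate to \<open>1 / (u - 1) - 1 / u\<close>.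
\<close>

lemma theta_mellin_eq_xi:
  assumes u: "Re u > 1"
  shows "(LINT y|lborel. theta_mellin u y) = 2 * entire_xi u / (u * (u - 1))"
proof -
  have u0: "u \<noteq> 0" "u \<noteq> 1" using u by auto
  have int: "integrable lborel (theta_mellin u)"
    using theta_mellin_integral[OF u] by (simp add: has_bochner_integral_iff)
  define N where "N = (LINT y|lborel. indicator {..<0} y *\<^sub>R theta_mellin u y)"
  have "(LINT y|lborel. theta_mellin u y) = (LINT y|lborel. indicator {0<..} y *\<^sub>R theta_mellin u y + indicator {..<0} y *\<^sub>R theta_mellin u y)"
    by (rule integral_discrete_difference[where X = "{0}"]) (auto simp: indicator_def)
  also have "\<dots> = theta_tail u + N"
    unfolding theta_tail_def N_def
    by (intro Bochner_Integration.integral_add theta_tail_integrable integrable_mult_indicator int) auto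
  also have "N = (LINT y|lborel. indicator {0<..} y *\<^sub>R theta_mellin u (- y))"
  proof -
    have "N = \<bar>-1\<bar> *\<^sub>R (LINT y|lborel. indicator {..<0} (0 + (-1) * y) *\<^sub>R theta_mellin u (0 + (-1) * y))"
      unfolding N_def by (rule lborel_integral_real_affine) auto
    thus ?thesis by (simp add: indicator_def)
  qed
  also have "(\<lambda>y. indicator {0<..} y *\<^sub>R theta_mellin u (- y)) =
     (\<lambda>y. indicator {0<..} y *\<^sub>R theta_mellin (1 - u) y + (indicator {0<..} y *\<^sub>R exp (- (u - 1) * of_real y) - indicator {0<..} y *\<^sub>R exp (- u * of_real y)))"
  proof
    fix y :: real
    have "2 * half_theta (exp (2 * (-y))) = exp y * (1 + 2 * half_theta (exp (2 * y))) - 1"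
    proof -
      have "sqrt (exp (2 * y)) = exp y" by (simp add: exp_double)
      thus ?thesis
        using theta_inverse[of "exp (2 * y)"] by (simp add: theta_def exp_minus inverse_eq_divide)
    qed
    hence "theta_mellin u (-y) = of_real (exp y * (1 + 2 * half_theta (exp (2 * y))) - 1) * exp (- u * of_real y)"
      by (simp add: theta_mellin_def)
    also have "\<dots> = (1 + of_real (2 * half_theta (exp (2 * y)))) * (exp (of_real y) * exp (- u * of_real y)) - exp (- u * of_real y)"
      by (simp add: exp_of_real algebra_simps)
    also have "exp (of_real y) * exp (- u * of_real y) = exp ((1 - u) * of_real y)"
      by (simp add: algebra_simps flip: exp_add)
    also have "(1 + of_real (2 * half_theta (exp (2 * y)))) * exp ((1 - u) * of_real y) - exp (- u * of_real y) =
       theta_mellin (1 - u) y + (exp (- (u - 1) * of_real y) - exp (- u * of_real y))"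
      by (simp add: theta_mellin_def algebra_simps)
    finally show "indicator {0<..} y *\<^sub>R theta_mellin u (- y) = indicator {0<..} y *\<^sub>R theta_mellin (1 - u) y + (indicator {0<..} y *\<^sub>R exp (- (u - 1) * of_real y) - indicator {0<..} y *\<^sub>R exp (- u * of_real y))"
      by (simp only: scaleR_add_right scaleR_diff_right)
  qed
  also have "(LINT y|lborel. \<dots> y) = theta_tail (1 - u) + (1 / (u - 1) - 1 / u)"
  proof -
    have "has_bochner_integral lborel (\<lambda>y. indicator {0<..} y *\<^sub>R theta_mellin (1 - u) y + (indicator {0<..} y *\<^sub>R exp (- (u - 1) * of_real y) - indicator {0<..} y *\<^sub>R exp (- u * of_real y))) (theta_tail (1 - u) + (1 / (u - 1) - 1 / u))"
      using theta_tail_integrable[of "1 - u"] u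
      by (intro has_bochner_integral_add has_bochner_integral_diff exp_decay_integral) 
         (auto simp: has_bochner_integral_iff theta_tail_def)
    thus ?thesis by (rule has_bochner_integral_integral_eq)
  qed
  finally have "(LINT y|lborel. theta_mellin u y) = theta_tail u + (theta_tail (1 - u) + (1 / (u - 1) - 1 / u))" .
  also have "1 / (u - 1) - 1 / u = 1 / (u * (u - 1))" using u0 by (simp add: field_simps)
  also have "theta_tail u + (theta_tail (1 - u) + 1 / (u * (u - 1))) = 2 * entire_xi u / (u * (u - 1))"
    using u0 unfolding entire_xi_def by (simp add: add_divide_distrib distrib_left)
  finally show ?thesis .
qed

lemma entire_xi_eq_zeta:
  assumes u: "Re u > 1"
  shows "entire_xi u = (u - 1) * exp (- (u / 2) * of_real (ln pi)) * dirichlet_zeta u * Gamma (1 + u / 2)"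
proof -
  have u0: "u \<noteq> 0" "u \<noteq> 1" using u by auto
  have "Gamma (u / 2) * exp (- (u / 2) * of_real (ln pi)) * dirichlet_zeta u = 2 * entire_xi u / (u * (u - 1))"
    using theta_mellin_integral[OF u] theta_mellin_eq_xi[OF u] by (simp add: has_bochner_integral_iff)
  moreover have "Gamma (1 + u / 2) = (u / 2) * Gamma (u / 2)"
  proof -
    have "u / 2 \<notin> \<int>\<^sub>\<le>\<^sub>0"
    proof
      assume "u / 2 \<in> \<int>\<^sub>\<le>\<^sub>0"
      then obtain n where "u / 2 = of_int n" "n \<le> 0" by (elim nonpos_Ints_cases)
      hence "Re (u / 2) \<le> 0" by simp
      thus False using u by simp
    qed
    from Gamma_plus1[OF this] show ?thesis by (simp only: add.commute)
  qed
  moreover define G T where "G = Gamma (u / 2)" and "T = exp (- (u / 2) * of_real (ln pi)) * dirichlet_zeta u"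
  ultimately have "G * T = 2 * entire_xi u / (u * (u - 1))" "Gamma (1 + u / 2) = (u / 2) * G"
    by (simp_all only: mult.assoc)
  hence "2 * entire_xi u = 2 * ((u - 1) * T * ((u / 2) * G))" "Gamma (1 + u / 2) = (u / 2) * G"
    using u0 by (simp_all add: field_simps)
  hence "entire_xi u = (u - 1) * T * Gamma (1 + u / 2)"
    by (metis mult_cancel_left zero_neq_numeral)
  thus ?thesis by (simp only: T_def mult.assoc)
qed

section \<open>Decay of xi in vertical strips\<close>

text \<open>
  A crude bound, needed only as the growth condition of the Phragmen-Lindelof principle.
\<close>

lemma entire_xi_growth:
  "\<exists>K. \<forall>u. 1 - B \<le> Re u \<and> Re u \<le> B \<longrightarrow> norm (entire_xi u) \<le> K * (1 + norm u)\<^sup>2"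
proof -
  define K where "K = 1 + 2 * Re (theta_tail (of_real B))"
  show ?thesis
  proof (intro exI allI impI)
    fix u :: complex assume u: "1 - B \<le> Re u \<and> Re u \<le> B"
    define W where "W = Re (theta_tail (of_real B))"
    have W: "norm (theta_tail u) \<le> W" "norm (theta_tail (1 - u)) \<le> W"
      unfolding W_def by (rule theta_tail_bound; use u in simp)+
    have W0: "W \<ge> 0" using W(1) norm_ge_zero[of "theta_tail u"] by linarith
    have n: "norm (u - 1) \<le> 1 + norm u" using norm_triangle_ineq4[of u 1] by simp
    have "norm (entire_xi u) \<le> norm (1/2 :: complex) + norm (u * (u - 1) / 2 * (theta_tail u + theta_tail (1 - u)))"
      unfolding entire_xi_def by (rule norm_triangle_ineq)
    also have "norm (u * (u - 1) / 2 * (theta_tail u + theta_tail (1 - u))) = norm u * norm (u - 1) / 2 * norm (theta_tail u + theta_tail (1 - u))"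
      by (simp add: norm_mult norm_divide)
    also have "\<dots> \<le> (1 + norm u) * (1 + norm u) / 2 * (W + W)"
      by (intro mult_mono divide_right_mono order_trans[OF norm_triangle_ineq add_mono] W n) (use W0 in auto)
    also have "norm (1/2 :: complex) + (1 + norm u) * (1 + norm u) / 2 * (W + W) \<le> K * (1 + norm u)\<^sup>2"
    proof -
      define S where "S = (1 + norm u)\<^sup>2"
      have "1 \<le> S" unfolding S_def using power_mono[of 1 "1 + norm u" 2] by simp
      moreover have "0 \<le> W * S" using W0 by (simp add: S_def)
      moreover have "(1 + norm u) * (1 + norm u) / 2 * (W + W) = W * S"
        by (simp add: S_def power2_eq_square)
      moreover have "K * S = S + 2 * (W * S)" by (simp add: K_def W_def algebra_simps)
      ultimately have "1/2 + (1 + norm u) * (1 + norm u) / 2 * (W + W) \<le> K * S" by linarith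
      thus ?thesis by (simp add: S_def)
    qed
    finally show "norm (entire_xi u) \<le> K * (1 + norm u)\<^sup>2" by simp
  qed
qed

text \<open>
  The factor \<open>exp (e (u - 1/2)\<^sup>2)\<close> decays on the strip faster than any polynomial, so the maximum
  modulus principle applies to a large rectangle; then \<open>e\<close> tends to \<open>0\<close>.
\<close>

lemma phragmen_lindelof_strip:
  assumes hol: "f holomorphic_on UNIV"
    and growth: "\<And>u. 1 - B \<le> Re u \<Longrightarrow> Re u \<le> B \<Longrightarrow> norm (f u) \<le> K * (1 + norm u) ^ n"
    and edge: "\<And>u. Re u = B \<or> Re u = 1 - B \<Longrightarrow> norm (f u) \<le> C"
    and z: "1 - B \<le> Re z" "Re z \<le> B"
  shows "norm (f z) \<le> C"
proof -
  \<comment> \<open>The maximum of \<open>Re ((u - 1/2)\<^sup>2)\<close> on the strip.\<close>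
  define D where "D = (B - 1/2)\<^sup>2"
  have cont: "continuous_on UNIV f" using hol by (rule holomorphic_on_imp_continuous_on)
  have C0: "C \<ge> 0" by (rule order_trans[OF norm_ge_zero edge[of "of_real B"]]) simp
  have K0: "K \<ge> 0" using growth[of z] z norm_ge_zero[of "f z"]
    by (smt (verit) mult_nonneg_nonneg mult_less_0_iff zero_less_power norm_ge_zero)
  have main: "norm (f z * exp (of_real e * (z - 1/2)\<^sup>2)) \<le> C * exp (e * D)" if e: "e > 0" for e
  proof -
    define g where "g = (\<lambda>u. f u * exp (of_real e * (u - 1/2)\<^sup>2))"
    have norm_g: "norm (g u) = norm (f u) * exp (e * ((Re u - 1/2)\<^sup>2 - (Im u)\<^sup>2))" for u
      by (simp add: g_def norm_mult power2_eq_square)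
    have sq: "(Re u - 1/2)\<^sup>2 \<le> D" if "1 - B \<le> Re u" "Re u \<le> B" for u
      unfolding D_def using that by (intro abs_le_square_iff[THEN iffD1]) auto
    define A where "A = 2 + \<bar>B\<bar>"
    have "((\<lambda>T::real. K * (A + T) ^ n * exp (e * (D - T\<^sup>2))) \<longlongrightarrow> 0) at_top"
    proof -
      have "((\<lambda>T::real. (A + T) ^ n * exp (e * (D - T\<^sup>2))) \<longlongrightarrow> 0) at_top"
        using e by real_asymp
      from tendsto_mult_right_zero[OF this, of K] show ?thesis by (simp add: mult.assoc)
    qed
    moreover have "0 < C * exp (e * D) \<or> C = 0" using C0 by auto
    ultimately have ev: "eventually (\<lambda>T. K * (A + T) ^ n * exp (e * (D - T\<^sup>2)) < d) at_top" if "d > 0" for d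
      using that by (intro order_tendstoD) auto
    show "norm (f z * exp (of_real e * (z - 1/2)\<^sup>2)) \<le> C * exp (e * D)"
    proof (rule field_le_epsilon)
      fix d :: real assume d: "d > 0"
      from eventually_happens'[OF trivial_limit_at_top_linorder eventually_conj[OF ev[OF d] eventually_gt_at_top[of "\<bar>Im z\<bar> + 1"]]]
      obtain T where T: "K * (A + T) ^ n * exp (e * (D - T\<^sup>2)) < d" "T > \<bar>Im z\<bar> + 1"
        by blast
      define S where "S = cbox (Complex (1 - B) (-T)) (Complex B T)"
      have "norm (g z) \<le> C * exp (e * D) + d"
      proof (rule maximum_modulus_frontier[of g S])
        show "g holomorphic_on interior S"
          unfolding g_def by (intro holomorphic_intros holomorphic_on_subset[OF hol]) auto
        show "continuous_on (closure S) g"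
          unfolding g_def by (intro continuous_intros continuous_on_subset[OF cont]) auto
        show "bounded S" unfolding S_def by (rule bounded_cbox)
        show "z \<in> S" using z T by (auto simp: S_def in_cbox_complex_iff)
        fix u assume "u \<in> frontier S"
        hence "u \<in> S" "u \<notin> box (Complex (1 - B) (-T)) (Complex B T)"
          by (auto simp: S_def frontier_def interior_cbox)
        hence u: "1 - B \<le> Re u" "Re u \<le> B" "\<bar>Im u\<bar> \<le> T" and
          "Re u = B \<or> Re u = 1 - B \<or> \<bar>Im u\<bar> = T"
          by (auto simp: S_def in_cbox_complex_iff in_box_complex_iff)
        from this(4) show "norm (g u) \<le> C * exp (e * D) + d"
        proof (elim disjE)
          assume T': "\<bar>Im u\<bar> = T"
          have "norm u \<le> \<bar>Re u\<bar> + \<bar>Im u\<bar>" by (rule cmod_le)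
          hence nu: "1 + norm u \<le> A + T" using u T' by (auto simp: A_def)
          have "norm (g u) \<le> (K * (1 + norm u) ^ n) * exp (e * (D - T\<^sup>2))"
            unfolding norm_g
          proof (intro mult_mono growth u)
            have "(Im u)\<^sup>2 = T\<^sup>2" using T' by (metis power2_abs)
            thus "exp (e * ((Re u - 1/2)\<^sup>2 - (Im u)\<^sup>2)) \<le> exp (e * (D - T\<^sup>2))"
              using sq[OF u(1,2)] e by (simp add: mult_left_mono)
          qed (use K0 in auto)
          also have "\<dots> \<le> (K * (A + T) ^ n) * exp (e * (D - T\<^sup>2))"
            by (intro mult_right_mono mult_left_mono power_mono nu K0) auto
          also have "\<dots> < d" by (rule T)
          finally show ?thesis using C0 by (smt (verit) exp_ge_zero mult_nonneg_nonneg)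
        next
          assume "Re u = B"
          hence "norm (f u) \<le> C" using edge by blast
          moreover have "(Re u - 1/2)\<^sup>2 - (Im u)\<^sup>2 \<le> D"
            using sq[OF u(1,2)] zero_le_power2[of "Im u"] by linarith
          hence "exp (e * ((Re u - 1/2)\<^sup>2 - (Im u)\<^sup>2)) \<le> exp (e * D)"
            using e by (simp add: mult_left_mono)
          ultimately have "norm (g u) \<le> C * exp (e * D)" unfolding norm_g using C0 by (intro mult_mono) auto
          thus ?thesis using d by linarith
        next
          assume "Re u = 1 - B"
          hence "norm (f u) \<le> C" using edge by blast
          moreover have "(Re u - 1/2)\<^sup>2 - (Im u)\<^sup>2 \<le> D"
            using sq[OF u(1,2)] zero_le_power2[of "Im u"] by linarith
          hence "exp (e * ((Re u - 1/2)\<^sup>2 - (Im u)\<^sup>2)) \<le> exp (e * D)"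
            using e by (simp add: mult_left_mono)
          ultimately have "norm (g u) \<le> C * exp (e * D)" unfolding norm_g using C0 by (intro mult_mono) auto
          thus ?thesis using d by linarith
        qed
      qed
      thus "norm (f z * exp (of_real e * (z - 1/2)\<^sup>2)) \<le> C * exp (e * D) + d" by (simp add: g_def)
    qed
  qed
  show ?thesis
  proof (rule tendsto_le)
    have "((\<lambda>e. norm (f z * exp (of_real e * (z - 1/2)\<^sup>2))) \<longlongrightarrow> norm (f z * exp (of_real 0 * (z - 1/2)\<^sup>2))) (at_right 0)"
      by (intro tendsto_intros)
    thus "((\<lambda>e. norm (f z * exp (of_real e * (z - 1/2)\<^sup>2))) \<longlongrightarrow> norm (f z)) (at_right 0)" by simp
    have "((\<lambda>e. C * exp (e * D)) \<longlongrightarrow> C * exp (0 * D)) (at_right 0)"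
      by (intro tendsto_intros)
    thus "((\<lambda>e. C * exp (e * D)) \<longlongrightarrow> C) (at_right 0)" by simp
    show "eventually (\<lambda>e. norm (f z * exp (of_real e * (z - 1/2)\<^sup>2)) \<le> C * exp (e * D)) (at_right 0)"
      using eventually_at_right_less[of 0] by eventually_elim (rule main)
  qed auto
qed

lemma norm_Gamma_le:
  assumes "Re z > 0"
  shows "norm (Gamma z) \<le> Gamma (Re z)"
proof -
  have *: "has_bochner_integral lborel (\<lambda>y. exp (z * of_real y) * of_real (exp (- exp y))) (Gamma z)"
    by (rule Gamma_exp_integral[OF assms])
  have **: "has_bochner_integral lborel (\<lambda>y. Re (exp (of_real (Re z) * of_real y) * of_real (exp (- exp y)))) (Re (Gamma (of_real (Re z))))"
    using assms by (intro has_bochner_integral_Re Gamma_exp_integral) auto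
  have "norm (LINT y|lborel. exp (z * of_real y) * of_real (exp (- exp y))) \<le> 
     (LINT y|lborel. Re (exp (of_real (Re z) * of_real y) * of_real (exp (- exp y))))"
    by (rule Bochner_Integration.integral_norm_bound_integral)
       (use * ** in \<open>auto simp: has_bochner_integral_iff norm_mult Re_exp\<close>)
  thus ?thesis using * ** by (simp add: has_bochner_integral_iff Gamma_complex_of_real)
qed

text \<open>
  On the line \<open>Re u = B\<close> the Dirichlet series is bounded, and three steps of the recursion of the
  Gamma function give decay of order \<open>\<bar>u\<bar>\<^sup>-\<^sup>3\<close>. This compensates the factor \<open>u - 1\<close> and the
  quadratic polynomial.
\<close>

lemma entire_xi_edge_decay:
  assumes B: "B > 1"
  shows "\<exists>C. \<forall>u. Re u = B \<longrightarrow> norm (entire_xi u * (of_real (B\<^sup>2) - (u - 1/2)\<^sup>2)) \<le> C"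
proof -
  define Z where "Z = (\<Sum>n. exp (- B * ln (real (Suc n))))"
  define C where "C = Gamma (1 + B/2 + 3) * exp (- (B/2) * ln pi) * Z * 80"
  show ?thesis
  proof (intro exI allI impI)
    fix u assume u: "Re u = B"
    define w where "w = 1 + u/2"
    have wpos: "w + of_nat k \<noteq> 0" "Re (w + of_nat k) > 0" for k
    proof -
      show "Re (w + of_nat k) > 0" using u B by (simp add: w_def)
      thus "w + of_nat k \<noteq> 0" by (metis zero_complex.sel(1) less_irrefl)
    qed
    have nonint: "w + of_nat k \<notin> \<int>\<^sub>\<le>\<^sub>0" for k
    proof
      assume "w + of_nat k \<in> \<int>\<^sub>\<le>\<^sub>0"
      then obtain n where "w + of_nat k = of_int n" "n \<le> 0" by (elim nonpos_Ints_cases)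
      hence "Re (w + of_nat k) \<le> 0" by simp
      thus False using wpos(2)[of k] by simp
    qed
    have G: "Gamma (w + 3) = w * (w + 1) * (w + 2) * Gamma w"
      using Gamma_plus1[OF nonint[of 0]] Gamma_plus1[OF nonint[of 1]] Gamma_plus1[OF nonint[of 2]]
      by (simp add: algebra_simps)
    define r where "r = norm u"
    have r: "norm (w + of_nat k) \<ge> r / 2" for k
    proof -
      have "(norm (u / 2))\<^sup>2 \<le> (norm (w + of_nat k))\<^sup>2"
        using u B unfolding cmod_power2 by (auto simp: w_def intro!: add_mono power_mono)
      thus ?thesis using power2_le_imp_le[of "norm (u/2)"] by (simp add: r_def norm_divide)
    qed
    have rB: "r \<ge> B" using abs_Re_le_cmod[of u] u by (simp add: r_def)
    have "norm (Gamma w) * (r/2)^3 \<le> norm (Gamma w) * (norm (w + of_nat 0) * norm (w + of_nat 1) * norm (w + of_nat 2))"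
    proof (intro mult_left_mono)
      have "(r/2)^3 = (r/2) * (r/2) * (r/2)" by (simp add: power3_eq_cube)
      also have "\<dots> \<le> norm (w + of_nat 0) * norm (w + of_nat 1) * norm (w + of_nat 2)"
        using rB B by (intro mult_mono r) auto
      finally show "(r/2)^3 \<le> norm (w + of_nat 0) * norm (w + of_nat 1) * norm (w + of_nat 2)" .
    qed auto
    also have "\<dots> = norm (Gamma (w + 3))" unfolding G by (simp add: norm_mult)
    also have "\<dots> \<le> Gamma (Re (w + 3))" by (rule norm_Gamma_le) (use u B in \<open>simp add: w_def\<close>)
    also have "Re (w + 3) = 1 + B/2 + 3" by (simp add: w_def u)
    finally have Gw: "norm (Gamma w) * (r/2)^3 \<le> Gamma (1 + B/2 + 3)" .
    have Zn: "norm (dirichlet_zeta u) \<le> Z"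
    proof -
      have n: "norm (of_nat (Suc n) powr (- u)) = exp (- B * ln (real (Suc n)))" for n
        using u by (subst norm_powr_real_powr) (auto simp: powr_def)
      have "summable (\<lambda>n. norm (of_nat (Suc n) powr (- u)))"
        unfolding n by (rule summable_dirichlet_real[OF B])
      from summable_norm[OF this] have "norm (\<Sum>n. of_nat (Suc n) powr (- u)) \<le> (\<Sum>n. norm (of_nat (Suc n) powr (- u)))" .
      thus ?thesis unfolding dirichlet_zeta_def Z_def n .
    qed
    have Z0: "Z \<ge> 0" using Zn norm_ge_zero[of "dirichlet_zeta u"] by linarith
    have "norm (of_real (B\<^sup>2) - (u - 1/2)\<^sup>2) \<le> B\<^sup>2 + (r + 1)\<^sup>2"
    proof -
      have "norm (u - 1/2) \<le> r + 1" using norm_triangle_ineq4[of u "1/2"] by (simp add: r_def)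
      hence "norm ((u - 1/2)\<^sup>2) \<le> (r + 1)\<^sup>2" by (simp add: norm_power power_mono)
      thus ?thesis using norm_triangle_ineq4[of "of_real (B\<^sup>2)" "(u - 1/2)\<^sup>2"] by (simp add: norm_power)
    qed
    also have "\<dots> \<le> 5 * r\<^sup>2"
    proof -
      have "B\<^sup>2 \<le> r\<^sup>2" by (rule power_mono) (use rB B in auto)
      moreover have "(r + 1)\<^sup>2 \<le> (2 * r)\<^sup>2" by (rule power_mono) (use rB B in auto)
      ultimately show ?thesis by (simp add: power_mult_distrib)
    qed
    finally have q: "norm (of_real (B\<^sup>2) - (u - 1/2)\<^sup>2) \<le> 5 * r\<^sup>2" .
    have u1: "norm (u - 1) \<le> 2 * r" using norm_triangle_ineq4[of u 1] rB B by (simp add: r_def)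
    define p where "p = exp (- (B/2) * ln pi)"
    \<comment> \<open>The factors \<open>u - 1\<close>, \<open>5 r\<^sup>2\<close> and \<open>(r / 2)\<^sup>3\<close> account for the constant \<open>80 = 2 \<cdot> 5 \<cdot> 2\<^sup>3\<close> in \<open>C\<close>.\<close>
    have "norm (entire_xi u) = norm (u - 1) * p * norm (dirichlet_zeta u) * norm (Gamma w)"
      using entire_xi_eq_zeta[of u] u B by (simp add: norm_mult w_def p_def)
    hence "norm (entire_xi u * (of_real (B\<^sup>2) - (u - 1/2)\<^sup>2)) =
        norm (u - 1) * p * norm (dirichlet_zeta u) * norm (Gamma w) * norm (of_real (B\<^sup>2) - (u - 1/2)\<^sup>2)"
      by (simp add: norm_mult)
    also have "\<dots> \<le> (2 * r) * p * Z * norm (Gamma w) * (5 * r\<^sup>2)"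
      using rB B Z0 by (intro mult_mono u1 Zn q order_refl mult_nonneg_nonneg) (auto simp: p_def)
    also have "\<dots> = (80 * p * Z) * (norm (Gamma w) * (r/2)^3)"
      by (simp add: power2_eq_square power3_eq_cube)
    also have "\<dots> \<le> (80 * p * Z) * Gamma (1 + B/2 + 3)"
      using Z0 by (intro mult_left_mono Gw) (auto simp: p_def)
    also have "\<dots> = C" by (simp add: C_def p_def)
    finally show "norm (entire_xi u * (of_real (B\<^sup>2) - (u - 1/2)\<^sup>2)) \<le> C" .
  qed
qed

text \<open>
  The multiplier \<open>A\<^sup>2 - (u - 1/2)\<^sup>2\<close> is invariant under \<open>u \<mapsto> 1 - u\<close>, so a bound on one edge of the
  strip suffices, and its modulus in the strip is at least \<open>1 + (Im u)\<^sup>2\<close>.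
\<close>

lemma entire_xi_decay:
  "\<exists>C. \<forall>u. 1 - B \<le> Re u \<and> Re u \<le> B \<longrightarrow> norm (entire_xi u) * (1 + (Im u)\<^sup>2) \<le> C"
proof -
  define A where "A = max 2 B"
  have A: "A \<ge> 2" "A \<ge> B" by (auto simp: A_def)
  define f where "f = (\<lambda>u. entire_xi u * (of_real (A\<^sup>2) - (u - 1/2)\<^sup>2))"
  obtain K where K: "\<And>u. 1 - A \<le> Re u \<Longrightarrow> Re u \<le> A \<Longrightarrow> norm (entire_xi u) \<le> K * (1 + norm u)\<^sup>2"
    using entire_xi_growth[of A] by blast
  obtain C where C: "\<And>u. Re u = A \<Longrightarrow> norm (f u) \<le> C"
    using entire_xi_edge_decay[of A] A unfolding f_def by auto
  have f_reflect: "f (1 - u) = f u" for u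
    unfolding f_def entire_xi_reflect by (simp add: power2_eq_square algebra_simps)
  have bound: "norm (f u) \<le> C" if u: "1 - A \<le> Re u" "Re u \<le> A" for u
  proof (rule phragmen_lindelof_strip[where f = f and n = 4 and K = "K * (A\<^sup>2 + 1)" and B = A])
    show "f holomorphic_on UNIV" unfolding f_def by (intro holomorphic_intros)
    fix v assume v: "1 - A \<le> Re v" "Re v \<le> A"
    have "norm (v - 1/2) \<le> 1 + norm v" using norm_triangle_ineq4[of v "1/2"] by simp
    hence n: "(norm (v - 1/2))\<^sup>2 \<le> (1 + norm v)\<^sup>2" by (rule power_mono) auto
    have "norm (of_real (A\<^sup>2) - (v - 1/2)\<^sup>2) \<le> norm (complex_of_real (A\<^sup>2)) + norm ((v - 1/2)\<^sup>2)"
      by (rule norm_triangle_ineq4)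
    also have "\<dots> = A\<^sup>2 + (norm (v - 1/2))\<^sup>2" by (simp add: norm_power)
    also have "\<dots> \<le> A\<^sup>2 + (1 + norm v)\<^sup>2" by (intro add_left_mono n)
    also have "\<dots> \<le> A\<^sup>2 * (1 + norm v)\<^sup>2 + (1 + norm v)\<^sup>2"
      using mult_left_mono[of 1 "(1 + norm v)\<^sup>2" "A\<^sup>2"] power_mono[of 1 "1 + norm v" 2] by simp
    finally have q: "norm (of_real (A\<^sup>2) - (v - 1/2)\<^sup>2) \<le> (A\<^sup>2 + 1) * (1 + norm v)\<^sup>2"
      by (simp add: algebra_simps)
    have "norm (f v) \<le> (K * (1 + norm v)\<^sup>2) * ((A\<^sup>2 + 1) * (1 + norm v)\<^sup>2)"
      unfolding f_def norm_mult using K[OF v] q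
      by (intro mult_mono) (auto intro: order_trans[OF norm_ge_zero K[OF v]])
    also have "\<dots> = (K * (A\<^sup>2 + 1)) * (1 + norm v) ^ 4" by algebra
    finally show "norm (f v) \<le> (K * (A\<^sup>2 + 1)) * (1 + norm v) ^ 4" .
  next
    fix v assume "Re v = A \<or> Re v = 1 - A"
    thus "norm (f v) \<le> C" using C[of v] C[of "1 - v"] f_reflect[of v] by auto
  qed (use u in auto)
  show ?thesis
  proof (intro exI allI impI)
    fix u assume "1 - B \<le> Re u \<and> Re u \<le> B"
    hence u: "1 - A \<le> Re u" "Re u \<le> A" using A by auto
    have "1 + (Im u)\<^sup>2 \<le> Re (of_real (A\<^sup>2) - (u - 1/2)\<^sup>2)"
    proof -
      have "(Re u - 1/2)\<^sup>2 \<le> (A - 1/2)\<^sup>2" using u by (intro abs_le_square_iff[THEN iffD1]) auto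
      also have "\<dots> = A\<^sup>2 - A + 1/4" by (simp add: power2_eq_square algebra_simps)
      finally show ?thesis using A by (simp add: power2_eq_square algebra_simps)
    qed
    also have "\<dots> \<le> norm (of_real (A\<^sup>2) - (u - 1/2)\<^sup>2)" by (rule complex_Re_le_cmod)
    finally have "norm (entire_xi u) * (1 + (Im u)\<^sup>2) \<le> norm (f u)"
      unfolding f_def norm_mult by (intro mult_left_mono) auto
    also have "\<dots> \<le> C" by (rule bound[OF u])
    finally show "norm (entire_xi u) * (1 + (Im u)\<^sup>2) \<le> C" .
  qed
qed

section \<open>Cauchy transforms of xi along vertical lines\<close>

text \<open>
  Up to the factor \<open>2 \<pi>\<close>, this is the Cauchy transform \<open>(1 / (2 \<pi> i)) \<integral> \<xi>(u) / (u - a) du\<close>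
  along the upward line \<open>Re u = b\<close>.
\<close>

definition xi_line :: "real \<Rightarrow> complex \<Rightarrow> complex" where
  "xi_line b a = (LINT w|lborel. entire_xi (Complex b w) / (Complex b w - a))"

lemma entire_xi_continuous: "continuous_on UNIV entire_xi"
  by (rule holomorphic_on_imp_continuous_on) (rule entire_xi_holomorphic[OF holomorphic_on_ident])

lemma xi_line_continuous:
  assumes "b \<noteq> Re a"
  shows "continuous_on A (\<lambda>w. entire_xi (Complex b w) / (Complex b w - a))"
proof (intro continuous_intros continuous_on_compose2[OF entire_xi_continuous])
  show "\<forall>w\<in>A. Complex b w - a \<noteq> 0" using assms by (auto simp: complex_eq_iff)
qed auto

lemma xi_line_integrable:
  assumes "b \<noteq> Re a"
  shows "integrable lborel (\<lambda>w. entire_xi (Complex b w) / (Complex b w - a))"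
proof -
  obtain C where C: "\<And>u. 1 - max b (1 - b) \<le> Re u \<and> Re u \<le> max b (1 - b) \<Longrightarrow> norm (entire_xi u) * (1 + (Im u)\<^sup>2) \<le> C"
    using entire_xi_decay[of "max b (1 - b)"] by blast
  show ?thesis
  proof (rule integrable_quadratic_decay)
    show "(\<lambda>w. entire_xi (Complex b w) / (Complex b w - a)) \<in> borel_measurable borel"
      by (intro borel_measurable_continuous_onI xi_line_continuous assms)
    fix w :: real
    have n: "norm (Complex b w - a) \<ge> \<bar>b - Re a\<bar>" using abs_Re_le_cmod[of "Complex b w - a"] by simp
    have "norm (entire_xi (Complex b w) / (Complex b w - a)) * (1 + w\<^sup>2) = norm (entire_xi (Complex b w)) * (1 + w\<^sup>2) / norm (Complex b w - a)"
      by (simp add: norm_divide)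
    also have "\<dots> \<le> C / \<bar>b - Re a\<bar>"
      using C[of "Complex b w"] n assms by (intro frac_le) (auto intro: order_trans[OF _ C[of "Complex b w"]])
    finally show "norm (entire_xi (Complex b w) / (Complex b w - a)) * (1 + w\<^sup>2) \<le> C / \<bar>b - Re a\<bar>" .
  qed
qed

lemma xi_line_reflect: "xi_line b a = - xi_line (1 - b) (1 - a)"
proof -
  have "xi_line b a = \<bar>-1\<bar> *\<^sub>R (LINT w|lborel. entire_xi (Complex b (0 + (-1) * w)) / (Complex b (0 + (-1) * w) - a))"
    unfolding xi_line_def by (rule lborel_integral_real_affine) auto
  also have "(\<lambda>w. entire_xi (Complex b (0 + (-1) * w)) / (Complex b (0 + (-1) * w) - a)) =
     (\<lambda>w. - (entire_xi (Complex (1 - b) w) / (Complex (1 - b) w - (1 - a))))"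
  proof
    fix w
    have "Complex b (0 + (-1) * w) = 1 - Complex (1 - b) w" by (simp add: complex_eq_iff)
    moreover have "1 - Complex (1 - b) w - a = - (Complex (1 - b) w - (1 - a))" by simp
    ultimately show "entire_xi (Complex b (0 + (-1) * w)) / (Complex b (0 + (-1) * w) - a) = - (entire_xi (Complex (1 - b) w) / (Complex (1 - b) w - (1 - a)))"
      by (simp only: entire_xi_reflect divide_minus_right)
  qed
  finally show ?thesis by (simp add: xi_line_def)
qed

text \<open>
  Cauchy's integral formula on the rectangle with vertical sides at \<open>b\<close> and \<open>b'\<close>; the
  contribution of the horizontal sides vanishes in the limit by \<open>entire_xi_decay\<close>.
\<close>

lemma xi_line_shift:
  assumes b: "b < Re a" "Re a < b'"
  shows "xi_line b' a - xi_line b a = 2 * pi * entire_xi a"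
proof -
  define f where "f = (\<lambda>u. entire_xi u / (u - a))"
  define B where "B = max b' (1 - b)"
  obtain C where C: "\<And>u. 1 - B \<le> Re u \<and> Re u \<le> B \<Longrightarrow> norm (entire_xi u) * (1 + (Im u)\<^sup>2) \<le> C"
    using entire_xi_decay[of B] by blast
  have B: "1 - B \<le> b" "b' \<le> B" by (auto simp: B_def)
  have C0: "C \<ge> 0" by (rule order_trans[OF _ C[of "Complex b 0"]]) (use b in \<open>auto simp: B_def\<close>)
  have f_cont: "continuous_on S f" if "a \<notin> S" for S
    unfolding f_def using that
    by (intro continuous_intros continuous_on_subset[OF entire_xi_continuous]) auto
  have horizontal: "norm (contour_integral (linepath (Complex x y) (Complex x' y)) f) \<le> C / (1 + y\<^sup>2) / (\<bar>y\<bar> - \<bar>Im a\<bar>) * (b' - b)"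
    if xx: "x \<in> {b..b'}" "x' \<in> {b..b'}" and y: "\<bar>y\<bar> > \<bar>Im a\<bar>" for x x' y
  proof -
    have seg: "Re u \<in> {b..b'} \<and> Im u = y" if "u \<in> closed_segment (Complex x y) (Complex x' y)" for u
    proof -
      from that obtain t where t: "0 \<le> t" "t \<le> 1" "u = (1 - t) *\<^sub>R Complex x y + t *\<^sub>R Complex x' y"
        by (auto simp: closed_segment_def)
      have "Re u = (1 - t) * x + t * x'" unfolding t(3) by simp
      moreover have "Im u = y" unfolding t(3) by (simp add: algebra_simps)
      moreover have "(1 - t) * x + t * x' \<in> {b..b'}"
        using convexD[OF convex_real_interval(5)[of b b'] xx, of "1 - t" t] t by simp
      ultimately show ?thesis by simp
    qed
    have "norm (contour_integral (linepath (Complex x y) (Complex x' y)) f) \<le> (C / (1 + y\<^sup>2) / (\<bar>y\<bar> - \<bar>Im a\<bar>)) * norm (Complex x' y - Complex x y)"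
    proof (rule contour_integral_bound_linepath)
      show "f contour_integrable_on linepath (Complex x y) (Complex x' y)"
        using seg y by (intro contour_integrable_continuous_linepath f_cont) force
      show "0 \<le> C / (1 + y\<^sup>2) / (\<bar>y\<bar> - \<bar>Im a\<bar>)" using C0 y by (auto intro!: divide_nonneg_nonneg add_nonneg_nonneg)
      fix u assume "u \<in> closed_segment (Complex x y) (Complex x' y)"
      hence u: "Re u \<in> {b..b'}" "Im u = y" using seg by auto
      have p: "1 + y\<^sup>2 > 0" by (smt (verit) zero_le_power2)
      have "norm (entire_xi u) * (1 + y\<^sup>2) \<le> C" using C[of u] u B by simp
      hence "norm (entire_xi u) \<le> C / (1 + y\<^sup>2)" using p by (simp add: field_simps)
      moreover have "norm (u - a) \<ge> \<bar>y\<bar> - \<bar>Im a\<bar>" using abs_Im_le_cmod[of "u - a"] u by simp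
      ultimately show "norm (f u) \<le> C / (1 + y\<^sup>2) / (\<bar>y\<bar> - \<bar>Im a\<bar>)"
        unfolding f_def norm_divide using y C0 p by (intro frac_le) auto
    qed
    also have "norm (Complex x' y - Complex x y) \<le> b' - b"
      using xx by (simp add: cmod_def abs_le_iff)
    hence "(C / (1 + y\<^sup>2) / (\<bar>y\<bar> - \<bar>Im a\<bar>)) * norm (Complex x' y - Complex x y) \<le> (C / (1 + y\<^sup>2) / (\<bar>y\<bar> - \<bar>Im a\<bar>)) * (b' - b)"
      using C0 y by (intro mult_left_mono) (auto intro!: divide_nonneg_nonneg add_nonneg_nonneg)
    finally show ?thesis .
  qed
  define V where "V = (\<lambda>c T. integral {-T..T} (\<lambda>w. f (Complex c w)))"
  have rect: "norm (V b' T - V b T - 2 * pi * entire_xi a) \<le> 2 * (C / (1 + T\<^sup>2) / (T - \<bar>Im a\<bar>) * (b' - b))"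
    if T: "T > \<bar>Im a\<bar>" for T
  proof -
    have bb: "b < b'" using b by simp
    have Tpos: "- T < T" using T by linarith
    have not_a: "a \<notin> closed_segment (Complex b (-T)) (Complex b' (-T))"
        "a \<notin> closed_segment (Complex b' (-T)) (Complex b' T)"
        "a \<notin> closed_segment (Complex b' T) (Complex b T)"
        "a \<notin> closed_segment (Complex b T) (Complex b (-T))"
      using b T bb Tpos by (auto simp: closed_segment_same_Re closed_segment_same_Im)
    have ci: "f contour_integrable_on linepath p q" if "a \<notin> closed_segment p q" for p q
      using that by (intro contour_integrable_continuous_linepath f_cont)
    have box: "a \<in> box (Complex b (-T)) (Complex b' T)" using b T by (auto simp: in_box_complex_iff)
    have "(f has_contour_integral (2 * pi * \<i> * winding_number (rectpath (Complex b (-T)) (Complex b' T)) a * entire_xi a)) (rectpath (Complex b (-T)) (Complex b' T))"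
      unfolding f_def
    proof (rule Cauchy_integral_formula_convex_simple)
      show "entire_xi holomorphic_on UNIV" by (rule entire_xi_holomorphic[OF holomorphic_on_ident])
      have "a \<notin> path_image (rectpath (Complex b (-T)) (Complex b' T))"
        using path_image_rectpath_inter_box[of "Complex b (-T)" "Complex b' T"] box bb Tpos by auto
      thus "path_image (rectpath (Complex b (-T)) (Complex b' T)) \<subseteq> UNIV - {a}" by auto
    qed auto
    hence "contour_integral (rectpath (Complex b (-T)) (Complex b' T)) f = 2 * pi * \<i> * entire_xi a"
      using winding_number_rectpath[OF box] by (simp add: contour_integral_unique)
    also have "contour_integral (rectpath (Complex b (-T)) (Complex b' T)) f =
        contour_integral (linepath (Complex b (-T)) (Complex b' (-T))) f + (contour_integral (linepath (Complex b' (-T)) (Complex b' T)) f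
        + (contour_integral (linepath (Complex b' T) (Complex b T)) f + contour_integral (linepath (Complex b T) (Complex b (-T))) f))"
      using ci[OF not_a(1)] ci[OF not_a(2)] ci[OF not_a(3)] ci[OF not_a(4)]
      by (simp add: rectpath_def Let_def valid_path_join contour_integrable_joinI)
    also have "contour_integral (linepath (Complex b' (-T)) (Complex b' T)) f = \<i> * V b' T"
      unfolding V_def by (rule contour_integral_linepath_same_Re) (use Tpos in auto)
    also have "contour_integral (linepath (Complex b T) (Complex b (-T))) f = - (\<i> * V b T)"
    proof -
      have "contour_integral (linepath (Complex b (-T)) (Complex b T)) f = \<i> * V b T"
        unfolding V_def by (rule contour_integral_linepath_same_Re) (use Tpos in auto)
      thus ?thesis using contour_integral_reversepath[of "linepath (Complex b (-T)) (Complex b T)" f] by simp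
    qed
    finally have "\<i> * (V b' T - V b T - 2 * pi * entire_xi a) = 
        - (contour_integral (linepath (Complex b (-T)) (Complex b' (-T))) f + contour_integral (linepath (Complex b' T) (Complex b T)) f)"
      by (simp add: algebra_simps add_eq_0_iff)
    hence "norm (V b' T - V b T - 2 * pi * entire_xi a) = norm (contour_integral (linepath (Complex b (-T)) (Complex b' (-T))) f + contour_integral (linepath (Complex b' T) (Complex b T)) f)"
      by (metis norm_minus_cancel norm_mult norm_ii mult_1)
    also have "\<dots> \<le> C / (1 + (-T)\<^sup>2) / (\<bar>-T\<bar> - \<bar>Im a\<bar>) * (b' - b) + C / (1 + T\<^sup>2) / (\<bar>T\<bar> - \<bar>Im a\<bar>) * (b' - b)"
      by (intro order_trans[OF norm_triangle_ineq add_mono] horizontal) (use bb T in auto)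
    also have "\<dots> = 2 * (C / (1 + T\<^sup>2) / (T - \<bar>Im a\<bar>) * (b' - b))"
    proof -
      have "\<bar>T\<bar> = T" "\<bar>-T\<bar> = T" "(-T)\<^sup>2 = T\<^sup>2" using T by auto
      thus ?thesis by (simp only: mult_2)
    qed
    finally show ?thesis .
  qed
  have V_lim: "(\<lambda>n. V c (real n)) \<longlonglongrightarrow> xi_line c a" if "c \<noteq> Re a" for c
    unfolding V_def xi_line_def f_def
    by (intro integral_Icc_tendsto xi_line_integrable that) real_asymp+
  have "(\<lambda>n. V b' (real n) - V b (real n) - 2 * pi * entire_xi a) \<longlonglongrightarrow> 0"
  proof (rule Lim_null_comparison)
    show "eventually (\<lambda>n. norm (V b' (real n) - V b (real n) - 2 * pi * entire_xi a) \<le> 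
        2 * (C / (1 + (real n)\<^sup>2) / (real n - \<bar>Im a\<bar>) * (b' - b))) sequentially"
    proof -
      have "eventually (\<lambda>n. real n > \<bar>Im a\<bar>) sequentially"
        using filterlim_real_sequentially by (simp add: filterlim_at_top_dense)
      thus ?thesis by eventually_elim (rule rect)
    qed
    show "(\<lambda>n. 2 * (C / (1 + (real n)\<^sup>2) / (real n - \<bar>Im a\<bar>) * (b' - b))) \<longlonglongrightarrow> 0"
      by real_asymp
  qed
  moreover have "(\<lambda>n. V b' (real n) - V b (real n) - 2 * pi * entire_xi a) \<longlonglongrightarrow> xi_line b' a - xi_line b a - 2 * pi * entire_xi a"
    using b by (intro tendsto_intros V_lim) auto
  ultimately have "xi_line b' a - xi_line b a - 2 * pi * entire_xi a = 0" by (rule LIMSEQ_unique[symmetric])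
  thus ?thesis by simp
qed

lemma half_theta_isCont: "isCont half_theta 1"
proof -
  have "uniform_limit {1/2..} (\<lambda>N x. \<Sum>n<N. exp (-pi * (real (Suc n))\<^sup>2 * x)) half_theta sequentially"
    unfolding half_theta_def
  proof (rule Weierstrass_m_test)
    show "summable (\<lambda>n. exp (-pi * (real (Suc n))\<^sup>2 * (1/2)))" by (rule summable_half_theta) simp
    show "norm (exp (-pi * (real (Suc n))\<^sup>2 * x)) \<le> exp (-pi * (real (Suc n))\<^sup>2 * (1/2))" if "x \<in> {1/2..}" for n x
      using that by (auto intro: mult_left_mono)
  qed
  hence "continuous_on {1/2..} half_theta"
    by (rule uniform_limit_theorem[rotated]) (auto intro!: always_eventually continuous_intros)
  hence "continuous_on {1/2<..} half_theta" by (rule continuous_on_subset) auto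
  thus ?thesis by (simp add: continuous_on_eq_continuous_at)
qed

text \<open>
  On the line \<open>Re u = 2\<close> the function \<open>2 \<xi>(u) / (u (u - 1)) = 2 \<xi>(u) (1 / (u - 1) - 1 / u)\<close> is the Fourier
  transform of \<open>theta_mellin 2\<close>. Inversion at \<open>0\<close> evaluates \<open>L(2, 1) - L(2, 0)\<close>, and
  reflection and shift express both terms by \<open>L(b, 1)\<close>.
\<close>

lemma xi_line_1:
  assumes "b < 1"
  shows "xi_line b 1 = of_real (pi * (theta 1 / 2 - 1))"
proof -
  define H where "H = (\<lambda>v. LINT y|lborel. exp (\<i> * of_real (v * y)) * theta_mellin 2 y)"
  have H_eq: "H v = 2 * (entire_xi (Complex 2 v) / (Complex 2 v - 1) - entire_xi (Complex 2 v) / (Complex 2 v - 0))" for v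
  proof -
    define u where "u = Complex 2 v"
    have u: "Re u > 1" "u \<noteq> 0" "u - 1 \<noteq> 0" by (auto simp: u_def complex_eq_iff)
    have ueq: "u = 2 + \<i> * of_real v" by (simp add: u_def complex_eq_iff)
    have "(\<lambda>y. exp (\<i> * of_real (v * y)) * theta_mellin 2 y) = theta_mellin u"
      by (simp add: fun_eq_iff theta_mellin_def ueq algebra_simps exp_add)
    hence "H v = 2 * entire_xi u / (u * (u - 1))"
      unfolding H_def using theta_mellin_eq_xi[OF u(1)] by simp
    also have "\<dots> = 2 * (entire_xi u / (u - 1) - entire_xi u / (u - 0))"
      using u by (simp add: field_simps)
    finally show ?thesis by (simp add: u_def)
  qed
  have i: "integrable lborel (\<lambda>v. entire_xi (Complex 2 v) / (Complex 2 v - 1))"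
      "integrable lborel (\<lambda>v. entire_xi (Complex 2 v) / (Complex 2 v - 0))"
    by (intro xi_line_integrable; simp)+
  have "integrable lborel H" unfolding H_eq by (intro integrable_mult_right Bochner_Integration.integrable_diff i)
  moreover have "integrable lborel (theta_mellin 2)"
    using theta_mellin_integral[of 2] by (simp add: has_bochner_integral_iff)
  moreover have "isCont (theta_mellin 2) 0"
  proof -
    have "isCont (\<lambda>y. half_theta (exp (2 * y))) 0"
    proof (rule isCont_o2[where f = "\<lambda>y::real. exp (2 * y)" and g = half_theta])
      show "isCont (\<lambda>y::real. exp (2 * y)) 0" by (intro continuous_intros)
    qed (use half_theta_isCont in simp)
    hence "isCont (\<lambda>y. complex_of_real (2 * half_theta (exp (2 * y)))) 0"
      by (intro continuous_of_real isCont_mult[OF continuous_const])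
    moreover have "isCont (\<lambda>y. exp (2 * complex_of_real y)) 0" by (intro continuous_intros)
    ultimately have "isCont (\<lambda>y. complex_of_real (2 * half_theta (exp (2 * y))) * exp (2 * complex_of_real y)) 0"
      by (rule isCont_mult)
    thus ?thesis unfolding theta_mellin_def[abs_def] .
  qed
  moreover have "norm (theta_mellin 2 y) \<le> 2 * (\<Sum>n. 1 / (pi * (real (Suc n))\<^sup>2))" for y
  proof -
    define x where "x = exp (2 * y)"
    have x: "x > 0" by (simp add: x_def)
    have "half_theta x * x \<le> (\<Sum>n. 1 / (pi * (real (Suc n))\<^sup>2))" using half_theta_le[OF x] x by (simp add: field_simps)
    thus ?thesis by (simp add: norm_theta_mellin x_def)
  qed
  ultimately have "(LINT v|lborel. H v) = 2 * pi * theta_mellin 2 0"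
    unfolding H_def by (intro fourier_inversion_at_0)
  moreover have "(LINT v|lborel. H v) = 2 * (xi_line 2 1 - xi_line 2 0)"
    unfolding H_eq xi_line_def
    by (simp only: Bochner_Integration.integral_mult_right_zero Bochner_Integration.integral_diff[OF i])
  moreover have "theta_mellin 2 0 = 2 * half_theta 1" by (simp add: theta_mellin_def)
  ultimately have "2 * (xi_line 2 1 - xi_line 2 0) = 2 * (2 * of_real (pi * half_theta 1))" by simp
  hence 1: "xi_line 2 1 - xi_line 2 0 = 2 * of_real (pi * half_theta 1)"
    by (rule mult_left_cancel[THEN iffD1, rotated]) simp
  have 2: "xi_line 2 0 = - xi_line (-1) 1" using xi_line_reflect[of 2 0] by simp
  have 3: "xi_line 2 1 - xi_line (-1) 1 = pi" "xi_line 2 1 - xi_line b 1 = pi"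
    using xi_line_shift[of "-1" 1 2] xi_line_shift[of b 1 2] assms by auto
  \<comment> \<open>The lines at \<open>-1\<close> and at \<open>b\<close> are on the same side of \<open>1\<close>.\<close>
  have "xi_line (-1) 1 = xi_line b 1" using 3 by (metis diff_diff_eq2 diff_add_cancel add_diff_cancel_left')
  hence "2 * xi_line b 1 + of_real pi = 2 * of_real (pi * half_theta 1)"
    using 1 2 3(2) by (simp add: algebra_simps)
  hence "xi_line b 1 = (2 * of_real (pi * half_theta 1) - of_real pi) / 2" by (simp add: eq_divide_eq algebra_simps)
  also have "\<dots> = of_real ((2 * (pi * half_theta 1) - pi) / 2)" by simp
  also have "(2 * (pi * half_theta 1) - pi) / 2 = pi * (theta 1 / 2 - 1)" by (simp add: theta_def field_simps)
  finally show ?thesis .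
qed

section \<open>The zeta function and the integral J\<close>

text \<open>
  At \<open>u = 1\<close> this is \<open>0\<close>, by division by zero, in accordance with the value that \<open>zeta\<close> is given
  there.
\<close>

definition zeta_via_xi :: "complex \<Rightarrow> complex" where
  "zeta_via_xi u = entire_xi u * exp (u / 2 * of_real (ln pi)) * rGamma (1 + u / 2) / (u - 1)"

lemma zeta_via_xi_holomorphic: "zeta_via_xi holomorphic_on (- {1})"
  unfolding zeta_via_xi_def by (intro holomorphic_intros) auto

lemma rGamma_nonzero: "Re z > 0 \<Longrightarrow> rGamma z \<noteq> 0"
  by (auto simp: rGamma_eq_zero_iff elim!: nonpos_Ints_cases)

lemma zeta_via_xi_eq_dirichlet:
  assumes u: "Re u > 1"
  shows "zeta_via_xi u = dirichlet_zeta u"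
proof -
  have "u \<noteq> 1" using u by auto
  define G where "G = Gamma (1 + u / 2)"
  have "rGamma (1 + u / 2) \<noteq> 0" using u by (intro rGamma_nonzero) auto
  hence G: "rGamma (1 + u / 2) = 1 / G" "G \<noteq> 0"
    by (auto simp: G_def Gamma_def field_simps)
  have "exp (- (u / 2) * of_real (ln pi)) * exp (u / 2 * of_real (ln pi)) = 1"
    by (simp flip: exp_add)
  moreover have "zeta_via_xi u = (exp (- (u / 2) * of_real (ln pi)) * exp (u / 2 * of_real (ln pi))) * dirichlet_zeta u * (G / G) * ((u - 1) / (u - 1))"
    unfolding zeta_via_xi_def entire_xi_eq_zeta[OF u] G(1) by (simp add: G_def mult_ac)
  ultimately show ?thesis using G(2) \<open>u \<noteq> 1\<close> by simp
qed

text \<open>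
  Both functions are holomorphic on the connected set \<open>- {1}\<close> and agree for \<open>Re s > 1\<close>, so the
  description that defines \<open>zeta\<close> is satisfied by exactly one function.
\<close>

lemma zeta_eq: "zeta = zeta_via_xi"
  unfolding zeta_def
proof (rule the_equality)
  show "zeta_via_xi holomorphic_on - {1} \<and> (\<forall>s. 1 < Re s \<longrightarrow> (\<lambda>n. of_nat (Suc n) powr - s) sums zeta_via_xi s) \<and> zeta_via_xi 1 = 0"
  proof (intro conjI allI impI zeta_via_xi_holomorphic)
    show "(\<lambda>n. of_nat (Suc n) powr - s) sums zeta_via_xi s" if "1 < Re s" for s
      unfolding zeta_via_xi_eq_dirichlet[OF that] by (rule dirichlet_zeta_sums[OF that])
  qed (simp add: zeta_via_xi_def)
next
  fix f :: "complex \<Rightarrow> complex"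
  assume f: "f holomorphic_on - {1} \<and> (\<forall>s. 1 < Re s \<longrightarrow> (\<lambda>n. of_nat (Suc n) powr - s) sums f s) \<and> f 1 = 0"
  have "f s = zeta_via_xi s" if "s \<noteq> 1" for s
  proof (rule analytic_continuation_open[of "{s. Re s > 1}" "- {1}" f zeta_via_xi])
    show "f z = zeta_via_xi z" if "z \<in> {s. 1 < Re s}" for z
    proof -
      have z: "1 < Re z" using that by simp
      have "(\<lambda>n. of_nat (Suc n) powr - z) sums f z" using f z by blast
      from sums_unique2[OF this dirichlet_zeta_sums[OF z]] show ?thesis
        by (simp add: zeta_via_xi_eq_dirichlet[OF z])
    qed
    show "{s. Re s > 1} \<noteq> {}" by (metis (mono_tags) Re_complex_of_real empty_iff mem_Collect_eq lt_ex gt_ex)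
    show "connected (- {1 :: complex})" by (rule connected_punctured_universe) simp
  qed (use f that zeta_via_xi_holomorphic in \<open>auto intro: open_halfspace_Re_gt\<close>)
  moreover have "f 1 = zeta_via_xi 1" using f by (simp add: zeta_via_xi_def)
  ultimately show "f = zeta_via_xi" by (metis ext)
qed

lemma riemann_xi_eq:
  assumes "0 \<le> Re s"
  shows "riemann_xi s = entire_xi s"
  unfolding riemann_xi_def
proof (rule remove_sings_eqI)
  have "eventually (\<lambda>z. entire_xi z = (z - 1) * of_real pi powr (- z / 2) * zeta z * Gamma (1 + z / 2)) (at s)"
  proof -
    have "eventually (\<lambda>z. z \<in> {z. Re z > -1}) (nhds s)"
      using assms by (intro eventually_nhds_in_open open_halfspace_Re_gt) auto
    hence "eventually (\<lambda>z. z \<in> {z. Re z > -1}) (at s)" by (simp add: eventually_nhds_conv_at)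
    moreover have "eventually (\<lambda>z. z \<noteq> 1) (at s)" by (rule eventually_neq_at_within)
    ultimately show ?thesis
    proof eventually_elim
      case (elim z)
      have "rGamma (1 + z / 2) \<noteq> 0" using elim by (intro rGamma_nonzero) auto
      hence G: "rGamma (1 + z / 2) * Gamma (1 + z / 2) = 1" by (simp add: Gamma_def)
      have p: "complex_of_real pi powr (- z / 2) = exp (- (z / 2) * of_real (ln pi))"
        by (simp add: powr_def Ln_of_real)
      have "(z - 1) * of_real pi powr (- z / 2) * zeta z * Gamma (1 + z / 2) =
         entire_xi z * (exp (- (z / 2) * of_real (ln pi)) * exp (z / 2 * of_real (ln pi))) * (rGamma (1 + z / 2) * Gamma (1 + z / 2)) * ((z - 1) / (z - 1))"
        unfolding zeta_eq zeta_via_xi_def p by (simp add: mult_ac)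
      also have "\<dots> = entire_xi z" unfolding G using elim by (simp flip: exp_add)
      finally show ?case by simp
    qed
  qed
  moreover have "(entire_xi \<longlongrightarrow> entire_xi s) (at s)"
    using entire_xi_continuous by (simp add: continuous_on_eq_continuous_at isCont_def)
  ultimately show "((\<lambda>s. (s - 1) * of_real pi powr (- s / 2) * zeta s * Gamma (1 + s / 2)) \<longlongrightarrow> entire_xi s) (at s)"
    by (rule Lim_transform_eventually[rotated])
qed

text \<open>
  Points with \<open>Im z \<noteq> 0\<close> avoid all poles of the Gamma function. On a vertical line they miss only one
  point, which does not matter for the integral.
\<close>

lemma zeta_Gamma_eq:
  assumes "Im z \<noteq> 0"
  shows "zeta_Gamma z = entire_xi (2 * z - 2) * of_real pi powr (z - 1) / (2 * z - 3)"
  unfolding zeta_Gamma_def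
proof (rule remove_sings_eqI)
  let ?g = "\<lambda>z. entire_xi (2 * z - 2) * of_real pi powr (z - 1) / (2 * z - 3)"
  have "eventually (\<lambda>w. w \<in> {w. Im w \<noteq> 0}) (nhds z)"
  proof (rule eventually_nhds_in_open)
    have "{w. Im w \<noteq> 0} = {w. Im w > 0} \<union> {w. Im w < 0}" by auto
    thus "open {w. Im w \<noteq> 0}" by (simp add: open_Un open_halfspace_Im_gt open_halfspace_Im_lt)
  qed (use assms in auto)
  hence "eventually (\<lambda>w. w \<in> {w. Im w \<noteq> 0}) (at z)" by (simp add: eventually_nhds_conv_at)
  hence "eventually (\<lambda>w. ?g w = zeta (2 * w - 2) * Gamma w) (at z)"
  proof eventually_elim
    case (elim w)
    have "w \<notin> \<int>\<^sub>\<le>\<^sub>0" using elim by (auto elim!: nonpos_Ints_cases)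
    hence G: "rGamma w * Gamma w = 1" by (simp add: Gamma_def rGamma_eq_zero_iff)
    have p: "complex_of_real pi powr (w - 1) = exp ((w - 1) * of_real (ln pi))"
      by (simp add: powr_def Ln_of_real)
    have w: "(2 * w - 2) / 2 = w - 1" "1 + (2 * w - 2) / 2 = w" "2 * w - 2 - 1 = 2 * w - 3" by (auto simp: diff_divide_distrib)
    have "zeta (2 * w - 2) * Gamma w = entire_xi (2 * w - 2) * exp ((w - 1) * of_real (ln pi)) / (2 * w - 3) * (rGamma w * Gamma w)"
      unfolding zeta_eq zeta_via_xi_def w by (simp add: mult_ac)
    thus ?case unfolding G p by simp
  qed
  moreover have "(?g \<longlongrightarrow> ?g z) (at z)"
  proof -
    have nz: "2 * z - 3 \<noteq> 0" using assms by (auto simp: complex_eq_iff)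
    have p: "complex_of_real pi powr (w - 1) = exp ((w - 1) * of_real (ln pi))" for w
      by (simp add: powr_def Ln_of_real)
    have "isCont entire_xi (2 * z - 2)"
      using entire_xi_continuous by (simp add: continuous_on_eq_continuous_at)
    moreover have "((\<lambda>w. 2 * w - 2) \<longlongrightarrow> 2 * z - 2) (at z)" by (intro tendsto_intros)
    ultimately have "((\<lambda>w. entire_xi (2 * w - 2)) \<longlongrightarrow> entire_xi (2 * z - 2)) (at z)"
      by (rule isCont_tendsto_compose)
    thus ?thesis unfolding p by (intro tendsto_intros nz)
  qed
  ultimately show "((\<lambda>z. zeta (2 * z - 2) * Gamma z) \<longlongrightarrow> ?g z) (at z)"
    by (rule Lim_transform_eventually[rotated])
qed

text \<open>
  The left-hand side is \<open>M\<close> divided by \<open>u - 1\<close>, in the variable \<open>u\<close>. The numerator of \<open>M\<close> is such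
  that the residues at \<open>1\<close>, \<open>s\<close> and \<open>1 - s\<close> do not depend on \<open>s\<close>. The identity remains valid at \<open>s = 1/2\<close>, where two of the poles coincide.
\<close>

lemma kernel_partial_fractions:
  fixes u s :: complex
  assumes "u \<noteq> 1" "u \<noteq> s" "u \<noteq> 1 - s"
  shows "1 / (u - 1) * ((u - 1/2 - 2 * (s - 1/2)\<^sup>2) / ((u - s) * (u - (1 - s)))) =
     2 / (u - 1) - 1 / (u - s) - 1 / (u - (1 - s))"
proof -
  have gen: "1 / p * ((2 * (q * r) - p * r - p * q) / (q * r)) = 2 / p - 1 / q - 1 / r"
    if "p \<noteq> 0" "q \<noteq> 0" "r \<noteq> 0" for p q r :: complex
    using that by (simp add: field_simps)
  have "u - 1/2 - 2 * (s - 1/2)\<^sup>2 = 2 * ((u - s) * (u - (1 - s))) - (u - 1) * (u - (1 - s)) - (u - 1) * (u - s)"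
    by (simp add: power2_eq_square field_simps)
  thus ?thesis using gen[of "u - 1" "u - s" "u - (1 - s)"] assms by simp
qed

lemma M_eq_quotient:
  fixes c v :: real and s :: complex
  defines "u \<equiv> - 2 * of_real c - 2 + 2 * \<i> * of_real v"
  shows "M c s v = (u - 1/2 - 2 * (s - 1/2)\<^sup>2) / ((u - s) * (u - (1 - s)))"
proof -
  have "- (2 * s - 1)\<^sup>2 / 2 + 2 * \<i> * of_real v - 2 * (of_real c + 5 / 4) = u - 1/2 - 2 * (s - 1/2)\<^sup>2"
    by (simp add: u_def power2_eq_square field_simps)
  moreover have "- (2 * s - 1)\<^sup>2 / 4 + 2 * \<i> * (2 * \<i> * of_real v - 4 * (of_real c + 5 / 4)) * of_real v
        + 4 * (of_real c + 5 / 4)\<^sup>2 = (u - s) * (u - (1 - s))"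
    by (simp add: u_def power2_eq_square field_simps)
  ultimately show ?thesis by (simp only: M_def)
qed

lemma J_eq_xi_lines:
  assumes c: "c > - 3 / 2" and b: "b = - 2 * c - 2" "b \<noteq> Re s" "b \<noteq> 1 - Re s"
  shows "J s c = (2 * xi_line b 1 - xi_line b s - xi_line b (1 - s)) / (2 * pi)"
proof -
  define F where "F = (\<lambda>w. 2 * (entire_xi (Complex b w) / (Complex b w - 1)) - entire_xi (Complex b w) / (Complex b w - s) - entire_xi (Complex b w) / (Complex b w - (1 - s)))"
  have b1: "b \<noteq> Re 1" using b c by simp
  have b2: "b \<noteq> Re s" "b \<noteq> Re (1 - s)" using b by auto
  note i = xi_line_integrable[OF b1] xi_line_integrable[OF b2(1)] xi_line_integrable[OF b2(2)]
  have F_int: "(LINT w|lborel. F w) = 2 * xi_line b 1 - xi_line b s - xi_line b (1 - s)"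
    unfolding F_def xi_line_def
    by (simp only: Bochner_Integration.integral_diff[OF Bochner_Integration.integrable_diff[OF integrable_mult_right[OF i(1)] i(2)] i(3)]
       Bochner_Integration.integral_diff[OF integrable_mult_right[OF i(1)] i(2)] integral_mult_right_zero)
  have F_meas: "F \<in> borel_measurable borel"
    unfolding F_def by (intro borel_measurable_diff borel_measurable_times borel_measurable_const borel_measurable_continuous_onI xi_line_continuous b1 b2)
  have eq: "of_real pi powr (of_real c - \<i> * of_real v) * zeta_Gamma (- of_real c + \<i> * of_real v) * M c s v = F (0 + 2 * v) / pi"
    if v: "v \<noteq> 0" for v
  proof -
    define z where "z = - of_real c + \<i> * of_real v"
    define u where "u = - 2 * of_real c - 2 + 2 * \<i> * of_real v"
    have u: "u = Complex b (0 + 2 * v)" "2 * z - 2 = u" "2 * z - 3 = u - 1"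
      by (auto simp: u_def z_def b complex_eq_iff)
    have neq: "u \<noteq> 1" "u \<noteq> s" "u \<noteq> 1 - s"
      using b1 b2 unfolding u(1) by (auto simp: complex_eq_iff)
    have Imz: "Im z \<noteq> 0" using v by (simp add: z_def)
    have p: "complex_of_real pi powr (of_real c - \<i> * of_real v) * of_real pi powr (z - 1) = 1 / of_real pi"
    proof -
      have "complex_of_real pi powr (of_real c - \<i> * of_real v) * of_real pi powr (z - 1) = of_real pi powr (-1)"
        by (simp add: z_def flip: powr_add)
      thus ?thesis by (simp add: powr_minus_divide)
    qed
    have "of_real pi powr (of_real c - \<i> * of_real v) * zeta_Gamma z * M c s v =
      (complex_of_real pi powr (of_real c - \<i> * of_real v) * of_real pi powr (z - 1)) * entire_xi u *
        (1 / (u - 1) * ((u - 1/2 - 2 * (s - 1/2)\<^sup>2) / ((u - s) * (u - (1 - s)))))"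
      unfolding zeta_Gamma_eq[OF Imz] M_eq_quotient u(2,3) u_def[symmetric] by (simp only: mult_ac times_divide_eq_left times_divide_eq_right mult_1_left)
    also have "\<dots> = F (0 + 2 * v) / pi"
    proof -
      have gen: "(1 / q) * E * (2 / A - 1 / B - 1 / C) = (2 * (E / A) - E / B - E / C) / q" for q E A B C :: complex
        by (simp add: right_diff_distrib diff_divide_distrib mult.commute)
      show ?thesis
        unfolding p kernel_partial_fractions[OF neq] F_def u(1)[symmetric] by (rule gen)
    qed
    finally show ?thesis by (simp only: z_def)
  qed
  have "J s c = (LINT v|lborel. F (0 + 2 * v) / pi)"
    \<comment> \<open>The point \<open>v = 0\<close>, where the line may meet a pole of the Gamma function, is a null set.\<close>
    unfolding J_def by (rule integral_discrete_difference[where X = "{0}"]) (use eq in auto)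
  also have "\<dots> = (LINT v|lborel. F (0 + 2 * v)) / pi" by simp
  also have "(LINT v|lborel. F (0 + 2 * v)) = (LINT w|lborel. F w) / 2"
    using lborel_integral_real_affine[of 2 F 0] by (simp add: scaleR_conv_of_real)
  finally show ?thesis unfolding F_int by simp
qed

theorem mainTheorem2:
  fixes s :: complex and \<sigma> t c :: real and K :: complex
  assumes s: "s = of_real \<sigma> + \<i> * of_real t"
    and \<sigma>: "0 \<le> \<sigma>" "\<sigma> \<le> 1"
    and c: "c > - 3 / 2"
    and K: "K = of_real (pi powr (1 / 4) / (2 * Gamma (3 / 4)))"
  shows "(c < - \<sigma> / 2 - 1 \<and> c < \<sigma> / 2 - 3 / 2 \<longrightarrow> riemann_xi s = K - 1 - J s c) \<and>
         (- \<sigma> / 2 - 1 < c \<and> c < \<sigma> / 2 - 3 / 2 \<longrightarrow> 0 = K - 1 - J s c) \<and>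
         (\<sigma> / 2 - 3 / 2 < c \<and> c < - \<sigma> / 2 - 1 \<longrightarrow> 0 = K - 1 - J s c) \<and>
         (c > - \<sigma> / 2 - 1 \<and> c > \<sigma> / 2 - 3 / 2 \<longrightarrow> - riemann_xi s = K - 1 - J s c)"
proof -
  define b where "b = - 2 * c - 2"
  have Re_s: "Re s = \<sigma>" by (simp add: s)
  have b1: "b < 1" using c by (simp add: b_def)
  have xi: "riemann_xi s = entire_xi s" using riemann_xi_eq[of s] \<sigma> Re_s by simp
  have K': "K = of_real (theta 1 / 2)" unfolding K theta_1 by (simp add: field_simps)
  \<comment> \<open>Since \<open>1 - \<sigma>\<close> is on the right of \<open>b\<close> exactly if \<open>1 - b\<close> is on the right of \<open>\<sigma>\<close>, only the point \<open>s\<close> remains.\<close>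
  have F: "xi_line b (1 - s) = - xi_line (1 - b) s" using xi_line_reflect[of b "1 - s"] by simp
  have main: "K - 1 - J s c = (xi_line b s - xi_line (1 - b) s) / (2 * pi)" if "b \<noteq> \<sigma>" "b \<noteq> 1 - \<sigma>"
  proof -
    have "J s c = (2 * of_real (pi * (theta 1 / 2 - 1)) - xi_line b s + xi_line (1 - b) s) / (2 * pi)"
      using J_eq_xi_lines[OF c b_def, of s] that Re_s xi_line_1[OF b1] F by simp
    thus ?thesis unfolding K' by (simp add: field_simps)
  qed
  show ?thesis
  proof (intro conjI impI; elim conjE)
    assume "c < - \<sigma> / 2 - 1" "c < \<sigma> / 2 - 3 / 2"
    hence *: "b > \<sigma>" "1 - b < \<sigma>" by (auto simp: b_def)
    thus "riemann_xi s = K - 1 - J s c"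
      using main xi_line_shift[of "1 - b" s b] Re_s by (simp add: xi)
  next
    assume "- \<sigma> / 2 - 1 < c" "c < \<sigma> / 2 - 3 / 2"
    hence *: "b < \<sigma>" "1 - b < \<sigma>" by (auto simp: b_def)
    have "xi_line (\<sigma> + 1) s - xi_line b s = xi_line (\<sigma> + 1) s - xi_line (1 - b) s"
      using xi_line_shift[of b s "\<sigma> + 1"] xi_line_shift[of "1 - b" s "\<sigma> + 1"] * Re_s by simp
    hence "xi_line b s = xi_line (1 - b) s" by simp
    thus "0 = K - 1 - J s c" using main * by simp
  next
    assume "\<sigma> / 2 - 3 / 2 < c" "c < - \<sigma> / 2 - 1"
    hence *: "b > \<sigma>" "1 - b > \<sigma>" by (auto simp: b_def)
    have "xi_line b s - xi_line (\<sigma> - 1) s = xi_line (1 - b) s - xi_line (\<sigma> - 1) s"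
      using xi_line_shift[of "\<sigma> - 1" s b] xi_line_shift[of "\<sigma> - 1" s "1 - b"] * Re_s by simp
    hence "xi_line b s = xi_line (1 - b) s" by simp
    thus "0 = K - 1 - J s c" using main * by simp
  next
    assume "c > - \<sigma> / 2 - 1" "c > \<sigma> / 2 - 3 / 2"
    hence *: "b < \<sigma>" "1 - b > \<sigma>" by (auto simp: b_def)
    hence "xi_line (1 - b) s - xi_line b s = 2 * pi * entire_xi s"
      using xi_line_shift[of b s "1 - b"] Re_s by simp
    hence "(xi_line b s - xi_line (1 - b) s) / (2 * pi) = - entire_xi s" by (simp add: field_simps)
    thus "- riemann_xi s = K - 1 - J s c" using main * by (simp add: xi)
  qed
qed

end
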